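(* Let $(X,d,\mu)$ be a quasi-metric-measure space where the measure $\mu$ is doubling, i.e., there is a constant $C_\mu\in[1,\infty)$ with $\mu(B_d(x,2r))\le C_\mu\,\mu(B_d(x,r))$ for all $x\in X$ and $r\in(0,\infty)$. Fix $\alpha,p\in(0,\infty)$, $\tilde p\in(0,p]$, and $q\in(0,\infty]$ with $\alpha\preceq_q\mathrm{ind}(X,d)$. Suppose that either of the embeddings $$M^\alpha_{p,q}(X,d,\mu)\hookrightarrow L^{\tilde p}(X,\mu)\quad\text{or}\quad N^\alpha_{p,q}(X,d,\mu)\hookrightarrow L^{\tilde p}(X,\mu)$$ is compact. Then the following statements are valid for all $\beta,u\in(0,\infty)$, $v\in(0,\infty]$, and every $s\in(0,\infty)$ such that $\mu(B_d(x,\lambda r))\le4^s\lambda^s\mu(B_d(x,r))$ for all $x\in X$, $r\in(0,\infty)$, $\lambda\in[1,\infty)$: (1) If $\beta u<s$, then for each fixed $\tilde q\in(0,su/(s-\beta u))$ the embeddings $M^\beta_{u,v}(X,d,\mu)\hookrightarrow L^{\tilde q}(X,\mu)$ and $N^\beta_{u,v}(X,d,\mu)\hookrightarrow L^{\tilde q}(X,\mu)$ are compact. (2) If $\beta u>s$, then for each fixed $\gamma\in(0,\beta-s/u)$ the embeddings $M^\beta_{u,v}(X,d,\mu)\hookrightarrow\mathcal C^\gamma(X,d)$ and $N^\beta_{u,v}(X,d,\mu)\hookrightarrow\mathcal C^\gamma(X,d)$ are compact. Moreover, the embeddings $M^\beta_{u,v}(X,d,\mu)\hookrightarrow L^{\tilde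 q}(X,\mu)$ and $N^\beta_{u,v}(X,d,\mu)\hookrightarrow L^{\tilde q}(X,\mu)$ are compact for all $\tilde q\in(0,\infty)$.
   Context: A quasi-metric space $(X,d)$ is a set $X$ with at least two elements and a function $d:X\times X\to[0,\infty)$ for which there are constants $C_0,C_1\in(0,\infty)$ such that for all $x,y,z\in X$: $d(x,y)=0$ iff $x=y$; $d(y,x)\le C_0 d(x,y)$; $d(x,y)\le C_1\max\{d(x,z),d(z,y)\}$ (symmetry is not required). For a quasi-metric $\rho$, $C_\rho:=\sup\frac{\rho(x,y)}{\max\{\rho(x,z),\rho(z,y)\}}\in[1,\infty)$, the supremum over all $x,y,z\in X$ not all equal. Balls are $B_d(x,r):=\{y\in X:d(x,y)<r\}$. The topology $\tau_d$ consists of all $\mathcal O\subseteq X$ such that for each $x\in\mathcal O$ there is $r>0$ with $B_d(x,r)\subseteq\mathcal O$. A quasi-metric-measure space $(X,d,\mu)$ is a quasi-metric space with a nonnegative measure $\mu$ on a $\sigma$-algebra containing the Borel sets of $\tau_d$, such that all $d$-balls are measurable and $\mu(B_d(x,r))\in(0,\infty)$ for all $x\in X$, $r\in(0,\infty)$. Quasi-metrics $d,\rho$ are equivalent ($\rho\approx d$) if $\kappa^{-1}\rho\le d\le\kappa\rho$ on $X\times X$ for some constant $\kappa>0$. $\mathrm{ind}(X,d):=\sup_{\rho\approx d}(\log_2C_\rho)^{-1}\in(0,\infty]$ (with $1/0:=\infty$). The notation $\alpha\preceq_q\mathrm{ind}(X,d)$ means $\alpha\le\mathrm{ind}(X,d)$,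 where $\alpha=\mathrm{ind}(X,d)$ is permitted only when $q=\infty$ and the supremum defining $\mathrm{ind}(X,d)$ is attained. For a doubling measure, the inequality required of $s$ holds for every $s\in(0,\infty)$ with $s\ge\log_2C_\mu$. Fractional gradients: for $\alpha\in(0,\infty)$ and measurable $f:X\to\mathbb R$, $\mathbb D^\alpha_d(f)$ is the set of sequences $\vec g=\{g_k\}_{k\in\mathbb Z}$ of nonnegative measurable functions on $X$ for which there is a measurable $E$ with $\mu(E)=0$ and $|f(x)-f(y)|\le[d(x,y)]^\alpha(g_k(x)+g_k(y))$ for all $k\in\mathbb Z$ and $x,y\in X\setminus E$ with $2^{-k-1}\le d(x,y)<2^{-k}$. The Hajłasz–Triebel–Lizorkin space $M^\alpha_{p,q}(X,d,\mu)$ is the set of $f\in L^p(X,\mu)$ with finite (quasi-)norm $\|f\|_{L^p(X,\mu)}+\inf_{\vec g\in\mathbb D^\alpha_d(f)}\big\|\,\|\{g_k\}_k\|_{\ell^q(\mathbb Z)}\big\|_{L^p(X,\mu)}$; the Hajłasz–Besov space $N^\alpha_{p,q}(X,d,\mu)$ is the set of $f\in L^p(X,\mu)$ with finite (quasi-)norm $\|f\|_{L^p(X,\mu)}+\inf_{\vec g\in\mathbb D^\alpha_d(f)}\big\|\{\|g_k\|_{L^p(X,\mu)}\}_k\big\|_{\ell^q(\mathbb Z)}$. Hölder space: for $\beta\in(0,\infty)$, $\mathcal C^\beta(X,d)$ is the set of bounded $f:X\to\mathbb R$ with finite norm $\sup_{x\in X}|f(x)|+\sup_{x\ne y}\frac{|f(x)-f(y)|}{[d(x,y)]^\beta}$.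 Functions are identified when equal $\mu$-a.e.; an embedding into $\mathcal C^\beta(X,d)$ means that each function agrees $\mu$-a.e. with a (necessarily unique) element of $\mathcal C^\beta(X,d)$. An embedding is compact if the natural map is well defined and maps bounded sets to totally bounded sets. *)

theory Defs
  imports "HOL-Analysis.Analysis"
begin

section \<open>Quasi-metric spaces\<close>

definition quasi_metric :: "'a set \<Rightarrow> ('a \<Rightarrow> 'a \<Rightarrow> real) \<Rightarrow> bool" where
  "quasi_metric X d \<longleftrightarrow>
     (\<exists>x\<in>X. \<exists>y\<in>X. x \<noteq> y) \<and>
     (\<forall>x\<in>X. \<forall>y\<in>X. 0 \<le> d x y) \<and>
     (\<forall>x\<in>X. \<forall>y\<in>X. d x y = 0 \<longleftrightarrow> x = y) \<and>
     (\<exists>C\<^sub>0>0. \<forall>x\<in>X. \<forall>y\<in>X. d y x \<le> C\<^sub>0 * d x y) \<and>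
     (\<exists>C\<^sub>1>0. \<forall>x\<in>X. \<forall>y\<in>X. \<forall>z\<in>X. d x y \<le> C\<^sub>1 * max (d x z) (d z y))"

definition qm_ball :: "'a set \<Rightarrow> ('a \<Rightarrow> 'a \<Rightarrow> real) \<Rightarrow> 'a \<Rightarrow> real \<Rightarrow> 'a set" where
  "qm_ball X d x r = {y \<in> X. d x y < r}"

definition qm_open_sets :: "'a set \<Rightarrow> ('a \<Rightarrow> 'a \<Rightarrow> real) \<Rightarrow> 'a set set" where
  "qm_open_sets X d = {U. U \<subseteq> X \<and> (\<forall>x\<in>U. \<exists>r>0. qm_ball X d x r \<subseteq> U)}"

text \<open>The constant \<open>C\<^sub>\<rho>\<close>. For a quasi-metric the set below is nonempty and bounded above, and all
  denominators are positive, so the real-valued supremum is the genuine one (and is at least 1).\<close>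

definition qm_const :: "'a set \<Rightarrow> ('a \<Rightarrow> 'a \<Rightarrow> real) \<Rightarrow> real" where
  "qm_const X \<rho> =
     Sup {\<rho> x y / max (\<rho> x z) (\<rho> z y) | x y z.
            x \<in> X \<and> y \<in> X \<and> z \<in> X \<and> \<not> (x = y \<and> y = z)}"

definition qm_equiv :: "'a set \<Rightarrow> ('a \<Rightarrow> 'a \<Rightarrow> real) \<Rightarrow> ('a \<Rightarrow> 'a \<Rightarrow> real) \<Rightarrow> bool" where
  "qm_equiv X \<rho> d \<longleftrightarrow>
     (\<exists>\<kappa>>0. \<forall>x\<in>X. \<forall>y\<in>X. inverse \<kappa> * \<rho> x y \<le> d x y \<and> d x y \<le> \<kappa> * \<rho> x y)"

text \<open>In \<^typ>\<open>ennreal\<close> the inverse of \<open>0\<close> is \<open>\<infinity>\<close>, which is the convention needed when \<open>C\<^sub>\<rho> = 1\<close>.\<close>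

definition qm_index :: "'a set \<Rightarrow> ('a \<Rightarrow> 'a \<Rightarrow> real) \<Rightarrow> ennreal" where
  "qm_index X d =
     (SUP \<rho> \<in> {\<rho>. quasi_metric X \<rho> \<and> qm_equiv X \<rho> d}. inverse (ennreal (log 2 (qm_const X \<rho>))))"

definition qm_index_attained :: "'a set \<Rightarrow> ('a \<Rightarrow> 'a \<Rightarrow> real) \<Rightarrow> bool" where
  "qm_index_attained X d \<longleftrightarrow>
     (\<exists>\<rho>. quasi_metric X \<rho> \<and> qm_equiv X \<rho> d \<and>
          inverse (ennreal (log 2 (qm_const X \<rho>))) = qm_index X d)"

text \<open>The relation \<open>\<alpha> \<preceq>\<^sub>q ind(X, d)\<close>.\<close>

definition admissible_smoothness :: "'a set \<Rightarrow> ('a \<Rightarrow> 'a \<Rightarrow> real) \<Rightarrow> ennreal \<Rightarrow> real \<Rightarrow> bool" where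
  "admissible_smoothness X d q \<alpha> \<longleftrightarrow>
     ennreal \<alpha> \<le> qm_index X d \<and>
     (ennreal \<alpha> = qm_index X d \<longrightarrow> q = \<infinity> \<and> qm_index_attained X d)"

section \<open>Quasi-metric-measure spaces\<close>

definition quasi_metric_measure_space :: "'a measure \<Rightarrow> ('a \<Rightarrow> 'a \<Rightarrow> real) \<Rightarrow> bool" where
  "quasi_metric_measure_space M d \<longleftrightarrow>
     quasi_metric (space M) d \<and>
     sigma_sets (space M) (qm_open_sets (space M) d) \<subseteq> sets M \<and>
     (\<forall>x\<in>space M. \<forall>r>0. qm_ball (space M) d x r \<in> sets M \<and>
        0 < emeasure M (qm_ball (space M) d x r) \<and> emeasure M (qm_ball (space M) d x r) < \<infinity>)"

definition doubling_measure :: "'a measure \<Rightarrow> ('a \<Rightarrow> 'a \<Rightarrow> real) \<Rightarrow> bool" where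
  "doubling_measure M d \<longleftrightarrow>
     (\<exists>C\<ge>1. \<forall>x\<in>space M. \<forall>r>0.
        emeasure M (qm_ball (space M) d x (2 * r)) \<le> ennreal C * emeasure M (qm_ball (space M) d x r))"

section \<open>Function spaces\<close>

text \<open>Functions on \<open>X = space M\<close> are represented by total functions on the type \<^typ>\<open>'a\<close>; their
  values outside \<^term>\<open>space M\<close> are irrelevant to everything below. (Quasi-)norms take values in
  \<^typ>\<open>ennreal\<close>, and functions that agree almost everywhere are not literally identified: their
  difference has quasi-norm zero in all spaces defined by integrals.\<close>

text \<open>\<open>t\<^sup>r\<close> for \<open>t \<in> [0, \<infinity>]\<close>; only used for \<open>r > 0\<close>.\<close>

definition ennpowr :: "ennreal \<Rightarrow> real \<Rightarrow> ennreal" where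
  "ennpowr t r = (if t = \<infinity> then \<infinity> else ennreal (enn2real t powr r))"

definition Lp_norm :: "'a measure \<Rightarrow> real \<Rightarrow> ('a \<Rightarrow> ennreal) \<Rightarrow> ennreal" where
  "Lp_norm M p F = ennpowr (\<integral>\<^sup>+x. ennpowr (F x) p \<partial>M) (1 / p)"

definition lq_norm :: "ennreal \<Rightarrow> (int \<Rightarrow> ennreal) \<Rightarrow> ennreal" where
  "lq_norm q a = (if q = \<infinity> then (SUP k. a k) else Lp_norm (count_space UNIV) (enn2real q) a)"

definition Lp_qnorm :: "'a measure \<Rightarrow> real \<Rightarrow> ('a \<Rightarrow> real) \<Rightarrow> ennreal" where
  "Lp_qnorm M p f = Lp_norm M p (\<lambda>x. ennreal \<bar>f x\<bar>)"

definition Lp_space :: "'a measure \<Rightarrow> real \<Rightarrow> ('a \<Rightarrow> real) set" where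
  "Lp_space M p = {f \<in> borel_measurable M. Lp_qnorm M p f < \<infinity>}"

definition frac_gradients ::
    "'a measure \<Rightarrow> ('a \<Rightarrow> 'a \<Rightarrow> real) \<Rightarrow> real \<Rightarrow> ('a \<Rightarrow> real) \<Rightarrow> (int \<Rightarrow> 'a \<Rightarrow> real) set" where
  "frac_gradients M d \<alpha> f =
     {g. (\<forall>k. g k \<in> borel_measurable M \<and> (\<forall>x\<in>space M. 0 \<le> g k x)) \<and>
         (\<exists>E\<in>null_sets M. \<forall>k. \<forall>x\<in>space M - E. \<forall>y\<in>space M - E.
            2 powi (- k - 1) \<le> d x y \<and> d x y < 2 powi (- k) \<longrightarrow>
            \<bar>f x - f y\<bar> \<le> d x y powr \<alpha> * (g k x + g k y))}"

definition HTL_norm ::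
    "'a measure \<Rightarrow> ('a \<Rightarrow> 'a \<Rightarrow> real) \<Rightarrow> real \<Rightarrow> real \<Rightarrow> ennreal \<Rightarrow> ('a \<Rightarrow> real) \<Rightarrow> ennreal" where
  "HTL_norm M d \<alpha> p q f =
     Lp_qnorm M p f +
     (INF g \<in> frac_gradients M d \<alpha> f. Lp_norm M p (\<lambda>x. lq_norm q (\<lambda>k. ennreal (g k x))))"

definition HTL_space ::
    "'a measure \<Rightarrow> ('a \<Rightarrow> 'a \<Rightarrow> real) \<Rightarrow> real \<Rightarrow> real \<Rightarrow> ennreal \<Rightarrow> ('a \<Rightarrow> real) set" where
  "HTL_space M d \<alpha> p q = {f \<in> Lp_space M p. HTL_norm M d \<alpha> p q f < \<infinity>}"

definition HB_norm ::
    "'a measure \<Rightarrow> ('a \<Rightarrow> 'a \<Rightarrow> real) \<Rightarrow> real \<Rightarrow> real \<Rightarrow> ennreal \<Rightarrow> ('a \<Rightarrow> real) \<Rightarrow> ennreal" where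
  "HB_norm M d \<alpha> p q f =
     Lp_qnorm M p f +
     (INF g \<in> frac_gradients M d \<alpha> f. lq_norm q (\<lambda>k. Lp_norm M p (\<lambda>x. ennreal (g k x))))"

definition HB_space ::
    "'a measure \<Rightarrow> ('a \<Rightarrow> 'a \<Rightarrow> real) \<Rightarrow> real \<Rightarrow> real \<Rightarrow> ennreal \<Rightarrow> ('a \<Rightarrow> real) set" where
  "HB_space M d \<alpha> p q = {f \<in> Lp_space M p. HB_norm M d \<alpha> p q f < \<infinity>}"

definition Holder_norm :: "'a set \<Rightarrow> ('a \<Rightarrow> 'a \<Rightarrow> real) \<Rightarrow> real \<Rightarrow> ('a \<Rightarrow> real) \<Rightarrow> ennreal" where
  "Holder_norm X d \<beta> f =
     (SUP x\<in>X. ennreal \<bar>f x\<bar>) +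
     (SUP (x, y) \<in> {(x, y). x \<in> X \<and> y \<in> X \<and> x \<noteq> y}. ennreal (\<bar>f x - f y\<bar> / d x y powr \<beta>))"

definition Holder_space :: "'a set \<Rightarrow> ('a \<Rightarrow> 'a \<Rightarrow> real) \<Rightarrow> real \<Rightarrow> ('a \<Rightarrow> real) set" where
  "Holder_space X d \<beta> = {f. Holder_norm X d \<beta> f < \<infinity>}"

section \<open>Compact embeddings\<close>

definition qnorm_totally_bounded :: "(('a \<Rightarrow> real) \<Rightarrow> ennreal) \<Rightarrow> ('a \<Rightarrow> real) set \<Rightarrow> bool" where
  "qnorm_totally_bounded N T \<longleftrightarrow>
     (\<forall>\<epsilon>>0. \<exists>K. finite K \<and> K \<subseteq> T \<and> (\<forall>g\<in>T. \<exists>h\<in>K. N (\<lambda>x. g x - h x) < \<epsilon>))"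

text \<open>Compactness of the natural map from the space \<open>A\<close> with quasi-norm \<open>N\<^sub>A\<close> to the space \<open>B\<close> with
  quasi-norm \<open>N\<^sub>B\<close>, both consisting of functions modulo equality almost everywhere. The map is
  well defined if every \<open>f \<in> A\<close> has a representative in \<open>B\<close>; the image of \<open>S \<subseteq> A\<close> is given by all
  representatives in \<open>B\<close> of members of \<open>S\<close>. For \<open>B\<close> a Lebesgue space these differ by functions of
  quasi-norm zero; for \<open>B\<close> a Hoelder space the representative is unique on \<^term>\<open>space M\<close>,
  as balls have positive measure.\<close>

definition compact_embedding ::
    "'a measure \<Rightarrow> ('a \<Rightarrow> real) set \<Rightarrow> (('a \<Rightarrow> real) \<Rightarrow> ennreal) \<Rightarrow>
     ('a \<Rightarrow> real) set \<Rightarrow> (('a \<Rightarrow> real) \<Rightarrow> ennreal) \<Rightarrow> bool" where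
  "compact_embedding M A N\<^sub>A B N\<^sub>B \<longleftrightarrow>
     (\<forall>f\<in>A. \<exists>g\<in>B. AE x in M. f x = g x) \<and>
     (\<forall>S\<subseteq>A. (\<exists>R<\<infinity>. \<forall>f\<in>S. N\<^sub>A f \<le> R) \<longrightarrow>
        qnorm_totally_bounded N\<^sub>B {g \<in> B. \<exists>f\<in>S. AE x in M. f x = g x})"

definition HTL_compact_Lp ::
    "'a measure \<Rightarrow> ('a \<Rightarrow> 'a \<Rightarrow> real) \<Rightarrow> real \<Rightarrow> real \<Rightarrow> ennreal \<Rightarrow> real \<Rightarrow> bool" where
  "HTL_compact_Lp M d \<alpha> p q r \<longleftrightarrow>
     compact_embedding M (HTL_space M d \<alpha> p q) (HTL_norm M d \<alpha> p q) (Lp_space M r) (Lp_qnorm M r)"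

definition HB_compact_Lp ::
    "'a measure \<Rightarrow> ('a \<Rightarrow> 'a \<Rightarrow> real) \<Rightarrow> real \<Rightarrow> real \<Rightarrow> ennreal \<Rightarrow> real \<Rightarrow> bool" where
  "HB_compact_Lp M d \<alpha> p q r \<longleftrightarrow>
     compact_embedding M (HB_space M d \<alpha> p q) (HB_norm M d \<alpha> p q) (Lp_space M r) (Lp_qnorm M r)"

definition HTL_compact_Holder ::
    "'a measure \<Rightarrow> ('a \<Rightarrow> 'a \<Rightarrow> real) \<Rightarrow> real \<Rightarrow> real \<Rightarrow> ennreal \<Rightarrow> real \<Rightarrow> bool" where
  "HTL_compact_Holder M d \<alpha> p q \<gamma> \<longleftrightarrow>
     compact_embedding M (HTL_space M d \<alpha> p q) (HTL_norm M d \<alpha> p q)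
       (Holder_space (space M) d \<gamma>) (Holder_norm (space M) d \<gamma>)"

definition HB_compact_Holder ::
    "'a measure \<Rightarrow> ('a \<Rightarrow> 'a \<Rightarrow> real) \<Rightarrow> real \<Rightarrow> real \<Rightarrow> ennreal \<Rightarrow> real \<Rightarrow> bool" where
  "HB_compact_Holder M d \<alpha> p q \<gamma> \<longleftrightarrow>
     compact_embedding M (HB_space M d \<alpha> p q) (HB_norm M d \<alpha> p q)
       (Holder_space (space M) d \<gamma>) (Holder_norm (space M) d \<gamma>)"

end

theory Submission
  imports Defs
begin

text \<open>
Why one compact embedding yields all the others: the hypothesis is used only to see that the space
is bounded. Once the space is bounded, every one of the embeddings in the conclusion is compact.

\<^bold>\<open>From compactness to boundedness.\<close> Since \<open>\<alpha>\<close> does not exceed the index, there is a quasi-metric \<open>\<rho>\<close>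
equivalent to \<open>d\<close> and an exponent \<open>a \<ge> \<alpha>\<close> (with \<open>a > \<alpha>\<close> if \<open>q < \<infinity>\<close>) such that
\<open>\<rho>\<^sup>a(x,y) \<le> 2 max {\<rho>\<^sup>a(x,z), \<rho>\<^sup>a(z,y)}\<close>. Frink's chain argument turns \<open>\<rho>\<^sup>a\<close> into something that obeys a
genuine triangle inequality, so that the distance to a point can be truncated to bump functions of
Hoelder order \<open>a\<close> (\<open>bump_functions\<close>); their fractional gradients of order \<open>\<alpha>\<close> decay geometrically
in the scale, which makes the \<open>\<ell>\<^sup>q\<close> norm finite. In an unbounded doubling space, the balls about a fixed
centre have measures tending to infinity. Concentric bumps, normalised in \<open>L\<^sup>p\<close>, with radii for which the
measures grow rapidly, are then bounded in both function spaces. Each of them carries at least a fixed amount of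
\<open>L\<^bsup>p'\<^esup>\<close> mass where the smaller ones vanish, so no two are close in \<open>L\<^bsup>p'\<^esup>\<close>
(\<open>compact_embedding_imp_bounded\<close>).

\<^bold>\<open>From boundedness to compactness.\<close> On a bounded space, the growth condition with exponent \<open>s\<close> says that
balls of radius \<open>r \<le> 1\<close> have measure at least \<open>b r\<^sup>s\<close>; hence the measure is finite and the space is totally
bounded. Both scales of spaces embed into the largest one, in which the gradients are only bounded in
\<open>L\<^sup>u\<close> uniformly in the scale. For a function \<open>f\<close> in a bounded subset of it, summing the gradients of all
finer scales gives functions \<open>w\<^sub>n\<close> with integral at most \<open>A 2\<^bsup>-n\<beta>u\<^esup>\<close> and
\<open>\<bar>f x - f y\<bar> \<le> w\<^sub>n(x)\<^bsup>1/u\<^esup> + w\<^sub>n(y)\<^bsup>1/u\<^esup>\<close> whenever \<open>d x y < 2\<^sup>-\<^sup>n\<close>. The sum of the \<open>u\<close>-th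
powers works for every \<open>u > 0\<close>, also where \<open>L\<^sup>u\<close> has no triangle inequality.

Every ball of radius comparable to \<open>2\<^sup>-\<^sup>n\<close> contains points at which \<open>w\<^sub>n\<close> is at most twice its average,
hence at most a constant times \<open>2\<^bsup>n(s - \<beta>u)\<^esup>\<close>. Telescoping \<open>f\<close> along such points gives the two
Sobolev-type estimates: if \<open>\<beta>u < s\<close> then \<open>\<bar>f\<bar> \<le> w\<^sub>n\<^bsup>1/u\<^esup> + C 2\<^bsup>n(s/u - \<beta>)\<^esup>\<close> for all \<open>n\<close>, and
cutting the range of \<open>f\<close> dyadically bounds \<open>f\<close> in every \<open>L\<^sup>Q\<close> with \<open>Q < su/(s - \<beta>u)\<close>
(\<open>subcritical_moment_bound\<close>); if \<open>\<beta>u > s\<close> then \<open>f\<close> is Hoelder continuous of order \<open>\<beta> - s/u\<close> off a null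
set (\<open>profile_holder_supercritical\<close>).

Compactness follows by pigeonhole. Cover the space by finitely many small balls and record, for each of
them, the rounded value of \<open>f\<close> at one point with small \<open>w\<^sub>n\<close>, if there is such a point. Only finitely many
records occur. Two functions with the same record are close except on a set of small measure, which the
bound in a higher \<open>L\<^sup>Q\<close> makes negligible (\<open>profile_class_totally_bounded_Lp\<close>); in the Hoelder case they
are uniformly close, and interpolation with the Hoelder bound of higher order concludes
(\<open>holder_class_totally_bounded\<close>).
\<close>

section \<open>Hoelder functions from the index\<close>

text \<open>Frink's lemma. The weights, 2 for the two extreme links and 4 for the inner ones, make the induction close:
a chain is split at a link where the distances from the one end and to the other end are both large,
and that link is extreme in both halves, so that it is charged \<open>2 + 2 = 4\<close>.\<close>

lemma frink_chain:
  fixes D :: "'a \<Rightarrow> 'a \<Rightarrow> real" and x :: "nat \<Rightarrow> 'a"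
  assumes D0: "\<And>a b. a \<in> X \<Longrightarrow> b \<in> X \<Longrightarrow> 0 \<le> D a b"
    and D2: "\<And>a b c. a \<in> X \<Longrightarrow> b \<in> X \<Longrightarrow> c \<in> X \<Longrightarrow> D a b \<le> 2 * max (D a c) (D c b)"
    and xX: "\<And>i. m \<le> i \<Longrightarrow> i \<le> n \<Longrightarrow> x i \<in> X"
    and mn: "m + 2 \<le> n"
  shows "D (x m) (x n) + 2 * D (x m) (x (Suc m)) + 2 * D (x (n - 1)) (x n)
           \<le> 4 * (\<Sum>i=m..<n. D (x i) (x (Suc i)))"
  using xX mn
proof (induction "n - m" arbitrary: m n rule: less_induct)
  case less
  note X = less.prems(1)
  have Xm: "x m \<in> X" and Xn: "x n \<in> X" using X less.prems(2) by auto
  define S where "S a b = (\<Sum>i=a..<b. D (x i) (x (Suc i)))" for a b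
  have split: "S m n = S m k + S k n" if "m \<le> k" "k \<le> n" for k
    using that unfolding S_def by (simp add: sum.atLeastLessThan_concat)
  have step: "S k (Suc k) = D (x k) (x (Suc k))" for k by (simp add: S_def)
  have Snn: "0 \<le> S a b" if "m \<le> a" "b \<le> n" for a b
    unfolding S_def by (intro sum_nonneg D0 X) (use that in auto)
  have last: "S m n = S m (n - 1) + D (x (n - 1)) (x n)"
    using split[of "n - 1"] step[of "n - 1"] less.prems(2) by auto
  have first: "S m n = D (x m) (x (Suc m)) + S (Suc m) n"
    using split[of "Suc m"] step[of m] less.prems(2) by auto
  have both: "S m n \<ge> D (x m) (x (Suc m)) + D (x (n - 1)) (x n)"
  proof -
    have "S m (n - 1) = D (x m) (x (Suc m)) + S (Suc m) (n - 1)"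
      using less.prems(2) unfolding S_def by (subst sum.atLeast_Suc_lessThan) auto
    then show ?thesis using last Snn[of "Suc m" "n - 1"] by simp
  qed
  have ends: "0 \<le> D (x m) (x (Suc m))" "0 \<le> D (x (n - 1)) (x n)"
    using less.prems(2) by (auto intro!: D0 X)
  \<comment> \<open>\<open>p\<close> is the last index from which the distance to the end is at least half of the total distance.\<close>
  define P where "P p \<longleftrightarrow> p < n \<and> m \<le> p \<and> D (x m) (x n) \<le> 2 * D (x p) (x n)" for p
  have Pm: "P m" using less.prems(2) D0[OF Xm Xn] by (auto simp: P_def)
  define p where "p = Greatest P"
  have Pp: "P p" unfolding p_def by (rule GreatestI_nat[where P=P and k=m and b=n]) (use Pm in \<open>auto simp: P_def\<close>)
  have pmax: "q \<le> p" if "P q" for q unfolding p_def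
    by (rule Greatest_le_nat[where P=P and b=n]) (use that in \<open>auto simp: P_def\<close>)
  have pn: "p < n" "m \<le> p" and Dp: "D (x m) (x n) \<le> 2 * D (x p) (x n)"
    using Pp by (auto simp: P_def)
  show ?case
  proof (cases "p = n - 1")
    case True
    then show ?thesis using Dp both ends unfolding S_def[symmetric] by simp
  next
    case False
    then have p1: "Suc p < n" using pn by simp
    have "\<not> P (Suc p)" using pmax[of "Suc p"] by auto
    then have "\<not> D (x m) (x n) \<le> 2 * D (x (Suc p)) (x n)"
      using p1 pn by (auto simp: P_def)
    with D2[of "x m" "x n" "x (Suc p)"] Xm Xn X[of "Suc p"] p1 pn
    have Dq: "D (x m) (x n) \<le> 2 * D (x m) (x (Suc p))" by auto
    show ?thesis
    proof (cases "p = m")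
      case True
      then show ?thesis using Dq both ends unfolding S_def[symmetric] by simp
    next
      case False
      have A: "D (x m) (x (Suc p)) + 2 * D (x m) (x (Suc m)) + 2 * D (x p) (x (Suc p)) \<le> 4 * S m (Suc p)"
        using less.hyps[of "Suc p" m] pn p1 False X unfolding S_def by auto
      have B: "D (x p) (x n) + 2 * D (x p) (x (Suc p)) + 2 * D (x (n - 1)) (x n) \<le> 4 * S p n"
        using less.hyps[of n p] pn p1 False X unfolding S_def by auto
      have "S m n = S m p + S p n" "S m (Suc p) = S m p + D (x p) (x (Suc p))"
        using split[of p] pn unfolding S_def by auto
      then show ?thesis using A B Dp Dq unfolding S_def[symmetric] by simp
    qed
  qed
qed

text \<open>The infimum of the lengths of chains that start at \<open>x0\<close>. Appending one link to a chain gives the one-sided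
Lipschitz estimate, and Frink's lemma shows that the infimum does not collapse. Two-sided
estimates result because \<open>D b a\<close> is comparable to \<open>D a b\<close> in the application.\<close>

lemma chain_infimum_function:
  fixes D :: "'a \<Rightarrow> 'a \<Rightarrow> real"
  assumes D0: "\<And>a b. a \<in> X \<Longrightarrow> b \<in> X \<Longrightarrow> 0 \<le> D a b"
    and Drefl: "\<And>a. a \<in> X \<Longrightarrow> D a a = 0"
    and D2: "\<And>a b c. a \<in> X \<Longrightarrow> b \<in> X \<Longrightarrow> c \<in> X \<Longrightarrow> D a b \<le> 2 * max (D a c) (D c b)"
    and x0: "x0 \<in> X"
  shows "\<exists>F. (\<forall>y\<in>X. D x0 y \<le> 4 * F y \<and> F y \<le> D x0 y) \<and> (\<forall>y\<in>X. \<forall>z\<in>X. F z \<le> F y + D y z)"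
proof -
  define L where "L c n = (\<Sum>i<n. D (c i) (c (Suc i)))" for c and n :: nat
  define T where "T y = {L c n | c n. c 0 = x0 \<and> c n = y \<and> (\<forall>i\<le>n. c i \<in> X)}" for y
  define F where "F y = Inf (T y)" for y
  have T_lower: "D x0 y / 4 \<le> t" if t: "t \<in> T y" for t y
  proof -
    obtain c n where c: "t = L c n" "c 0 = x0" "c n = y" "\<And>i. i \<le> n \<Longrightarrow> c i \<in> X"
      using t by (auto simp: T_def)
    have "D x0 y \<le> 4 * L c n"
    proof -
      consider "n = 0" | "n = 1" | "n \<ge> 2" by linarith
      then show ?thesis
      proof cases
        case 1 then show ?thesis using c Drefl[OF x0] by (auto simp: L_def)
      next
        case 2
        then show ?thesis using c D0[of x0 y] x0 c(4)[of n] by (auto simp: L_def)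
      next
        case 3
        have "D (c 0) (c n) + 2 * D (c 0) (c (Suc 0)) + 2 * D (c (n - 1)) (c n)
           \<le> 4 * (\<Sum>i=0..<n. D (c i) (c (Suc i)))"
          by (rule frink_chain[of X]) (use D0 D2 c 3 in auto)
        moreover have "0 \<le> D (c 0) (c (Suc 0))" "0 \<le> D (c (n - 1)) (c n)"
          using c 3 by (auto intro!: D0)
        ultimately show ?thesis using c by (simp add: L_def lessThan_atLeast0)
      qed
    qed
    then show ?thesis using c by simp
  qed
  have T_direct: "D x0 y \<in> T y" if "y \<in> X" for y
  proof -
    have "D x0 y = L (\<lambda>i. if i = 0 then x0 else y) 1" by (simp add: L_def)
    then show ?thesis unfolding T_def using that x0
      by (auto intro!: exI[of _ "\<lambda>i. if i = 0 then x0 else y"] exI[of _ "1::nat"])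
  qed
  have bdd: "bdd_below (T y)" for y using T_lower by (auto intro!: bdd_belowI[of _ "D x0 y / 4"])
  have "D x0 y \<le> 4 * F y" if "y \<in> X" for y
  proof -
    have "D x0 y / 4 \<le> F y" unfolding F_def
      by (rule cInf_greatest) (use T_direct[OF that] T_lower in auto)
    then show ?thesis by simp
  qed
  moreover have "F y \<le> D x0 y" if "y \<in> X" for y
    unfolding F_def by (rule cInf_lower[OF T_direct[OF that] bdd])
  moreover have "F z \<le> F y + D y z" if yz: "y \<in> X" "z \<in> X" for y z
  proof -
    have "F z - D y z \<le> t" if t: "t \<in> T y" for t
    proof -
      obtain c n where c: "t = L c n" "c 0 = x0" "c n = y" "\<And>i. i \<le> n \<Longrightarrow> c i \<in> X"
        using t by (auto simp: T_def)
      define c' where "c' = c(Suc n := z)"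
      have "L c' (Suc n) = t + D y z"
        unfolding L_def c(1) by (simp add: c'_def c(3) L_def)
      moreover have "L c' (Suc n) \<in> T z"
        unfolding T_def using c yz
        by (auto simp: c'_def intro!: exI[of _ "c(Suc n := z)"] exI[of _ "Suc n"])
      ultimately have "t + D y z \<in> T z" by simp
      from cInf_lower[OF this bdd] show ?thesis by (simp add: F_def)
    qed
    then have "F z - D y z \<le> F y" unfolding F_def[of y]
      by (intro cInf_greatest) (use T_direct[OF yz(1)] in auto)
    then show ?thesis by simp
  qed
  ultimately show ?thesis by (intro exI[of _ F]) blast
qed

text \<open>The supremum that defines \<open>qm_const\<close> is taken over a nonempty set that is bounded above.\<close>

lemma quasi_metric_le_qm_const:
  assumes q: "quasi_metric X \<rho>" and "x \<in> X" "y \<in> X" "z \<in> X"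
  shows "\<rho> x y \<le> qm_const X \<rho> * max (\<rho> x z) (\<rho> z y)" and "1 \<le> qm_const X \<rho>"
proof -
  let ?S = "{\<rho> x y / max (\<rho> x z) (\<rho> z y) | x y z. x \<in> X \<and> y \<in> X \<and> z \<in> X \<and> \<not> (x = y \<and> y = z)}"
  have nn: "\<And>x y. x \<in> X \<Longrightarrow> y \<in> X \<Longrightarrow> 0 \<le> \<rho> x y"
    and z0: "\<And>x y. x \<in> X \<Longrightarrow> y \<in> X \<Longrightarrow> \<rho> x y = 0 \<longleftrightarrow> x = y"
    using q by (auto simp: quasi_metric_def)
  obtain C where C: "\<And>x y z. x \<in> X \<Longrightarrow> y \<in> X \<Longrightarrow> z \<in> X \<Longrightarrow> \<rho> x y \<le> C * max (\<rho> x z) (\<rho> z y)"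
    using q unfolding quasi_metric_def by blast
  have pos: "0 < max (\<rho> x z) (\<rho> z y)" if "x \<in> X" "y \<in> X" "z \<in> X" "\<not> (x = y \<and> y = z)" for x y z
    using nn[of x z] nn[of z y] z0[of x z] z0[of z y] that by (auto simp: less_max_iff_disj order_less_le)
  have bdd: "bdd_above ?S"
    by (rule bdd_aboveI[of _ C]) (use C pos in \<open>auto simp: divide_le_eq\<close>)
  show "\<rho> x y \<le> qm_const X \<rho> * max (\<rho> x z) (\<rho> z y)"
  proof (cases "x = y \<and> y = z")
    case True
    then show ?thesis using z0[of x x] assms by auto
  next
    case False
    have "\<rho> x y / max (\<rho> x z) (\<rho> z y) \<le> qm_const X \<rho>"
      unfolding qm_const_def by (rule cSup_upper[OF _ bdd]) (use assms False in blast)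
    then show ?thesis using pos[OF assms(2-4) False] by (simp add: divide_le_eq)
  qed
  obtain a b where ab: "a \<in> X" "b \<in> X" "a \<noteq> b" using q by (auto simp: quasi_metric_def)
  have "\<rho> a b / max (\<rho> a b) (\<rho> b b) \<le> qm_const X \<rho>"
    unfolding qm_const_def by (rule cSup_upper[OF _ bdd]) (use ab in blast)
  moreover have "\<rho> a b / max (\<rho> a b) (\<rho> b b) = 1"
    using nn[of a b] z0[of a b] z0[of b b] ab by (auto simp: max_def)
  ultimately show "1 \<le> qm_const X \<rho>" by simp
qed

text \<open>What the relation between \<open>\<alpha>\<close> and the index provides: an exponent \<open>a\<close> up to which an equivalent quasi-metric
may be snowflaked while its constant stays at most 2. A strict inequality below the index leaves room for \<open>a > \<alpha>\<close>;
at the index itself, attainment gives \<open>a = \<alpha>\<close>.\<close>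

lemma admissible_smoothness_snowflake:
  assumes adm: "admissible_smoothness X d q \<alpha>" and a: "0 < \<alpha>"
  obtains \<rho> a where "quasi_metric X \<rho>" "qm_equiv X \<rho> d" "\<alpha> \<le> a" "q < \<infinity> \<Longrightarrow> \<alpha> < a"
    "qm_const X \<rho> powr a \<le> 2"
proof -
  have le: "ennreal \<alpha> \<le> qm_index X d" using adm by (simp add: admissible_smoothness_def)
  consider (attained) "ennreal \<alpha> = qm_index X d" "q = \<infinity>" "qm_index_attained X d"
    | (below) "ennreal \<alpha> < qm_index X d"
    using adm le unfolding admissible_smoothness_def order_le_less by blast
  then show thesis
  proof cases
    case attained
    then obtain \<rho> where \<rho>: "quasi_metric X \<rho>" "qm_equiv X \<rho> d"
        "inverse (ennreal (log 2 (qm_const X \<rho>))) = ennreal \<alpha>"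
      by (auto simp: qm_index_attained_def)
    obtain x where x: "x \<in> X" using \<rho>(1) by (auto simp: quasi_metric_def)
    have C1: "1 \<le> qm_const X \<rho>" by (rule quasi_metric_le_qm_const(2)[OF \<rho>(1) x x x])
    define l where "l = log 2 (qm_const X \<rho>)"
    have l0: "0 \<le> l" using C1 by (simp add: l_def)
    have "l \<noteq> 0" using \<rho>(3) by (auto simp: l_def[symmetric])
    with l0 have l: "0 < l" by simp
    have "inverse l = \<alpha>" using \<rho>(3) l a by (simp add: l_def[symmetric] inverse_ennreal)
    then have "l * \<alpha> = 1" using l by auto
    moreover have "qm_const X \<rho> = 2 powr l" using C1 by (simp add: l_def)
    ultimately have "qm_const X \<rho> powr \<alpha> = 2" by (simp add: powr_powr)
    then show thesis using that[of \<rho> \<alpha>] \<rho> attained by auto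
  next
    case below
    then obtain \<rho> where \<rho>: "quasi_metric X \<rho>" "qm_equiv X \<rho> d"
        "ennreal \<alpha> < inverse (ennreal (log 2 (qm_const X \<rho>)))"
      unfolding qm_index_def less_SUP_iff by auto
    obtain x where x: "x \<in> X" using \<rho>(1) by (auto simp: quasi_metric_def)
    have C1: "1 \<le> qm_const X \<rho>" by (rule quasi_metric_le_qm_const(2)[OF \<rho>(1) x x x])
    define l where "l = log 2 (qm_const X \<rho>)"
    have l0: "0 \<le> l" using C1 by (simp add: l_def)
    have C: "qm_const X \<rho> = 2 powr l" using C1 by (simp add: l_def)
    \<comment> \<open>If \<open>l = 0\<close>, the equivalent quasi-metric is an ultrametric, and every exponent is possible.\<close>
    show thesis
    proof (cases "l = 0")
      case True
      then show thesis using that[of \<rho> "\<alpha> + 1"] \<rho> C by auto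
    next
      case False
      with l0 have l: "0 < l" by simp
      have "\<alpha> < inverse l" using \<rho>(3) l a by (simp add: l_def[symmetric] inverse_ennreal ennreal_less_iff)
      moreover have "qm_const X \<rho> powr inverse l = 2" using l by (simp add: C powr_powr)
      ultimately show thesis using that[of \<rho> "inverse l"] \<rho> by auto
    qed
  qed
qed

text \<open>A substitute for \<open>d(x0, -)\<^sup>a\<close> that varies in a Hoelder continuous way, although \<open>d\<close> itself may be
discontinuous.\<close>

lemma holder_distance_function:
  assumes qm: "quasi_metric X d" and adm: "admissible_smoothness X d q \<alpha>" and a0: "0 < \<alpha>"
  obtains a c where "\<alpha> \<le> a" "q < \<infinity> \<Longrightarrow> \<alpha> < a" "1 \<le> c"
    "\<And>x0. x0 \<in> X \<Longrightarrow> \<exists>F. (\<forall>y\<in>X. d x0 y powr a \<le> c * F y \<and> F y \<le> c * d x0 y powr a) \<and>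
        (\<forall>y\<in>X. \<forall>z\<in>X. \<bar>F y - F z\<bar> \<le> c * d y z powr a)"
proof -
  obtain \<rho> a where \<rho>: "quasi_metric X \<rho>" "qm_equiv X \<rho> d" and a: "\<alpha> \<le> a" "q < \<infinity> \<Longrightarrow> \<alpha> < a"
    and C2: "qm_const X \<rho> powr a \<le> 2"
    using admissible_smoothness_snowflake[OF adm a0] by metis
  have apos: "0 < a" using a a0 by simp
  have nn: "\<And>x y. x \<in> X \<Longrightarrow> y \<in> X \<Longrightarrow> 0 \<le> \<rho> x y" and z0: "\<And>x. x \<in> X \<Longrightarrow> \<rho> x x = 0"
    using \<rho>(1) by (auto simp: quasi_metric_def)
  have dnn: "\<And>x y. x \<in> X \<Longrightarrow> y \<in> X \<Longrightarrow> 0 \<le> d x y" using qm by (auto simp: quasi_metric_def)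
  obtain k where k: "k > 0" "\<And>x y. x \<in> X \<Longrightarrow> y \<in> X \<Longrightarrow> inverse k * \<rho> x y \<le> d x y \<and> d x y \<le> k * \<rho> x y"
    using \<rho>(2) by (auto simp: qm_equiv_def)
  obtain C0 where C0: "C0 > 0" "\<And>x y. x \<in> X \<Longrightarrow> y \<in> X \<Longrightarrow> d y x \<le> C0 * d x y"
    using qm by (auto simp: quasi_metric_def)
  define D where "D x y = \<rho> x y powr a" for x y
  have D0: "0 \<le> D x y" if "x \<in> X" "y \<in> X" for x y by (simp add: D_def)
  have Drefl: "D x x = 0" if "x \<in> X" for x using that z0 by (simp add: D_def)
  have D2: "D x y \<le> 2 * max (D x z) (D z y)" if "x \<in> X" "y \<in> X" "z \<in> X" for x y z
  proof -
    let ?m = "max (\<rho> x z) (\<rho> z y)"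
    have m0: "0 \<le> ?m" using nn that by (auto simp: le_max_iff_disj)
    have "D x y \<le> (qm_const X \<rho> * ?m) powr a" unfolding D_def
      by (rule powr_mono2) (use apos nn that quasi_metric_le_qm_const(1)[OF \<rho>(1)] in auto)
    also have "\<dots> = qm_const X \<rho> powr a * ?m powr a"
      using quasi_metric_le_qm_const(2)[OF \<rho>(1) that(1) that(1) that(1)] m0 by (simp add: powr_mult)
    also have "\<dots> \<le> 2 * ?m powr a" by (rule mult_right_mono) (use C2 in auto)
    also have "?m powr a = max (D x z) (D z y)" unfolding D_def
      using nn that apos by (auto simp: max_def powr_mono2 intro!: antisym)
    finally show ?thesis .
  qed
  \<comment> \<open>\<open>k\<close> compares \<open>\<rho>\<close> with \<open>d\<close>, 4 is the loss in Frink's lemma, and \<open>C0\<close> enters through \<open>d z y \<le> C0 d y z\<close>.\<close>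
  define c where "c = max 1 (max (4 * k powr a) (max (k powr a) ((k * C0) powr a)))"
  have c1: "1 \<le> c" and ck4: "4 * k powr a \<le> c" and ck: "k powr a \<le> c" and ckC: "(k * C0) powr a \<le> c"
    by (auto simp: c_def)
  have Dd: "D x y \<le> k powr a * d x y powr a" "d x y powr a \<le> k powr a * D x y"
    if "x \<in> X" "y \<in> X" for x y
  proof -
    have "\<rho> x y \<le> k * d x y" using k(1) k(2)[OF that] by (simp add: field_simps)
    then have "\<rho> x y powr a \<le> (k * d x y) powr a" using nn that apos by (intro powr_mono2) auto
    then show "D x y \<le> k powr a * d x y powr a" using k(1) dnn[OF that] by (simp add: D_def powr_mult)
    have "d x y powr a \<le> (k * \<rho> x y) powr a" using dnn that apos k by (intro powr_mono2) auto
    then show "d x y powr a \<le> k powr a * D x y" using k(1) nn[OF that] by (simp add: D_def powr_mult)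
  qed
  have ineq: "\<exists>F. (\<forall>y\<in>X. d x0 y powr a \<le> c * F y \<and> F y \<le> c * d x0 y powr a) \<and>
        (\<forall>y\<in>X. \<forall>z\<in>X. \<bar>F y - F z\<bar> \<le> c * d y z powr a)" if x0: "x0 \<in> X" for x0
  proof -
    obtain F where F: "\<And>y. y \<in> X \<Longrightarrow> D x0 y \<le> 4 * F y" "\<And>y. y \<in> X \<Longrightarrow> F y \<le> D x0 y"
      "\<And>y z. y \<in> X \<Longrightarrow> z \<in> X \<Longrightarrow> F z \<le> F y + D y z"
      using chain_infimum_function[of X D x0, OF D0 Drefl D2 x0] by blast
    have 1: "d x0 y powr a \<le> c * F y" if y: "y \<in> X" for y
    proof -
      have "0 \<le> F y" using F(1)[OF y] D0[OF x0 y] by simp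
      have "d x0 y powr a \<le> k powr a * (4 * F y)"
        using Dd(2)[OF x0 y] F(1)[OF y] mult_left_mono[of "D x0 y" "4 * F y" "k powr a"] by simp
      also have "\<dots> = (4 * k powr a) * F y" by simp
      also have "\<dots> \<le> c * F y" by (rule mult_right_mono[OF ck4]) fact
      finally show ?thesis .
    qed
    have 2: "F y \<le> c * d x0 y powr a" if y: "y \<in> X" for y
      using F(2)[OF y] Dd(1)[OF x0 y] mult_right_mono[OF ck, of "d x0 y powr a"] by simp
    have 3: "F z - F y \<le> c * d y z powr a" if yz: "y \<in> X" "z \<in> X" for y z
      using F(3)[OF yz] Dd(1)[OF yz] mult_right_mono[OF ck, of "d y z powr a"] by simp
    have 4: "F y - F z \<le> c * d y z powr a" if yz: "y \<in> X" "z \<in> X" for y z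
    proof -
      have "F y - F z \<le> D z y" using F(3)[OF yz(2,1)] by simp
      also have "\<dots> \<le> k powr a * d z y powr a" by (rule Dd(1)[OF yz(2,1)])
      also have "\<dots> \<le> k powr a * (C0 * d y z) powr a"
        by (intro mult_left_mono powr_mono2) (use apos dnn yz C0 in auto)
      also have "\<dots> = (k * C0) powr a * d y z powr a"
        using k C0 dnn[OF yz] by (simp add: powr_mult)
      also have "\<dots> \<le> c * d y z powr a" by (rule mult_right_mono[OF ckC]) simp
      finally show ?thesis .
    qed
    show ?thesis using 1 2 3 4 by (intro exI[of _ F]) (auto simp: abs_le_iff)
  qed
  show thesis by (rule that[of a c]) (use a c1 ineq in auto)
qed

section \<open>Powers and quasi-norms with values in the extended half-line\<close>

abbreviation power_integral :: "'a measure \<Rightarrow> real \<Rightarrow> ('a \<Rightarrow> real) \<Rightarrow> ennreal" where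
  "power_integral M p f \<equiv> \<integral>\<^sup>+x. ennreal (\<bar>f x\<bar> powr p) \<partial>M"

lemma ennpowr_ennreal [simp]: "0 \<le> a \<Longrightarrow> ennpowr (ennreal a) r = ennreal (a powr r)"
  by (simp add: ennpowr_def)

lemma ennpowr_infinity [simp]: "ennpowr \<infinity> r = \<infinity>" "ennpowr top r = top"
  by (simp_all add: ennpowr_def)

lemma ennpowr_zero [simp]: "ennpowr 0 r = 0"
  by (simp add: ennpowr_def)

lemma ennpowr_mono: "a \<le> b \<Longrightarrow> 0 \<le> r \<Longrightarrow> ennpowr a r \<le> ennpowr b r"
  by (cases a rule: ennreal_cases; cases b rule: ennreal_cases)
     (auto simp: powr_mono2 top_unique)

lemma ennpowr_ennpowr [simp]: "ennpowr (ennpowr a r) t = ennpowr a (r * t)"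
  by (cases a rule: ennreal_cases) (auto simp: powr_powr)

lemma ennpowr_one [simp]: "ennpowr a 1 = a"
  by (cases a rule: ennreal_cases) auto

text \<open>The powers with exponents \<open>r\<close> and \<open>1 / r\<close> form a Galois connection; this moves the outer root of a
quasi-norm to the other side of an inequality.\<close>

lemma ennpowr_le_iff:
  assumes "0 < r" shows "ennpowr a (1 / r) \<le> b \<longleftrightarrow> a \<le> ennpowr b r"
  using ennpowr_mono[of "ennpowr a (1 / r)" b r] ennpowr_mono[of a "ennpowr b r" "1 / r"] assms
  by auto

lemma ennpowr_cmult:
  assumes "0 \<le> c" "0 < r"
  shows "ennpowr (ennreal c * a) r = ennreal (c powr r) * ennpowr a r"
proof (cases a rule: ennreal_cases)
  case (real b)
  then show ?thesis using assms by (simp flip: ennreal_mult add: powr_mult)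
next
  case top
  then show ?thesis using assms by (cases "c = 0") (auto simp: ennreal_mult_top)
qed

lemma Lp_norm_le_iff: "0 < p \<Longrightarrow> Lp_norm M p F \<le> R \<longleftrightarrow> (\<integral>\<^sup>+x. ennpowr (F x) p \<partial>M) \<le> ennpowr R p"
  unfolding Lp_norm_def by (rule ennpowr_le_iff)

lemma Lp_qnorm_le_iff:
  assumes "0 < p" "0 \<le> r"
  shows "Lp_qnorm M p f \<le> ennreal r \<longleftrightarrow> power_integral M p f \<le> ennreal (r powr p)"
  using assms by (simp add: Lp_qnorm_def Lp_norm_le_iff)

lemma Lp_norm_mono:
  assumes "0 < p" "\<And>x. x \<in> space M \<Longrightarrow> F x \<le> G x"
  shows "Lp_norm M p F \<le> Lp_norm M p G"
  unfolding Lp_norm_def using assms by (intro ennpowr_mono nn_integral_mono) auto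

lemma Lp_norm_indicator:
  assumes "0 < p" "S \<in> sets M" "A < \<infinity>"
  shows "Lp_norm M p (\<lambda>x. A * indicator S x) = A * ennpowr (emeasure M S) (1 / p)"
proof -
  obtain c where c: "A = ennreal c" "0 \<le> c" using assms(3) by (cases A rule: ennreal_cases) auto
  have "ennpowr (A * indicator S x) p = ennreal (c powr p) * indicator S x" for x
    using assms c by (auto simp: indicator_def)
  then have "Lp_norm M p (\<lambda>x. A * indicator S x) = ennpowr (ennreal (c powr p) * emeasure M S) (1 / p)"
    using assms by (simp add: Lp_norm_def nn_integral_cmult_indicator)
  also have "\<dots> = A * ennpowr (emeasure M S) (1 / p)"
    using assms c by (simp add: ennpowr_cmult powr_powr)
  finally show ?thesis .
qed

lemma lq_norm_upper:
  assumes "0 < q" shows "a k \<le> lq_norm q a"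
proof (cases "q = \<infinity>")
  case True
  then show ?thesis by (auto simp: lq_norm_def intro: SUP_upper)
next
  case False
  then have r: "0 < enn2real q" using assms by (simp add: enn2real_positive_iff less_top)
  have "ennpowr (a k) (enn2real q) = (\<integral>\<^sup>+j. ennpowr (a j) (enn2real q) * indicator {k} j \<partial>count_space UNIV)"
    by (simp add: nn_integral_indicator_singleton)
  also have "\<dots> \<le> (\<integral>\<^sup>+j. ennpowr (a j) (enn2real q) \<partial>count_space UNIV)"
    by (intro nn_integral_mono) (auto simp: indicator_def)
  finally have "ennpowr (ennpowr (a k) (enn2real q)) (1 / enn2real q) \<le> lq_norm q a"
    using False r ennpowr_mono[of _ _ "1 / enn2real q"] by (simp add: lq_norm_def Lp_norm_def del: ennpowr_ennpowr)
  then show ?thesis using r by simp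
qed

lemma lq_norm_mono:
  assumes "0 < q" "\<And>k. a k \<le> b k" shows "lq_norm q a \<le> lq_norm q b"
proof (cases "q = \<infinity>")
  case True
  then show ?thesis using assms by (auto simp: lq_norm_def intro: SUP_mono)
next
  case False
  then have r: "0 < enn2real q" using assms by (simp add: enn2real_positive_iff less_top)
  then show ?thesis using assms False by (auto simp: lq_norm_def intro: Lp_norm_mono)
qed

lemma lq_norm_cmult:
  assumes "0 < q" "C < \<infinity>" shows "lq_norm q (\<lambda>k. C * a k) = C * lq_norm q a"
proof (cases "q = \<infinity>")
  case True
  then show ?thesis by (simp add: lq_norm_def SUP_mult_left_ennreal)
next
  case False
  then have r: "0 < enn2real q" using assms by (simp add: enn2real_positive_iff less_top)
  obtain c where c: "C = ennreal c" "0 \<le> c" using assms(2) by (cases C rule: ennreal_cases) auto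
  show ?thesis using r False
    by (simp add: lq_norm_def Lp_norm_def c ennpowr_cmult nn_integral_cmult powr_powr)
qed

text \<open>Reindexing the integers by \<open>int_decode\<close>, for which \<open>\<bar>int_decode n\<bar> \<ge> (n - 1) / 2\<close>, bounds the two-sided
geometric series by a one-sided one.\<close>

lemma lq_norm_geometric_finite:
  fixes \<epsilon> W :: real
  assumes q: "0 < q" and W: "0 \<le> W" and e: "0 \<le> \<epsilon>" "q < \<infinity> \<Longrightarrow> 0 < \<epsilon>"
  shows "lq_norm q (\<lambda>k. ennreal (W * 2 powr (- \<epsilon> * \<bar>of_int k\<bar>))) < \<infinity>"
proof (cases "q = \<infinity>")
  case True
  have "W * 2 powr (- \<epsilon> * \<bar>of_int k\<bar>) \<le> W * 2 powr 0" for k :: int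
    by (intro mult_left_mono powr_mono) (use W e in auto)
  then have "(SUP k::int. ennreal (W * 2 powr (- \<epsilon> * \<bar>of_int k\<bar>))) \<le> ennreal W"
    by (intro SUP_least ennreal_leI) simp
  then show ?thesis using True by (auto simp: lq_norm_def intro: le_less_trans)
next
  case False
  define r where "r = enn2real q"
  have r: "0 < r" using assms False by (simp add: r_def enn2real_positive_iff less_top)
  have e0: "0 < \<epsilon>" using e False by (simp add: less_top)
  define t where "t = 2 powr (- (\<epsilon> * r / 2))"
  have t: "0 < t" "t < 1" using e0 r by (simp_all add: t_def powr_less_one)
  define h where "h k = W powr r * 2 powr (- (\<epsilon> * r) * \<bar>of_int k\<bar>)" for k :: int
  have "(\<integral>\<^sup>+k. ennpowr (ennreal (W * 2 powr (- \<epsilon> * \<bar>of_int k\<bar>))) r \<partial>count_space UNIV)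
      = (\<integral>\<^sup>+k. ennreal (h k) \<partial>count_space UNIV)"
    using W by (simp add: h_def powr_mult powr_powr mult_ac)
  also have "\<dots> = (\<integral>\<^sup>+n. ennreal (h (int_decode n)) \<partial>count_space UNIV)"
    by (rule nn_integral_bij_count_space[symmetric]) (rule bij_int_decode)
  also have "\<dots> \<le> (\<integral>\<^sup>+n. ennreal (W powr r * 2 powr (\<epsilon> * r / 2) * t ^ n) \<partial>count_space UNIV)"
  proof (intro nn_integral_mono ennreal_leI)
    fix n :: nat
    have "int n - 1 \<le> 2 * \<bar>int_decode n\<bar>"
      by (auto simp: int_decode_def sum_decode_def)
    then have "real_of_int (int n - 1) \<le> real_of_int (2 * \<bar>int_decode n\<bar>)"
      by (rule of_int_le_iff[THEN iffD2])
    then have "(real n - 1) / 2 \<le> \<bar>of_int (int_decode n)\<bar>" by simp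
    moreover have "- (\<epsilon> * r) \<le> 0" using e0 r by simp
    ultimately have "- (\<epsilon> * r) * \<bar>of_int (int_decode n)\<bar> \<le> - (\<epsilon> * r) * ((real n - 1) / 2)"
      by (rule mult_left_mono_neg)
    then have "h (int_decode n) \<le> W powr r * 2 powr (- (\<epsilon> * r) * ((real n - 1) / 2))"
      unfolding h_def by (intro mult_left_mono[OF powr_mono]) simp_all
    also have "2 powr (- (\<epsilon> * r) * ((real n - 1) / 2)) = 2 powr (\<epsilon> * r / 2) * t ^ n"
      unfolding t_def by (simp add: powr_realpow[symmetric] powr_powr powr_add[symmetric] algebra_simps diff_divide_distrib)
    finally show "h (int_decode n) \<le> W powr r * 2 powr (\<epsilon> * r / 2) * t ^ n" by (simp add: mult.assoc)
  qed
  also have "\<dots> = (\<Sum>n. ennreal (W powr r * 2 powr (\<epsilon> * r / 2) * t ^ n))"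
    by (rule nn_integral_count_space_nat)
  also have "\<dots> < \<infinity>"
    using t by (subst suminf_ennreal2) (auto intro!: summable_mult simp: summable_geometric_iff)
  finally have "(\<integral>\<^sup>+k. ennpowr (ennreal (W * 2 powr (- \<epsilon> * \<bar>of_int k\<bar>))) r \<partial>count_space UNIV) < \<infinity>" .
  then show ?thesis using False
    by (auto simp: lq_norm_def Lp_norm_def r_def[symmetric] ennpowr_def less_top)
qed

lemma powi_eq_powr: "2 powi k = 2 powr real_of_int k"
  by (simp add: powr_real_of_int')

lemma dyadic_scale:
  assumes t: "0 < (t::real)" obtains k :: int where "2 powi (- k - 1) \<le> t" "t < 2 powi (- k)"
proof -
  define l where "l = \<lfloor>log 2 t\<rfloor>"
  have l: "real_of_int l \<le> log 2 t" "log 2 t < real_of_int l + 1" by (simp_all add: l_def)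
  have tl: "t = 2 powr log 2 t" using t by simp
  have "2 powr real_of_int l \<le> t" by (subst tl) (use l in \<open>simp del: powr_log_cancel\<close>)
  moreover have "t < 2 powr (real_of_int l + 1)" by (subst tl) (use l in \<open>simp del: powr_log_cancel\<close>)
  ultimately show thesis using that[of "- l - 1"] by (simp add: powi_eq_powr algebra_simps)
qed

lemma dyadic_scale_nat:
  assumes "0 < (t::real)" "t < 2 powr (- real n)"
  obtains j where "2 powi (- int (n + j) - 1) \<le> t" "t < 2 powi (- int (n + j))"
proof -
  obtain k where k: "2 powi (- k - 1) \<le> t" "t < 2 powi (- k)" using dyadic_scale[OF assms(1)] .
  have "2 powr (real_of_int (- k - 1)) < 2 powr (- real n)"
    using k(1) assms(2) unfolding powi_eq_powr by linarith
  then have "real_of_int (- k - 1) < - real n" by simp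
  then have "int n \<le> k" by linarith
  then have "k = int (n + nat (k - int n))" by simp
  then show thesis using that[of "nat (k - int n)"] k by metis
qed

text \<open>Comparison with twice the larger of the two values takes the place of convexity, which fails for \<open>Q < 1\<close>.\<close>

lemma abs_diff_powr_le:
  assumes "0 \<le> Q" shows "\<bar>a - b\<bar> powr Q \<le> 2 powr Q * (\<bar>a\<bar> powr Q + \<bar>b\<bar> powr (Q::real))"
proof -
  have "\<bar>a - b\<bar> powr Q \<le> (2 * max \<bar>a\<bar> \<bar>b\<bar>) powr Q" using assms by (intro powr_mono2) auto
  also have "\<dots> = 2 powr Q * max \<bar>a\<bar> \<bar>b\<bar> powr Q" by (simp add: powr_mult)
  also have "\<dots> \<le> 2 powr Q * (\<bar>a\<bar> powr Q + \<bar>b\<bar> powr Q)"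
    by (intro mult_left_mono) (auto simp: max_def)
  finally show ?thesis .
qed

lemma ennreal_less_obtain_real:
  assumes "0 < (\<epsilon>::ennreal)" obtains e where "0 < e" "ennreal e < \<epsilon>"
proof -
  obtain y where y: "0 < y" "y < \<epsilon>" using dense[OF assms] by blast
  then have "y < top" by (meson less_le_trans top_greatest)
  then obtain e where "y = ennreal e" "0 \<le> e" by (cases y rule: ennreal_cases) auto
  with y that[of e] show thesis by (cases "e = 0") auto
qed

section \<open>Function spaces with a uniform bound on every scale\<close>

text \<open>Membership in the ball of the Besov space with third index \<open>\<infinity>\<close>, the largest of the spaces with given
\<open>\<beta>\<close> and \<open>u\<close>; \<open>A\<close> bounds the \<open>u\<close>-th powers of the quasi-norms.\<close>

definition besov_bounded ::
    "'a measure \<Rightarrow> ('a \<Rightarrow> 'a \<Rightarrow> real) \<Rightarrow> real \<Rightarrow> real \<Rightarrow> real \<Rightarrow> ('a \<Rightarrow> real) \<Rightarrow> bool" where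
  "besov_bounded M d \<beta> u A f \<longleftrightarrow> f \<in> borel_measurable M \<and>
     power_integral M u f \<le> ennreal A \<and>
     (\<exists>g\<in>frac_gradients M d \<beta> f. \<forall>k. (\<integral>\<^sup>+x. ennreal (g k x powr u) \<partial>M) \<le> ennreal A)"

lemma besov_boundedI:
  assumes u: "0 < u" and R: "0 \<le> R" and f: "f \<in> Lp_space M u" and "Lp_qnorm M u f \<le> ennreal R"
    and g: "g \<in> frac_gradients M d \<beta> f" "\<And>k. Lp_norm M u (\<lambda>x. ennreal (g k x)) \<le> ennreal R"
  shows "besov_bounded M d \<beta> u (R powr u) f"
proof -
  have "(\<integral>\<^sup>+x. ennreal (g k x powr u) \<partial>M) \<le> ennreal (R powr u)" for k
  proof -
    have "(\<integral>\<^sup>+x. ennreal (g k x powr u) \<partial>M) = (\<integral>\<^sup>+x. ennpowr (ennreal (g k x)) u \<partial>M)"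
      using g by (intro nn_integral_cong) (auto simp: frac_gradients_def)
    then show ?thesis using g(2)[of k] u R by (simp add: Lp_norm_le_iff)
  qed
  then show ?thesis unfolding besov_bounded_def
    using f g assms(4) u R by (auto simp: Lp_space_def Lp_qnorm_le_iff)
qed

text \<open>Covers both scales of spaces, whose gradient parts \<open>\<Phi>\<close> dominate each single \<open>g k\<close>. The bound \<open>R + 1\<close> leaves room to choose a
gradient, as the infimum in the norm may fail to be attained.\<close>

lemma quasi_norm_besov_bounded:
  assumes u: "0 < u" and R: "0 \<le> R" and f: "f \<in> Lp_space M u"
    and fR: "Lp_qnorm M u f + (INF g \<in> frac_gradients M d \<beta> f. \<Phi> g) \<le> ennreal R"
    and \<Phi>: "\<And>g k. Lp_norm M u (\<lambda>x. ennreal (g k x)) \<le> \<Phi> g"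
  shows "besov_bounded M d \<beta> u ((R + 1) powr u) f"
proof -
  have 1: "Lp_qnorm M u f \<le> ennreal R" and I: "(INF g \<in> frac_gradients M d \<beta> f. \<Phi> g) \<le> ennreal R"
    using fR by (auto intro: order_trans[rotated])
  have "ennreal R < ennreal (R + 1)" using R by (simp add: ennreal_less_iff)
  from le_less_trans[OF I this] obtain g where g: "g \<in> frac_gradients M d \<beta> f" "\<Phi> g < ennreal (R + 1)"
    unfolding INF_less_iff by blast
  have "Lp_norm M u (\<lambda>x. ennreal (g k x)) \<le> ennreal (R + 1)" for k
    using \<Phi>[of g k] g(2) by (meson less_imp_le order_trans)
  moreover have "Lp_qnorm M u f \<le> ennreal (R + 1)"
    using 1 by (rule order_trans) (auto intro: ennreal_leI)
  ultimately show ?thesis using f R u g(1) by (intro besov_boundedI) auto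
qed

lemma HTL_norm_besov_bounded:
  assumes "0 < u" "0 < v" "0 \<le> R" "f \<in> HTL_space M d \<beta> u v" "HTL_norm M d \<beta> u v f \<le> ennreal R"
  shows "besov_bounded M d \<beta> u ((R + 1) powr u) f"
  by (rule quasi_norm_besov_bounded[where \<Phi> = "\<lambda>g. Lp_norm M u (\<lambda>x. lq_norm v (\<lambda>k. ennreal (g k x)))"])
    (use assms in \<open>auto simp: HTL_space_def HTL_norm_def intro!: Lp_norm_mono lq_norm_upper\<close>)

lemma HB_norm_besov_bounded:
  assumes "0 < u" "0 < v" "0 \<le> R" "f \<in> HB_space M d \<beta> u v" "HB_norm M d \<beta> u v f \<le> ennreal R"
  shows "besov_bounded M d \<beta> u ((R + 1) powr u) f"
  by (rule quasi_norm_besov_bounded[where \<Phi> = "\<lambda>g. lq_norm v (\<lambda>k. Lp_norm M u (\<lambda>x. ennreal (g k x)))"])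
    (use assms lq_norm_upper[of v] in \<open>auto simp: HB_space_def HB_norm_def\<close>)

lemma besov_bounded_cong_AE:
  assumes f: "besov_bounded M d \<beta> u A f" and g: "g \<in> borel_measurable M" and fg: "AE x in M. f x = g x"
  shows "besov_bounded M d \<beta> u A g"
proof -
  obtain N where N: "N \<in> null_sets M" "{x \<in> space M. f x \<noteq> g x} \<subseteq> N"
    using fg by (auto elim!: AE_E simp: null_sets_def)
  obtain h E where h: "\<And>k. h k \<in> borel_measurable M \<and> (\<forall>x\<in>space M. 0 \<le> h k x)" "E \<in> null_sets M"
    "\<And>k x y. x \<in> space M - E \<Longrightarrow> y \<in> space M - E \<Longrightarrow> 2 powi (- k - 1) \<le> d x y \<Longrightarrow> d x y < 2 powi (- k)
       \<Longrightarrow> \<bar>f x - f y\<bar> \<le> d x y powr \<beta> * (h k x + h k y)"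
    "\<And>k. (\<integral>\<^sup>+x. ennreal (h k x powr u) \<partial>M) \<le> ennreal A"
    using f unfolding besov_bounded_def frac_gradients_def by blast
  have "h \<in> frac_gradients M d \<beta> g" unfolding frac_gradients_def
  proof (safe intro!: bexI[of _ "E \<union> N"])
    fix k x y assume xy: "x \<in> space M" "y \<in> space M" "x \<notin> E" "x \<notin> N" "y \<notin> E" "y \<notin> N"
      "2 powi (- k - 1) \<le> d x y" "d x y < 2 powi (- k)"
    then have "f x = g x" "f y = g y" using N by auto
    then show "\<bar>g x - g y\<bar> \<le> d x y powr \<beta> * (h k x + h k y)" using h(3)[of x y k] xy by auto
  qed (use h N in auto)
  moreover have "power_integral M u g = power_integral M u f"
    using fg by (intro nn_integral_cong_AE) auto
  ultimately show ?thesis using f g h(4) unfolding besov_bounded_def by auto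
qed

section \<open>Geometry of quasi-metric measure spaces\<close>

text \<open>With a common constant for both defects of \<open>d\<close>, every loss in the radii below is a power of \<open>K\<close>.\<close>

locale quasi_metric_measure =
  fixes M :: "'a measure" and d :: "'a \<Rightarrow> 'a \<Rightarrow> real" and K :: real
  assumes qmm: "quasi_metric_measure_space M d"
    and K1: "1 \<le> K"
    and quasi_symmetric: "x \<in> space M \<Longrightarrow> y \<in> space M \<Longrightarrow> d y x \<le> K * d x y"
    and quasi_triangle: "x \<in> space M \<Longrightarrow> y \<in> space M \<Longrightarrow> z \<in> space M \<Longrightarrow>
      d x y \<le> K * max (d x z) (d z y)"

lemma quasi_metric_measure_exists:
  assumes "quasi_metric_measure_space M d"
  obtains K where "quasi_metric_measure M d K"
proof -
  have q: "quasi_metric (space M) d" using assms by (simp add: quasi_metric_measure_space_def)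
  then have nn: "\<And>x y. x \<in> space M \<Longrightarrow> y \<in> space M \<Longrightarrow> 0 \<le> d x y" by (auto simp: quasi_metric_def)
  obtain C0 where C0: "\<And>x y. x \<in> space M \<Longrightarrow> y \<in> space M \<Longrightarrow> d y x \<le> C0 * d x y"
    using q unfolding quasi_metric_def by blast
  obtain C1 where C1: "\<And>x y z. x \<in> space M \<Longrightarrow> y \<in> space M \<Longrightarrow> z \<in> space M \<Longrightarrow>
      d x y \<le> C1 * max (d x z) (d z y)"
    using q unfolding quasi_metric_def by blast
  define K where "K = max 1 (max C0 C1)"
  have "quasi_metric_measure M d K"
  proof
    fix x y z assume X: "x \<in> space M" "y \<in> space M" "z \<in> space M"
    have "C1 * max (d x z) (d z y) \<le> K * max (d x z) (d z y)"
      using nn[of x z] X by (intro mult_right_mono) (auto simp: K_def le_max_iff_disj)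
    then show "d x y \<le> K * max (d x z) (d z y)" using C1[of x y z] X by simp
  next
    fix x y assume X: "x \<in> space M" "y \<in> space M"
    have "C0 * d x y \<le> K * d x y" using nn[of x y] X by (intro mult_right_mono) (auto simp: K_def)
    then show "d y x \<le> K * d x y" using C0[of x y] X by simp
  qed (use assms in \<open>auto simp: K_def\<close>)
  then show thesis by (rule that)
qed

context quasi_metric_measure
begin

abbreviation X :: "'a set" where "X \<equiv> space M"

abbreviation B :: "'a \<Rightarrow> real \<Rightarrow> 'a set" where "B \<equiv> qm_ball X d"

lemma quasi_metric_d: "quasi_metric X d"
  using qmm by (simp add: quasi_metric_measure_space_def)

lemma d_nonneg: "x \<in> X \<Longrightarrow> y \<in> X \<Longrightarrow> 0 \<le> d x y"
  using quasi_metric_d by (auto simp: quasi_metric_def)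

lemma d_pos: "x \<in> X \<Longrightarrow> y \<in> X \<Longrightarrow> x \<noteq> y \<Longrightarrow> 0 < d x y"
  using quasi_metric_d by (auto simp: quasi_metric_def order_less_le)

lemma d_refl: "x \<in> X \<Longrightarrow> d x x = 0"
  using quasi_metric_d by (auto simp: quasi_metric_def)

lemma ball_iff: "y \<in> B x r \<longleftrightarrow> y \<in> X \<and> d x y < r"
  by (auto simp: qm_ball_def)

lemma ball_mono: "r \<le> t \<Longrightarrow> B x r \<subseteq> B x t" by (auto simp: qm_ball_def)

lemma ball_sets: "x \<in> X \<Longrightarrow> 0 < r \<Longrightarrow> B x r \<in> sets M"
  and ball_pos: "x \<in> X \<Longrightarrow> 0 < r \<Longrightarrow> 0 < emeasure M (B x r)"
  and ball_finite: "x \<in> X \<Longrightarrow> 0 < r \<Longrightarrow> emeasure M (B x r) < \<infinity>"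
  using qmm by (auto simp: quasi_metric_measure_space_def)

lemma quasi_triangle_less:
  assumes "x \<in> X" "y \<in> X" "z \<in> X" "d x z < r" "d z y < r"
  shows "d x y < K * r"
proof -
  have "K * max (d x z) (d z y) < K * r" using assms K1 by (intro mult_strict_left_mono) auto
  then show ?thesis using quasi_triangle[OF assms(1-3)] by simp
qed

lemma quasi_symmetric_less:
  assumes "x \<in> X" "y \<in> X" "d x y < r" shows "d y x < K * r"
proof -
  have "K * d x y < K * r" using assms K1 by (intro mult_strict_left_mono) auto
  then show ?thesis using quasi_symmetric[OF assms(1-2)] by simp
qed

lemma le_K_mult: "0 \<le> r \<Longrightarrow> r \<le> K * r"
  using mult_right_mono[OF K1, of r] by simp

lemma less_K_mult: "t < r \<Longrightarrow> 0 \<le> r \<Longrightarrow> t < K * r"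
  using le_K_mult[of r] by linarith

text \<open>Balls of radius \<open>r / K\<^sup>2\<close> therefore have all mutual distances below \<open>r\<close>; this is where the radii
\<open>2\<^sup>-\<^sup>n / K\<^sup>2\<close> below come from.\<close>

lemma ball_two_points:
  assumes "x \<in> X" "y \<in> B x r" "z \<in> B x r" "0 < r" shows "d y z < K\<^sup>2 * r"
proof -
  have "d y x < K * r" using assms quasi_symmetric_less by (auto simp: ball_iff)
  moreover have "d x z < K * r" using assms less_K_mult[of "d x z" r] by (simp add: ball_iff)
  ultimately have "d y z < K * (K * r)" using assms by (intro quasi_triangle_less[of y z x]) (auto simp: ball_iff)
  then show ?thesis by (simp add: power2_eq_square)
qed

lemma ball_nonempty_off_null:
  assumes "x \<in> X" "0 < r" "N \<in> null_sets M"
  obtains y where "y \<in> B x r" "y \<notin> N"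
proof -
  have "\<not> B x r \<subseteq> N"
  proof
    assume "B x r \<subseteq> N"
    then have "emeasure M (B x r) \<le> emeasure M N" using assms by (intro emeasure_mono) auto
    then show False using ball_pos[OF assms(1,2)] assms(3) by (auto simp: null_sets_def)
  qed
  then show thesis using that by blast
qed

lemma doubling_scale:
  assumes dbl: "doubling_measure M d"
  shows "\<exists>C\<ge>1. \<forall>x\<in>X. \<forall>r>0. emeasure M (B x (L * r)) \<le> ennreal C * emeasure M (B x r)"
proof -
  obtain C where C: "C \<ge> 1" "\<And>x r. x \<in> X \<Longrightarrow> r > 0 \<Longrightarrow>
      emeasure M (B x (2 * r)) \<le> ennreal C * emeasure M (B x r)"
    using dbl by (auto simp: doubling_measure_def)
  have iter: "emeasure M (B x (2 ^ n * r)) \<le> ennreal (C ^ n) * emeasure M (B x r)"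
    if "x \<in> X" "r > 0" for x r n
  proof (induction n)
    case (Suc n)
    have "emeasure M (B x (2 ^ Suc n * r)) = emeasure M (B x (2 * (2 ^ n * r)))" by (simp add: mult.assoc)
    also have "\<dots> \<le> ennreal C * emeasure M (B x (2 ^ n * r))" using that by (intro C) auto
    also have "\<dots> \<le> ennreal C * (ennreal (C ^ n) * emeasure M (B x r))"
      using Suc by (intro mult_left_mono) auto
    also have "\<dots> = ennreal (C ^ Suc n) * emeasure M (B x r)"
      using C(1) by (simp add: ennreal_mult mult.assoc)
    finally show ?case .
  qed simp
  obtain n where n: "L < 2 ^ n" using real_arch_pow[of 2 L] by auto
  have "emeasure M (B x (L * r)) \<le> ennreal (C ^ n) * emeasure M (B x r)"
    if x: "x \<in> X" "r > 0" for x r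
  proof -
    have "L * r \<le> 2 ^ n * r" using n x by simp
    then have "emeasure M (B x (L * r)) \<le> emeasure M (B x (2 ^ n * r))"
      using x by (intro emeasure_mono ball_mono ball_sets) auto
    then show ?thesis using iter[OF x] by (rule order_trans)
  qed
  then show ?thesis using C(1) by (intro exI[of _ "C ^ n"]) (auto simp: one_le_power)
qed

text \<open>If the measures of the balls about \<open>x0\<close> had a finite supremum, a ball of nearly maximal measure would be
disjoint from a ball of the same radius about a far point. By doubling, the second ball has at least a fixed
fraction of the measure of the first, so a ball containing both would exceed the supremum. The radius is taken
proportional to the distance of the two centres, which keeps the doubling constant independent of it.\<close>

lemma unbounded_ball_measure:
  assumes dbl: "doubling_measure M d" and unb: "\<And>D. \<exists>x\<in>X. \<exists>y\<in>X. D \<le> d x y"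
    and x0: "x0 \<in> X"
  shows "\<exists>r\<ge>1. m < measure M (B x0 r)"
proof (rule ccontr)
  assume "\<not> ?thesis"
  then have ub: "measure M (B x0 r) \<le> m" if "r \<ge> 1" for r using that by (auto simp: not_less)
  have em: "emeasure M (B x r) = ennreal (measure M (B x r))" if "x \<in> X" "0 < r" for x r
    using ball_finite[OF that] by (intro emeasure_eq_ennreal_measure) auto
  have fm: "B x r \<in> fmeasurable M" if "x \<in> X" "0 < r" for x r
    using ball_finite[OF that] ball_sets[OF that] by (auto simp: fmeasurable_def)
  obtain C where C: "C \<ge> 1" "\<And>x r. x \<in> X \<Longrightarrow> r > 0 \<Longrightarrow>
      emeasure M (B x ((2 * K ^ 4) * r)) \<le> ennreal C * emeasure M (B x r)"
    using doubling_scale[OF dbl, of "2 * K ^ 4"] by auto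
  define S where "S = (SUP r\<in>{1..}. measure M (B x0 r))"
  have bdd: "bdd_above ((\<lambda>r. measure M (B x0 r)) ` {1..})" using ub by (intro bdd_aboveI[of _ m]) auto
  have S_upper: "measure M (B x0 r) \<le> S" if "1 \<le> r" for r
    unfolding S_def using that bdd by (intro cSUP_upper) auto
  have "0 < measure M (B x0 1)" using ball_pos[OF x0, of 1] em[OF x0, of 1] by simp
  then have S0: "0 < S" using S_upper[of 1] by simp
  have "S / (1 + 1 / C) < S" using S0 C(1) by (simp add: divide_less_eq field_simps)
  then have "\<exists>r\<in>{1..}. S / (1 + 1 / C) < measure M (B x0 r)"
    using less_cSUP_iff[of "{1..}" "\<lambda>r. measure M (B x0 r)" "S / (1 + 1 / C)"] bdd
    unfolding S_def[symmetric] by auto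
  then obtain r0 where r0: "1 \<le> r0" "S / (1 + 1 / C) < measure M (B x0 r0)" by auto
  obtain a b where ab: "a \<in> X" "b \<in> X" "K\<^sup>2 * (K\<^sup>2 * r0) \<le> d a b" using unb by blast
  obtain x where x: "x \<in> X" "K\<^sup>2 * r0 \<le> d x0 x"
  proof (rule ccontr)
    assume "\<not> thesis"
    then have "d x0 a < K\<^sup>2 * r0" "d x0 b < K\<^sup>2 * r0" using that ab by (auto simp: not_le[symmetric])
    then have "d a b < K\<^sup>2 * (K\<^sup>2 * r0)"
      using ab x0 r0 K1 by (intro ball_two_points[OF x0]) (auto simp: ball_iff)
    then show False using ab by simp
  qed
  define r where "r = d x0 x / K\<^sup>2"
  have r: "r0 \<le> r" "d x0 x = K\<^sup>2 * r" using x K1 by (auto simp: r_def field_simps)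
  then have rpos: "0 < r" using r0 by simp
  have disj: "B x0 r \<inter> B x r = {}"
  proof (rule ccontr)
    assume "B x0 r \<inter> B x r \<noteq> {}"
    then obtain z where z: "z \<in> X" "d x0 z < r" "d x z < r" by (auto simp: ball_iff)
    have "d z x < K * r" using quasi_symmetric_less[OF x(1) z(1,3)] .
    moreover have "d x0 z < K * r" using z less_K_mult[of "d x0 z" r] rpos by simp
    ultimately have "d x0 x < K * (K * r)" using x0 x z by (intro quasi_triangle_less[of x0 x z]) auto
    then show False using r by (simp add: power2_eq_square)
  qed
  have sub1: "B x0 r \<subseteq> B x ((2 * K ^ 4) * r)"
  proof
    fix z assume z: "z \<in> B x0 r"
    have "1 \<le> K ^ 3" using K1 by (simp add: one_le_power)
    have "d x x0 \<le> K * (K\<^sup>2 * r)" using quasi_symmetric[OF x0 x(1)] r by simp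
    also have "\<dots> = K ^ 3 * r" by (simp add: power2_eq_square power3_eq_cube)
    also have "\<dots> < 2 * K ^ 3 * r" using rpos K1 by simp
    finally have 1: "d x x0 < 2 * K ^ 3 * r" .
    have "1 * r \<le> 2 * K ^ 3 * r" using rpos \<open>1 \<le> K ^ 3\<close> by (intro mult_right_mono) auto
    then have "d x0 z < 2 * K ^ 3 * r" using z by (auto simp: ball_iff)
    then have "d x z < K * (2 * K ^ 3 * r)" using x x0 z 1
      by (intro quasi_triangle_less[of x z x0]) (auto simp: ball_iff)
    also have "\<dots> = (2 * K ^ 4) * r" by (simp add: numeral_eq_Suc)
    finally show "z \<in> B x ((2 * K ^ 4) * r)" using z by (auto simp: ball_iff)
  qed
  define R where "R = K * (d x0 x + r + 1)"
  have dx: "0 \<le> d x0 x" using d_nonneg x0 x by auto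
  have R: "d x0 x + r + 1 \<le> R" using dx rpos le_K_mult[of "d x0 x + r + 1"] by (simp add: R_def)
  have sub2: "B x0 r \<union> B x r \<subseteq> B x0 R"
  proof
    fix z assume z: "z \<in> B x0 r \<union> B x r"
    show "z \<in> B x0 R"
    proof (cases "z \<in> B x0 r")
      case True then show ?thesis using R dx by (auto simp: ball_iff)
    next
      case False
      then have "d x z < d x0 x + r + 1" "z \<in> X" using z dx by (auto simp: ball_iff)
      then show ?thesis unfolding R_def using x x0 rpos
        by (auto simp: ball_iff intro!: quasi_triangle_less[of x0 z x])
    qed
  qed
  have "emeasure M (B x0 r) \<le> ennreal C * emeasure M (B x r)"
    using sub1 x rpos K1 by (intro order_trans[OF emeasure_mono C(2)]) (auto intro!: ball_sets)
  then have "measure M (B x0 r) \<le> C * measure M (B x r)"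
    using em[OF x0 rpos] em[OF x(1) rpos] C(1) by (simp flip: ennreal_mult)
  then have c1: "measure M (B x0 r) / C \<le> measure M (B x r)" using C(1) by (simp add: field_simps)
  have "measure M (B x0 r) + measure M (B x r) = measure M (B x0 r \<union> B x r)"
    using disj fm[OF x0 rpos] fm[OF x(1) rpos] by (intro measure_Un_AE[symmetric]) auto
  also have "\<dots> \<le> measure M (B x0 R)"
    using sub2 fm[OF x0, of R] R dx rpos ball_sets[OF x0 rpos] ball_sets[OF x(1) rpos]
    by (intro measure_mono_fmeasurable) auto
  also have "\<dots> \<le> S" using R dx rpos by (intro S_upper) simp
  finally have "measure M (B x0 r) * (1 + 1 / C) \<le> S" using c1 by (simp add: field_simps)
  moreover have "measure M (B x0 r0) \<le> measure M (B x0 r)"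
    using r(1) fm[OF x0 rpos] r0 ball_sets[OF x0, of r0]
    by (intro measure_mono_fmeasurable ball_mono) auto
  then have "S / (1 + 1 / C) < measure M (B x0 r)" using r0 by simp
  then have "S < measure M (B x0 r) * (1 + 1 / C)" using C(1) by (simp add: field_simps)
  ultimately show False by simp
qed

end

text \<open>What the growth condition amounts to on a bounded space: finite mass and a lower bound \<open>b r\<^sup>s\<close> for the
measure of small balls.\<close>

locale bounded_regular_space = quasi_metric_measure +
  fixes s b :: real
  assumes s_pos: "0 < s" and b_pos: "0 < b"
    and finite_space: "emeasure M (space M) < \<infinity>"
    and lower_regular: "x \<in> space M \<Longrightarrow> 0 < r \<Longrightarrow> r \<le> 1 \<Longrightarrow>
      ennreal (b * r powr s) \<le> emeasure M (qm_ball (space M) d x r)"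

text \<open>The whole space is a ball of radius \<open>E\<close> about each of its points; compare it with the ball of radius \<open>r\<close> by the
growth condition with \<open>l = E / r\<close>.\<close>

lemma (in quasi_metric_measure) bounded_regular_space_exists:
  assumes bdd: "\<And>x y. x \<in> X \<Longrightarrow> y \<in> X \<Longrightarrow> d x y < D"
    and s: "0 < s" and growth: "\<And>x r l. x \<in> X \<Longrightarrow> 0 < r \<Longrightarrow> 1 \<le> l \<Longrightarrow>
      emeasure M (B x (l * r)) \<le> ennreal (4 powr s * l powr s) * emeasure M (B x r)"
  obtains b where "bounded_regular_space M d K s b"
proof -
  define E where "E = max D 1"
  have E: "1 \<le> E" and bE: "\<And>x y. x \<in> X \<Longrightarrow> y \<in> X \<Longrightarrow> d x y < E"
    using bdd by (auto simp: E_def less_max_iff_disj)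
  obtain x0 where x0: "x0 \<in> X" using quasi_metric_d by (auto simp: quasi_metric_def)
  have whole: "B x E = X" if "x \<in> X" for x using bE that by (auto simp: ball_iff)
  have fin: "emeasure M X < \<infinity>" using ball_finite[OF x0, of E] whole[OF x0] E by simp
  have em: "emeasure M X = ennreal (measure M X)"
    using fin by (intro emeasure_eq_ennreal_measure) auto
  define m where "m = measure M X"
  have m: "0 < m" using ball_pos[OF x0, of E] whole[OF x0] E em by (simp add: m_def)
  define b where "b = m / (4 powr s * E powr s)"
  have low: "ennreal (b * r powr s) \<le> emeasure M (B x r)" if x: "x \<in> X" "0 < r" "r \<le> 1" for x r
  proof -
    have "emeasure M (B x ((E / r) * r)) \<le> ennreal (4 powr s * (E / r) powr s) * emeasure M (B x r)"
      using x E by (intro growth) auto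
    then have 1: "ennreal m \<le> ennreal (4 powr s * (E / r) powr s) * emeasure M (B x r)"
      using x whole em by (simp add: m_def)
    have 2: "emeasure M (B x r) = ennreal (measure M (B x r))"
      using ball_finite[of x r] x by (intro emeasure_eq_ennreal_measure) auto
    have "m \<le> 4 powr s * (E / r) powr s * measure M (B x r)"
      using 1 unfolding 2 by (simp flip: ennreal_mult)
    also have "\<dots> = (4 powr s * E powr s) * (measure M (B x r) / r powr s)"
      using x E by (simp add: powr_divide)
    finally have "b \<le> measure M (B x r) / r powr s"
      using E unfolding b_def by (simp add: divide_le_eq mult.commute)
    then have "b * r powr s \<le> measure M (B x r)" using x by (simp add: le_divide_eq)
    then show ?thesis unfolding 2 by (rule ennreal_leI)
  qed
  have "bounded_regular_space M d K s b"
    by unfold_locales (use s m E fin low in \<open>auto simp: b_def\<close>)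
  then show thesis by (rule that)
qed

context bounded_regular_space
begin

text \<open>A maximal family of centres whose balls of radius \<open>\<eta>\<close> are disjoint: its size is bounded because each of these
balls has measure at least \<open>b \<eta>\<^sup>s\<close>, and by maximality enlarging the balls by the factor \<open>K\<^sup>2\<close> covers the space.\<close>

lemma finite_ball_cover:
  assumes r: "0 < r"
  obtains F where "finite F" "F \<subseteq> X" "\<And>x. x \<in> X \<Longrightarrow> \<exists>y\<in>F. x \<in> B y r"
proof -
  define \<eta> where "\<eta> = min 1 r / K\<^sup>2"
  have K2: "1 \<le> K\<^sup>2" using K1 by (simp add: one_le_power)
  have \<eta>: "0 < \<eta>" "\<eta> \<le> 1" "K\<^sup>2 * \<eta> \<le> r"
    using r K2 K1 by (auto simp: \<eta>_def divide_le_eq min_le_iff_disj intro!: divide_pos_pos)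
  define m where "m = measure M X"
  have em: "emeasure M X = ennreal m" unfolding m_def
    using finite_space by (intro emeasure_eq_ennreal_measure) auto
  define Sep where "Sep F \<longleftrightarrow> finite F \<and> F \<subseteq> X \<and> disjoint_family_on (\<lambda>x. B x \<eta>) F" for F
  have pos: "0 < b * \<eta> powr s" using b_pos \<eta> by simp
  have card_le: "real (card F) \<le> m / (b * \<eta> powr s)" if F: "Sep F" for F
  proof -
    have "ennreal (real (card F) * (b * \<eta> powr s)) = (\<Sum>x\<in>F. ennreal (b * \<eta> powr s))"
      using pos by (simp add: ennreal_mult ennreal_of_nat_eq_real_of_nat)
    also have "\<dots> \<le> (\<Sum>x\<in>F. emeasure M (B x \<eta>))"
      using F \<eta> by (intro sum_mono lower_regular) (auto simp: Sep_def)
    also have "\<dots> = emeasure M (\<Union>x\<in>F. B x \<eta>)"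
      using F \<eta> by (intro sum_emeasure) (auto simp: Sep_def intro!: ball_sets)
    also have "\<dots> \<le> ennreal m" unfolding em[symmetric] by (rule emeasure_space)
    finally have "real (card F) * (b * \<eta> powr s) \<le> m" by (simp add: m_def)
    then show ?thesis using pos by (simp add: pos_le_divide_eq)
  qed
  have "\<exists>F. Sep F \<and> (\<forall>G. Sep G \<longrightarrow> card G \<le> card F)"
  proof (rule ex_has_greatest_nat)
    show "Sep {}" by (simp add: Sep_def disjoint_family_on_def)
    show "\<forall>F. Sep F \<longrightarrow> card F < Suc (nat \<lceil>m / (b * \<eta> powr s)\<rceil>)"
      using card_le by (meson less_Suc_eq_le of_nat_ceiling of_nat_le_iff order_trans)
  qed
  then obtain F where F: "Sep F" and mx: "\<And>G. Sep G \<Longrightarrow> card G \<le> card F" by blast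
  have cover: "\<exists>y\<in>F. x \<in> B y r" if x: "x \<in> X" for x
  proof (cases "x \<in> F")
    case True
    then show ?thesis using r d_refl[OF x] x by (auto simp: ball_iff intro!: bexI[of _ x])
  next
    case False
    then have "\<not> Sep (insert x F)" using mx[of "insert x F"] F by (auto simp: Sep_def)
    then obtain y z where yz: "y \<in> F" "z \<in> B x \<eta>" "z \<in> B y \<eta>"
      using F x False by (fastforce simp: Sep_def disjoint_family_on_insert)
    have y: "y \<in> X" and z: "z \<in> X" using yz F by (auto simp: Sep_def ball_iff)
    have "d z x < K * \<eta>" using yz by (intro quasi_symmetric_less[OF x z]) (auto simp: ball_iff)
    moreover have "d y z < K * \<eta>" using yz less_K_mult[of "d y z" \<eta>] \<eta> by (auto simp: ball_iff)
    ultimately have "d y x < K * (K * \<eta>)" using x y z by (intro quasi_triangle_less[of y x z]) auto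
    then show ?thesis using yz x \<eta> by (auto simp: ball_iff power2_eq_square intro!: bexI[of _ y])
  qed
  show thesis using that[of F] F cover by (auto simp: Sep_def)
qed

end

section \<open>Compactness forces boundedness\<close>

context quasi_metric_measure
begin

abbreviation bump ::
    "real \<Rightarrow> real \<Rightarrow> (int \<Rightarrow> real) \<Rightarrow> 'a \<Rightarrow> real \<Rightarrow> ('a \<Rightarrow> real) \<Rightarrow> bool" where
  "bump \<alpha> \<Lambda> W x0 r \<phi> \<equiv>
     (\<forall>x\<in>X. 0 \<le> \<phi> x \<and> \<phi> x \<le> 1) \<and> (\<forall>x\<in>B x0 r. \<phi> x = 1) \<and>
     (\<forall>x\<in>X - B x0 (\<Lambda> * r). \<phi> x = 0) \<and>
     (\<forall>k. \<forall>x\<in>X. \<forall>y\<in>X. 2 powi (- k - 1) \<le> d x y \<longrightarrow> d x y < 2 powi (- k) \<longrightarrow>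
        \<bar>\<phi> x - \<phi> y\<bar> \<le> d x y powr \<alpha> * W k)"

text \<open>The truncated distance function at scale \<open>r\<close>. As \<open>r \<ge> 1\<close>, the Hoelder constant of order \<open>a\<close> is at most 1,
uniformly in \<open>r\<close>. For distances near \<open>2\<^sup>-\<^sup>k\<close>, the Hoelder bound gives the factor \<open>2\<^bsup>-k(a - \<alpha>)\<^esup>\<close> at small
scales (\<open>k \<ge> 0\<close>), and \<open>\<bar>\<phi> x - \<phi> y\<bar> \<le> 1\<close> gives \<open>2\<^bsup>k\<alpha>\<^esup>\<close> at large ones (\<open>k < 0\<close>). So weights independent of the
point suffice, and they have finite \<open>\<ell>\<^sup>q\<close> norm.\<close>

lemma bump_functions:
  assumes adm: "admissible_smoothness X d q \<alpha>" and \<alpha>: "0 < \<alpha>" and q: "0 < q"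
  obtains \<Lambda> :: real and W :: "int \<Rightarrow> real" where "1 \<le> \<Lambda>" "\<And>k. 0 \<le> W k" "lq_norm q (\<lambda>k. ennreal (W k)) < \<infinity>"
    "\<And>x0 r. x0 \<in> X \<Longrightarrow> 1 \<le> r \<Longrightarrow> \<exists>\<phi>\<in>borel_measurable M. bump \<alpha> \<Lambda> W x0 r \<phi>"
proof -
  obtain a c where a: "\<alpha> \<le> a" "q < \<infinity> \<Longrightarrow> \<alpha> < a" and c: "1 \<le> c"
    and dist: "\<And>x0. x0 \<in> X \<Longrightarrow> \<exists>F. (\<forall>y\<in>X. d x0 y powr a \<le> c * F y \<and> F y \<le> c * d x0 y powr a) \<and>
        (\<forall>y\<in>X. \<forall>z\<in>X. \<bar>F y - F z\<bar> \<le> c * d y z powr a)"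
    using holder_distance_function[OF quasi_metric_d adm \<alpha>] by metis
  have a0: "0 < a" using a \<alpha> by simp
  \<comment> \<open>\<open>\<epsilon> > 0\<close> whenever \<open>q < \<infinity>\<close>; for \<open>q = \<infinity>\<close> bounded weights are enough.\<close>
  define \<epsilon> where "\<epsilon> = min \<alpha> (a - \<alpha>)"
  define W where "W k = 2 powr \<alpha> * 2 powr (- \<epsilon> * \<bar>of_int k\<bar>)" for k :: int
  have W0: "0 \<le> W k" for k by (simp add: W_def)
  have Wfin: "lq_norm q (\<lambda>k. ennreal (W k)) < \<infinity>"
    unfolding W_def using a \<alpha> q by (intro lq_norm_geometric_finite) (auto simp: \<epsilon>_def)
  \<comment> \<open>Off the ball of radius \<open>\<Lambda> r\<close>, the distance function is at least twice its maximum on the ball of radius \<open>r\<close>.\<close>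
  define \<Lambda> where "\<Lambda> = (2 * c\<^sup>2) powr (1 / a)"
  have "1 \<le> c\<^sup>2" using c by (simp add: one_le_power)
  then have \<Lambda>: "1 \<le> \<Lambda>" "\<Lambda> powr a = 2 * c\<^sup>2"
    unfolding \<Lambda>_def using a0 by (auto intro!: ge_one_powr_ge_zero simp: powr_powr)
  have wt: "t \<le> D powr \<alpha> * W k"
    if D: "2 powi (- k - 1) \<le> D" "D < 2 powi (- k)" and t: "t \<le> 1" "t \<le> D powr a" for D t :: real and k :: int
  proof -
    have Dp: "0 < D" using D(1) by (meson less_le_trans zero_less_numeral zero_less_power_int)
    show ?thesis
    proof (cases "0 \<le> k")
      case True
      have "D powr (a - \<alpha>) \<le> (2 powr (- real_of_int k)) powr (a - \<alpha>)"
        using D(2) Dp a by (intro powr_mono2) (auto simp: powi_eq_powr)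
      also have "\<dots> = 2 powr (- ((a - \<alpha>) * real_of_int k))" by (simp add: powr_powr mult.commute)
      also have "\<dots> \<le> 2 powr (- \<epsilon> * \<bar>of_int k\<bar>)"
        using True by (intro powr_mono) (auto simp: \<epsilon>_def intro!: mult_right_mono)
      also have "\<dots> \<le> W k" unfolding W_def
        using mult_right_mono[of 1 "2 powr \<alpha>" "2 powr (- \<epsilon> * \<bar>of_int k\<bar>)"] \<alpha> ge_one_powr_ge_zero[of 2 \<alpha>]
        by simp
      finally have "D powr \<alpha> * D powr (a - \<alpha>) \<le> D powr \<alpha> * W k" by (intro mult_left_mono) auto
      then show ?thesis using t Dp by (simp add: powr_add[symmetric])
    next
      case False
      have "1 = (2 powr real_of_int (- k - 1)) powr \<alpha> * (2 powr real_of_int (- k - 1)) powr (- \<alpha>)"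
        by (simp add: powr_add[symmetric])
      also have "\<dots> \<le> D powr \<alpha> * W k"
      proof (rule mult_mono)
        show "(2 powr real_of_int (- k - 1)) powr \<alpha> \<le> D powr \<alpha>"
          using D(1) \<alpha> by (intro powr_mono2) (auto simp: powi_eq_powr)
        have "(2 powr real_of_int (- k - 1)) powr (- \<alpha>) = 2 powr \<alpha> * 2 powr (\<alpha> * real_of_int k)"
          by (simp add: powr_powr powr_add[symmetric] algebra_simps)
        also have "\<alpha> * real_of_int k \<le> \<epsilon> * real_of_int k"
          using False by (intro mult_right_mono_neg) (auto simp: \<epsilon>_def)
        then have "2 powr \<alpha> * 2 powr (\<alpha> * real_of_int k) \<le> W k"
          unfolding W_def using False by (intro mult_left_mono powr_mono) auto
        finally show "(2 powr real_of_int (- k - 1)) powr (- \<alpha>) \<le> W k" .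
      qed auto
      finally show ?thesis using t by simp
    qed
  qed
  have "\<exists>\<phi>\<in>borel_measurable M. bump \<alpha> \<Lambda> W x0 r \<phi>" if x0: "x0 \<in> X" and r: "1 \<le> r" for x0 r
  proof -
    obtain F where F: "\<And>y. y \<in> X \<Longrightarrow> d x0 y powr a \<le> c * F y" "\<And>y. y \<in> X \<Longrightarrow> F y \<le> c * d x0 y powr a"
      "\<And>y z. y \<in> X \<Longrightarrow> z \<in> X \<Longrightarrow> \<bar>F y - F z\<bar> \<le> c * d y z powr a"
      using dist[OF x0] by blast
    define t where "t = c * r powr a"
    have ra: "1 \<le> r powr a" using r a0 by (intro ge_one_powr_ge_zero) auto
    then have t: "0 < t" unfolding t_def using c by (intro mult_pos_pos) auto
    define \<phi> where "\<phi> x = max 0 (min 1 (2 - F x / t))" for x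
    have \<phi>1: "\<bar>\<phi> x - \<phi> y\<bar> \<le> 1" for x y by (auto simp: \<phi>_def)
    have lip: "\<bar>\<phi> x - \<phi> y\<bar> \<le> d x y powr a" if xy: "x \<in> X" "y \<in> X" for x y
    proof -
      have "\<bar>\<phi> x - \<phi> y\<bar> \<le> \<bar>F x / t - F y / t\<bar>" unfolding \<phi>_def by linarith
      also have "\<dots> = \<bar>F x - F y\<bar> / t" using t by (simp add: diff_divide_distrib[symmetric])
      also have "\<dots> \<le> (c * d x y powr a) / t" using F(3)[OF xy] t by (intro divide_right_mono) auto
      also have "\<dots> = d x y powr a / r powr a" using c by (simp add: t_def)
      also have "\<dots> \<le> d x y powr a" using ra by (simp add: divide_le_eq mult_le_cancel_left1)
      finally show ?thesis .
    qed
    have meas: "\<phi> \<in> borel_measurable M"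
    proof (rule borel_measurableI_greater)
      fix y :: real
      have "{x \<in> X. y < \<phi> x} \<in> qm_open_sets X d"
        unfolding qm_open_sets_def
      proof (safe)
        fix x assume x: "x \<in> X" "y < \<phi> x"
        have "B x ((\<phi> x - y) powr (1 / a)) \<subseteq> {x \<in> X. y < \<phi> x}"
        proof
          fix z assume z: "z \<in> B x ((\<phi> x - y) powr (1 / a))"
          then have zM: "z \<in> X" by (simp add: ball_iff)
          have "d x z powr a < ((\<phi> x - y) powr (1 / a)) powr a"
            using z x zM a0 by (intro powr_less_mono2) (auto simp: ball_iff intro: d_nonneg)
          also have "\<dots> = \<phi> x - y" using x a0 by (simp add: powr_powr)
          finally show "z \<in> {x \<in> X. y < \<phi> x}" using lip[OF x(1) zM] zM by auto
        qed
        then show "\<exists>r>0. B x r \<subseteq> {x \<in> X. y < \<phi> x}"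
          using x by (intro exI[of _ "(\<phi> x - y) powr (1 / a)"]) auto
      qed
      then have "{x \<in> X. y < \<phi> x} \<in> sigma_sets X (qm_open_sets X d)"
        by (rule sigma_sets.Basic)
      then show "{x \<in> X. y < \<phi> x} \<in> sets M"
        using qmm by (auto simp: quasi_metric_measure_space_def)
    qed
    have one: "\<phi> x = 1" if x: "x \<in> B x0 r" for x
    proof -
      have xM: "x \<in> X" and dx: "d x0 x \<le> r" using x by (auto simp: ball_iff)
      have "F x \<le> c * d x0 x powr a" by (rule F(2)[OF xM])
      also have "\<dots> \<le> t" unfolding t_def using dx c a0 d_nonneg[OF x0 xM] by (intro mult_left_mono powr_mono2) auto
      finally have "F x / t \<le> 1" using t by (simp add: divide_le_eq)
      then show ?thesis by (simp add: \<phi>_def)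
    qed
    have zero: "\<phi> x = 0" if x: "x \<in> X - B x0 (\<Lambda> * r)" for x
    proof -
      have xM: "x \<in> X" and dx: "\<Lambda> * r \<le> d x0 x" using x by (auto simp: ball_iff)
      have "c * (2 * t) = (\<Lambda> * r) powr a" using \<Lambda> r by (simp add: powr_mult t_def power2_eq_square)
      also have "\<dots> \<le> d x0 x powr a" using dx \<Lambda> r a0 by (intro powr_mono2) auto
      also have "\<dots> \<le> c * F x" by (rule F(1)[OF xM])
      finally have "2 * t \<le> F x" using c by simp
      then have "2 \<le> F x / t" using t by (simp add: le_divide_eq)
      then show ?thesis by (simp add: \<phi>_def)
    qed
    have "\<bar>\<phi> x - \<phi> y\<bar> \<le> d x y powr \<alpha> * W k" if "x \<in> X" "y \<in> X"
      "2 powi (- k - 1) \<le> d x y" "d x y < 2 powi (- k)" for k x y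
      by (rule wt[OF that(3,4) \<phi>1 lip[OF that(1,2)]])
    moreover have "0 \<le> \<phi> x \<and> \<phi> x \<le> 1" for x by (simp add: \<phi>_def)
    ultimately show ?thesis using meas one zero by (intro bexI[of _ \<phi>]) auto
  qed
  then show thesis using that[OF \<Lambda>(1) W0 Wfin] by blast
qed

abbreviation test_function ::
    "real \<Rightarrow> real \<Rightarrow> ennreal \<Rightarrow> real \<Rightarrow> ennreal \<Rightarrow> 'a \<Rightarrow> real \<Rightarrow> ('a \<Rightarrow> real) \<Rightarrow> bool" where
  "test_function \<alpha> p q \<Lambda> R x0 r f \<equiv>
     HTL_norm M d \<alpha> p q f \<le> R \<and> HB_norm M d \<alpha> p q f \<le> R \<and>
     (\<forall>x\<in>X. \<bar>f x\<bar> \<le> measure M (B x0 r) powr (- 1 / p) * indicator (B x0 (\<Lambda> * r)) x) \<and>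
     (\<forall>x\<in>B x0 r. f x = measure M (B x0 r) powr (- 1 / p))"

text \<open>Bumps normalised by \<open>\<mu>(B(x0, r))\<^bsup>-1/p\<^esup>\<close>. By doubling, the support has measure at most a constant times
\<open>\<mu>(B(x0, r))\<close>, so that the norms in both spaces are bounded independently of \<open>r\<close>.\<close>

lemma test_functions:
  assumes adm: "admissible_smoothness X d q \<alpha>" and \<alpha>: "0 < \<alpha>" and q: "0 < q" and p: "0 < p"
    and dbl: "doubling_measure M d"
  obtains \<Lambda> :: real and R :: ennreal where "1 \<le> \<Lambda>" "R < \<infinity>"
    "\<And>x0 r. x0 \<in> X \<Longrightarrow> 1 \<le> r \<Longrightarrow> \<exists>f\<in>HTL_space M d \<alpha> p q \<inter> HB_space M d \<alpha> p q.
       test_function \<alpha> p q \<Lambda> R x0 r f"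
proof -
  obtain \<Lambda> :: real and W :: "int \<Rightarrow> real" where \<Lambda>: "1 \<le> \<Lambda>" and W: "\<And>k. 0 \<le> W k" "lq_norm q (\<lambda>k. ennreal (W k)) < \<infinity>"
    and bumps: "\<And>x0 r. x0 \<in> X \<Longrightarrow> 1 \<le> r \<Longrightarrow> \<exists>\<phi>\<in>borel_measurable M. bump \<alpha> \<Lambda> W x0 r \<phi>"
    using bump_functions[OF adm \<alpha> q] by blast
  obtain C where C: "C \<ge> 1" "\<And>x r. x \<in> X \<Longrightarrow> r > 0 \<Longrightarrow>
      emeasure M (B x (\<Lambda> * r)) \<le> ennreal C * emeasure M (B x r)"
    using doubling_scale[OF dbl, of \<Lambda>] by auto
  define L where "L = lq_norm q (\<lambda>k. ennreal (W k))"
  have Lfin: "L < \<infinity>" using W by (simp add: L_def)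
  define R where "R = ennreal (C powr (1 / p)) + L * ennreal (C powr (1 / p))"
  have Rfin: "R < \<infinity>" using Lfin by (simp add: R_def ennreal_mult_less_top)
  have "\<exists>f\<in>HTL_space M d \<alpha> p q \<inter> HB_space M d \<alpha> p q.
       test_function \<alpha> p q \<Lambda> R x0 r f"
    if x0: "x0 \<in> X" and r: "1 \<le> r" for x0 r
  proof -
    obtain \<phi> where \<phi>m: "\<phi> \<in> borel_measurable M" and \<phi>01: "\<And>x. x \<in> X \<Longrightarrow> 0 \<le> \<phi> x \<and> \<phi> x \<le> 1"
      and \<phi>1: "\<And>x. x \<in> B x0 r \<Longrightarrow> \<phi> x = 1" and \<phi>0: "\<And>x. x \<in> X - B x0 (\<Lambda> * r) \<Longrightarrow> \<phi> x = 0"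
      and \<phi>W: "\<And>k x y. x \<in> X \<Longrightarrow> y \<in> X \<Longrightarrow> 2 powi (- k - 1) \<le> d x y \<Longrightarrow> d x y < 2 powi (- k) \<Longrightarrow>
          \<bar>\<phi> x - \<phi> y\<bar> \<le> d x y powr \<alpha> * W k"
      using bumps[OF x0 r] by blast
    define S where "S = B x0 (\<Lambda> * r)"
    have \<Lambda>r: "0 < \<Lambda> * r" using \<Lambda> r by simp
    have S: "S \<in> sets M" unfolding S_def by (rule ball_sets[OF x0 \<Lambda>r])
    define m where "m = measure M (B x0 r)"
    have em: "emeasure M (B x0 r) = ennreal m"
      unfolding m_def using ball_finite[OF x0, of r] r by (intro emeasure_eq_ennreal_measure) auto
    have m: "0 < m" using ball_pos[OF x0, of r] em r by simp
    define k where "k = m powr (- 1 / p)"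
    have k0: "0 < k" using m by (simp add: k_def)
    have Sm: "ennreal k * ennpowr (emeasure M S) (1 / p) \<le> ennreal (C powr (1 / p))"
    proof -
      have "ennpowr (emeasure M S) (1 / p) \<le> ennpowr (ennreal (C * m)) (1 / p)"
        using C(1) C(2)[OF x0, of r] r p m em unfolding S_def by (intro ennpowr_mono) (auto simp: ennreal_mult)
      also have "\<dots> = ennreal (C powr (1 / p) * m powr (1 / p))" using C(1) m by (simp add: powr_mult)
      finally have "ennreal k * ennpowr (emeasure M S) (1 / p) \<le> ennreal k * ennreal (C powr (1 / p) * m powr (1 / p))"
        by (rule mult_left_mono) simp
      also have "\<dots> = ennreal (C powr (1 / p) * (k * m powr (1 / p)))"
        using k0 by (simp add: ennreal_mult[symmetric] mult_ac)
      also have "k * m powr (1 / p) = 1" unfolding k_def using m by (simp add: powr_add[symmetric])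
      finally show ?thesis by simp
    qed
    define f where "f x = k * \<phi> x" for x
    define g where "g j x = k * W j * indicator S x" for j and x :: 'a
    have fm: "f \<in> borel_measurable M" unfolding f_def using \<phi>m by measurable
    have fle: "\<bar>f x\<bar> \<le> k * indicator S x" if "x \<in> X" for x
      using \<phi>01[OF that] \<phi>0[of x] that k0 by (auto simp: f_def S_def indicator_def abs_mult)
    have eLp: "Lp_norm M p (\<lambda>x. A * (ennreal k * indicator S x)) \<le> A * ennreal (C powr (1 / p))"
      if A: "A < \<infinity>" for A
    proof -
      have "Lp_norm M p (\<lambda>x. A * (ennreal k * indicator S x)) = (A * ennreal k) * ennpowr (emeasure M S) (1 / p)"
        using Lp_norm_indicator[OF p S, of "A * ennreal k"] A by (simp add: ennreal_mult_less_top mult.assoc)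
      also have "\<dots> \<le> A * ennreal (C powr (1 / p))" using Sm by (simp add: mult.assoc mult_left_mono)
      finally show ?thesis .
    qed
    have fp: "Lp_qnorm M p f \<le> ennreal (C powr (1 / p))"
    proof -
      have "ennreal \<bar>f x\<bar> \<le> 1 * (ennreal k * indicator S x)" if "x \<in> X" for x
        using ennreal_leI[OF fle[OF that]] k0 by (auto simp: indicator_def split: if_splits)
      then have "Lp_qnorm M p f \<le> Lp_norm M p (\<lambda>x. 1 * (ennreal k * indicator S x))"
        unfolding Lp_qnorm_def by (intro Lp_norm_mono p)
      also have "\<dots> \<le> 1 * ennreal (C powr (1 / p))" by (rule eLp) simp
      finally show ?thesis by simp
    qed
    have gg: "g \<in> frac_gradients M d \<alpha> f"
      unfolding frac_gradients_def
    proof (safe intro!: bexI[of _ "{}"])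
      fix j show "g j \<in> borel_measurable M" unfolding g_def using S by measurable
      fix x assume "x \<in> X" show "0 \<le> g j x" using k0 W by (simp add: g_def)
    next
      fix j x y assume xy: "x \<in> X" "y \<in> X" "2 powi (- j - 1) \<le> d x y" "d x y < 2 powi (- j)"
      show "\<bar>f x - f y\<bar> \<le> d x y powr \<alpha> * (g j x + g j y)"
      proof (cases "x \<in> S \<or> y \<in> S")
        case True
        have "\<bar>f x - f y\<bar> = k * \<bar>\<phi> x - \<phi> y\<bar>" using k0 by (simp add: f_def right_diff_distrib[symmetric] abs_mult)
        also have "\<dots> \<le> k * (d x y powr \<alpha> * W j)" using \<phi>W[OF xy] k0 by (intro mult_left_mono) auto
        also have "\<dots> = d x y powr \<alpha> * (k * W j)" by simp
        also have "k * W j \<le> g j x + g j y" using True k0 W(1)[of j] by (auto simp: g_def indicator_def)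
        finally show ?thesis by (simp add: mult_left_mono)
      next
        case False
        then have "f x = 0" "f y = 0" using \<phi>0 xy by (auto simp: f_def S_def)
        then show ?thesis using k0 W(1)[of j] by (simp add: g_def)
      qed
    qed
    have ge: "ennreal (g j x) = ennreal (W j) * (ennreal k * indicator S x)" for j x
      using k0 W by (auto simp: g_def indicator_def ennreal_mult mult.commute)
    have "Lp_norm M p (\<lambda>x. lq_norm q (\<lambda>j. ennreal (g j x))) \<le> L * ennreal (C powr (1 / p))"
    proof -
      have "lq_norm q (\<lambda>j. ennreal (g j x)) = L * (ennreal k * indicator S x)" for x
      proof -
        have "ennreal k * indicator S x < \<infinity>" by (auto simp: indicator_def)
        then show ?thesis unfolding ge L_def
          using lq_norm_cmult[OF q, of "ennreal k * indicator S x" "\<lambda>j. ennreal (W j)"]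
          by (simp add: mult.commute)
      qed
      then show ?thesis using eLp[OF Lfin] by simp
    qed
    then have T: "HTL_norm M d \<alpha> p q f \<le> R"
      unfolding HTL_norm_def R_def using fp gg by (intro add_mono) (auto intro: INF_lower2)
    have "lq_norm q (\<lambda>j. Lp_norm M p (\<lambda>x. ennreal (g j x))) \<le> lq_norm q (\<lambda>j. ennreal (C powr (1 / p)) * ennreal (W j))"
    proof (intro lq_norm_mono q)
      fix j
      show "Lp_norm M p (\<lambda>x. ennreal (g j x)) \<le> ennreal (C powr (1 / p)) * ennreal (W j)"
        unfolding ge using eLp[of "ennreal (W j)"] by (simp add: mult.commute)
    qed
    also have "\<dots> = L * ennreal (C powr (1 / p))"
      using lq_norm_cmult[OF q, of "ennreal (C powr (1 / p))" "\<lambda>j. ennreal (W j)"] by (simp add: L_def mult.commute)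
    finally have Bn: "HB_norm M d \<alpha> p q f \<le> R"
      unfolding HB_norm_def R_def using fp gg by (intro add_mono) (auto intro: INF_lower2)
    have fLp: "f \<in> Lp_space M p" using fm fp by (auto simp: Lp_space_def intro: le_less_trans)
    have "f \<in> HTL_space M d \<alpha> p q \<inter> HB_space M d \<alpha> p q"
      using fLp T Bn Rfin by (auto simp: HTL_space_def HB_space_def intro: le_less_trans)
    moreover have "f x = k" if "x \<in> B x0 r" for x using \<phi>1[OF that] by (simp add: f_def)
    ultimately show ?thesis using T Bn fle unfolding k_def m_def S_def by blast
  qed
  then show thesis using that[OF \<Lambda> Rfin] by blast
qed

text \<open>In an unbounded space take concentric test functions with radii \<open>\<rho> n\<close> such that each ball has at least
twice the measure of the support of the previous function. For \<open>i < j\<close>, the function \<open>f i\<close> vanishes on at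
least half of the ball on which \<open>f j\<close> equals \<open>V\<^bsup>-1/p\<^esup>\<close>; as \<open>p' \<le> p\<close> and \<open>V \<ge> 1\<close>, this contributes at least
\<open>V\<^bsup>1 - p'/p\<^esup> / 2 \<ge> 1/2\<close> to the integral of \<open>\<bar>f j - f i\<bar>\<^bsup>p'\<^esup>\<close>. So the sequence is separated in
\<open>L\<^bsup>p'\<^esup>\<close>, although it is bounded in the source space.\<close>

lemma compact_embedding_imp_bounded:
  assumes adm: "admissible_smoothness X d q \<alpha>" and \<alpha>: "0 < \<alpha>" and q: "0 < q" and p: "0 < p'" "p' \<le> p"
    and dbl: "doubling_measure M d"
    and cpt: "HTL_compact_Lp M d \<alpha> p q p' \<or> HB_compact_Lp M d \<alpha> p q p'"
  shows "\<exists>D. \<forall>x\<in>X. \<forall>y\<in>X. d x y < D"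
proof (rule ccontr)
  assume "\<not> ?thesis"
  then have unb: "\<exists>x\<in>X. \<exists>y\<in>X. D \<le> d x y" for D by (auto simp: not_less)
  have p0: "0 < p" using p by simp
  obtain \<Lambda> R where \<Lambda>: "1 \<le> \<Lambda>" and R: "R < \<infinity>" and test:
    "\<And>x0 r. x0 \<in> X \<Longrightarrow> 1 \<le> r \<Longrightarrow> \<exists>f\<in>HTL_space M d \<alpha> p q \<inter> HB_space M d \<alpha> p q.
       test_function \<alpha> p q \<Lambda> R x0 r f"
    by (rule test_functions[OF adm \<alpha> q p0 dbl], rule that)
  obtain C where C: "C \<ge> 1" "\<And>x r. x \<in> X \<Longrightarrow> r > 0 \<Longrightarrow>
      emeasure M (B x (\<Lambda> * r)) \<le> ennreal C * emeasure M (B x r)"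
    using doubling_scale[OF dbl, of \<Lambda>] by auto
  obtain x0 where x0: "x0 \<in> X" using quasi_metric_d by (auto simp: quasi_metric_def)
  define V where "V r = measure M (B x0 r)" for r
  have eV: "emeasure M (B x0 r) = ennreal (V r)" if "0 < r" for r
    unfolding V_def using ball_finite[OF x0 that] by (intro emeasure_eq_ennreal_measure) auto
  have big: "\<exists>r\<ge>1. m < V r" for m unfolding V_def by (rule unbounded_ball_measure[OF dbl unb x0])
  have "\<exists>\<rho>. \<forall>n::nat. (1 \<le> \<rho> n \<and> 1 \<le> V (\<rho> n)) \<and> 2 * C * V (\<rho> n) \<le> V (\<rho> (Suc n))"
  proof (rule dependent_nat_choice)
    show "\<exists>r. 1 \<le> r \<and> 1 \<le> V r" using big[of 1] by (auto intro: less_imp_le)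
    fix r and n :: nat
    show "\<exists>t. (1 \<le> t \<and> 1 \<le> V t) \<and> 2 * C * V r \<le> V t"
      using big[of "max 1 (2 * C * V r)"] by (auto intro: less_imp_le)
  qed
  then obtain \<rho> :: "nat \<Rightarrow> real" where \<rho>: "\<And>n. 1 \<le> \<rho> n" "\<And>n. 1 \<le> V (\<rho> n)" "\<And>n. 2 * C * V (\<rho> n) \<le> V (\<rho> (Suc n))"
    by blast
  have grow: "2 * C * V (\<rho> i) \<le> V (\<rho> j)" if "i < j" for i j
    using that
  proof (induction j)
    case (Suc j)
    have "1 * V (\<rho> j) \<le> 2 * C * V (\<rho> j)" using C(1) \<rho>(2)[of j] by (intro mult_right_mono) auto
    then have "V (\<rho> j) \<le> V (\<rho> (Suc j))" using \<rho>(3)[of j] by simp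
    then show ?case using Suc \<rho>(3)[of j] by (cases "i = j") auto
  qed simp
  have "\<forall>n. \<exists>f. f \<in> HTL_space M d \<alpha> p q \<and> f \<in> HB_space M d \<alpha> p q \<and>
       HTL_norm M d \<alpha> p q f \<le> R \<and> HB_norm M d \<alpha> p q f \<le> R \<and>
       (\<forall>x\<in>X. \<bar>f x\<bar> \<le> V (\<rho> n) powr (- 1 / p) * indicator (B x0 (\<Lambda> * \<rho> n)) x) \<and>
       (\<forall>x\<in>B x0 (\<rho> n). f x = V (\<rho> n) powr (- 1 / p))"
    using test[OF x0 \<rho>(1)] unfolding V_def by (simp add: Bex_def conj_assoc)
  from choice[OF this] obtain f where f: "\<And>n. f n \<in> HTL_space M d \<alpha> p q" "\<And>n. f n \<in> HB_space M d \<alpha> p q"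
    "\<And>n. HTL_norm M d \<alpha> p q (f n) \<le> R" "\<And>n. HB_norm M d \<alpha> p q (f n) \<le> R"
    "\<And>n x. x \<in> X \<Longrightarrow> \<bar>f n x\<bar> \<le> V (\<rho> n) powr (- 1 / p) * indicator (B x0 (\<Lambda> * \<rho> n)) x"
    "\<And>n x. x \<in> B x0 (\<rho> n) \<Longrightarrow> f n x = V (\<rho> n) powr (- 1 / p)" by auto
  define T where "T = {g \<in> Lp_space M p'. \<exists>h\<in>range f. AE x in M. h x = g x}"
  have tb: "qnorm_totally_bounded (Lp_qnorm M p') T"
    using cpt
  proof
    assume "HTL_compact_Lp M d \<alpha> p q p'"
    then have "\<forall>S\<subseteq>HTL_space M d \<alpha> p q. (\<exists>R<\<infinity>. \<forall>f\<in>S. HTL_norm M d \<alpha> p q f \<le> R) \<longrightarrow>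
        qnorm_totally_bounded (Lp_qnorm M p') {g \<in> Lp_space M p'. \<exists>f\<in>S. AE x in M. f x = g x}"
      unfolding HTL_compact_Lp_def compact_embedding_def by (rule conjunct2)
    from this[THEN spec, of "range f"] show ?thesis
      unfolding T_def using f(1) f(3) R by (auto intro!: exI[of _ R])
  next
    assume "HB_compact_Lp M d \<alpha> p q p'"
    then have "\<forall>S\<subseteq>HB_space M d \<alpha> p q. (\<exists>R<\<infinity>. \<forall>f\<in>S. HB_norm M d \<alpha> p q f \<le> R) \<longrightarrow>
        qnorm_totally_bounded (Lp_qnorm M p') {g \<in> Lp_space M p'. \<exists>f\<in>S. AE x in M. f x = g x}"
      unfolding HB_compact_Lp_def compact_embedding_def by (rule conjunct2)
    from this[THEN spec, of "range f"] show ?thesis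
      unfolding T_def using f(2) f(4) R by (auto intro!: exI[of _ R])
  qed
  have fm: "f n \<in> borel_measurable M" for n using f(1)[of n] by (auto simp: HTL_space_def Lp_space_def)
  have fT: "f n \<in> T" for n
  proof -
    let ?k = "V (\<rho> n) powr (- 1 / p)"
    have S: "B x0 (\<Lambda> * \<rho> n) \<in> sets M" and Sf: "emeasure M (B x0 (\<Lambda> * \<rho> n)) < \<infinity>"
      using ball_sets[OF x0, of "\<Lambda> * \<rho> n"] ball_finite[OF x0, of "\<Lambda> * \<rho> n"] \<Lambda> \<rho>(1)[of n] by auto
    have "Lp_qnorm M p' (f n) \<le> Lp_norm M p' (\<lambda>x. ennreal ?k * indicator (B x0 (\<Lambda> * \<rho> n)) x)"
      unfolding Lp_qnorm_def
    proof (rule Lp_norm_mono[OF p(1)])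
      fix x assume "x \<in> X"
      from ennreal_leI[OF f(5)[OF this, of n]]
      show "ennreal \<bar>f n x\<bar> \<le> ennreal ?k * indicator (B x0 (\<Lambda> * \<rho> n)) x"
        by (auto simp: indicator_def split: if_splits)
    qed
    also have "\<dots> = ennreal ?k * ennpowr (emeasure M (B x0 (\<Lambda> * \<rho> n))) (1 / p')"
      by (rule Lp_norm_indicator[OF p(1) S]) simp
    also have "\<dots> < \<infinity>" using Sf by (simp add: ennpowr_def ennreal_mult_less_top)
    finally show ?thesis using fm by (auto simp: T_def Lp_space_def)
  qed
  \<comment> \<open>Chosen such that two functions within \<open>e\<close> of the same element differ by at most \<open>1/4\<close> in the integral below.\<close>
  define e where "e = (1 / (8 * 2 powr p')) powr (1 / p')"
  have e: "0 < e" "e powr p' = 1 / (8 * 2 powr p')" using p by (simp_all add: e_def powr_powr)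
  obtain F where F: "finite F" "F \<subseteq> T" "\<And>g. g \<in> T \<Longrightarrow> \<exists>h\<in>F. Lp_qnorm M p' (\<lambda>x. g x - h x) < ennreal e"
  proof -
    have "0 < ennreal e" using e(1) by simp
    then have "\<exists>K. finite K \<and> K \<subseteq> T \<and> (\<forall>g\<in>T. \<exists>h\<in>K. Lp_qnorm M p' (\<lambda>x. g x - h x) < ennreal e)"
      using tb unfolding qnorm_totally_bounded_def by blast
    then show thesis using that by blast
  qed
  have "\<forall>n. \<exists>k. k \<in> F \<and> Lp_qnorm M p' (\<lambda>x. f n x - k x) < ennreal e"
    using F(3)[OF fT] by blast
  from choice[OF this] obtain h where h: "\<And>n. h n \<in> F" "\<And>n. Lp_qnorm M p' (\<lambda>x. f n x - h n x) < ennreal e"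
    by blast
  have "finite (range h)" using h(1) by (intro finite_subset[OF _ F(1)]) blast
  then have "\<not> inj h" using finite_imageD[of h UNIV] infinite_UNIV_nat by blast
  then obtain i j where ij: "i < j" "h i = h j"
    unfolding inj_def using linorder_neqE_nat by metis
  have hm [measurable]: "h i \<in> borel_measurable M" using h(1)[of i] F(2) by (auto simp: T_def Lp_space_def)
  note fm [measurable]
  have Ile: "(\<integral>\<^sup>+x. ennreal (\<bar>f n x - h i x\<bar> powr p') \<partial>M) \<le> ennreal (e powr p')" if "n = i \<or> n = j" for n
  proof -
    have "h n = h i" using that ij(2) by auto
    then have "Lp_qnorm M p' (\<lambda>x. f n x - h i x) \<le> ennreal e" using less_imp_le[OF h(2)[of n]] by simp
    then show ?thesis by (rule Lp_qnorm_le_iff[OF p(1) less_imp_le[OF e(1)], THEN iffD1])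
  qed
  have "(\<integral>\<^sup>+x. ennreal (\<bar>f j x - f i x\<bar> powr p') \<partial>M) \<le>
     (\<integral>\<^sup>+x. ennreal (2 powr p') * (ennreal (\<bar>f j x - h i x\<bar> powr p') + ennreal (\<bar>f i x - h i x\<bar> powr p')) \<partial>M)"
  proof (intro nn_integral_mono)
    fix x
    have "\<bar>f j x - f i x\<bar> powr p' \<le> 2 powr p' * (\<bar>f j x - h i x\<bar> powr p' + \<bar>f i x - h i x\<bar> powr p')"
      using abs_diff_powr_le[of p' "f j x - h i x" "f i x - h i x"] p by simp
    then show "ennreal (\<bar>f j x - f i x\<bar> powr p') \<le>
      ennreal (2 powr p') * (ennreal (\<bar>f j x - h i x\<bar> powr p') + ennreal (\<bar>f i x - h i x\<bar> powr p'))"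
      by (simp add: ennreal_plus[symmetric] ennreal_mult[symmetric] del: ennreal_plus)
  qed
  also have "\<dots> = ennreal (2 powr p') *
      ((\<integral>\<^sup>+x. ennreal (\<bar>f j x - h i x\<bar> powr p') \<partial>M) + (\<integral>\<^sup>+x. ennreal (\<bar>f i x - h i x\<bar> powr p') \<partial>M))"
    by (simp add: nn_integral_cmult nn_integral_add)
  also have "\<dots> \<le> ennreal (2 powr p') * (ennreal (e powr p') + ennreal (e powr p'))"
    by (intro mult_left_mono add_mono Ile) auto
  also have "\<dots> = ennreal (1 / 4)"
    by (simp add: e(2) ennreal_plus[symmetric] ennreal_mult[symmetric] del: ennreal_plus)
  finally have upper: "(\<integral>\<^sup>+x. ennreal (\<bar>f j x - f i x\<bar> powr p') \<partial>M) \<le> ennreal (1 / 4)" .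
  define S where "S = B x0 (\<rho> j) - B x0 (\<Lambda> * \<rho> i)"
  have \<rho>0: "0 < \<rho> i" "0 < \<rho> j" "0 < \<Lambda> * \<rho> i" using \<rho>(1)[of i] \<rho>(1)[of j] \<Lambda> by auto
  have sets: "B x0 (\<rho> j) \<in> sets M" "B x0 (\<Lambda> * \<rho> i) \<in> sets M" using ball_sets[OF x0] \<rho>0 by auto
  then have S: "S \<in> sets M" by (simp add: S_def)
  have Sm: "V (\<rho> j) / 2 \<le> measure M S"
  proof -
    have "ennreal (V (\<Lambda> * \<rho> i)) \<le> ennreal (C * V (\<rho> i))"
      using C(2)[OF x0 \<rho>0(1)] eV[OF \<rho>0(1)] eV[OF \<rho>0(3)] C(1) by (simp add: ennreal_mult V_def)
    moreover have "0 \<le> C * V (\<rho> i)" using C(1) \<rho>(2)[of i] by simp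
    ultimately have "V (\<Lambda> * \<rho> i) \<le> C * V (\<rho> i)" by (simp add: ennreal_le_iff)
    then have 1: "V (\<Lambda> * \<rho> i) \<le> V (\<rho> j) / 2" using grow[OF ij(1)] by simp
    have fmj: "B x0 (\<rho> j) \<in> fmeasurable M" "B x0 (\<Lambda> * \<rho> i) \<in> fmeasurable M"
      using sets ball_finite[OF x0] \<rho>0 by (auto simp: fmeasurable_def)
    have "V (\<rho> j) \<le> measure M (S \<union> B x0 (\<Lambda> * \<rho> i))"
      unfolding V_def using fmj sets S by (intro measure_mono_fmeasurable) (auto simp: S_def)
    also have "\<dots> \<le> measure M S + V (\<Lambda> * \<rho> i)"
      unfolding V_def using fmj S sets by (intro measure_Un_le) auto
    finally show ?thesis using 1 by simp
  qed
  have "ennreal (1 / 2) \<le> ennreal (V (\<rho> j) powr (- p' / p)) * emeasure M S"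
  proof -
    have v1: "1 \<le> V (\<rho> j)" by (rule \<rho>(2))
    have "emeasure M S \<le> emeasure M (B x0 (\<rho> j))" by (intro emeasure_mono sets) (auto simp: S_def)
    then have eS: "emeasure M S = ennreal (measure M S)"
      using ball_finite[OF x0 \<rho>0(2)] by (intro emeasure_eq_ennreal_measure) (auto simp: top_unique)
    have "1 - p' / p = 1 + - p' / p" by simp
    then have split: "V (\<rho> j) powr (1 - p' / p) = V (\<rho> j) * V (\<rho> j) powr (- p' / p)"
      using v1 by (simp only: powr_add) simp
    have "1 \<le> V (\<rho> j) powr (1 - p' / p)" using v1 p by (intro ge_one_powr_ge_zero) auto
    then have "1 / 2 \<le> V (\<rho> j) powr (- p' / p) * (V (\<rho> j) / 2)" unfolding split by (simp add: mult.commute)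
    also have "\<dots> \<le> V (\<rho> j) powr (- p' / p) * measure M S" by (intro mult_left_mono Sm) simp
    finally have "ennreal (1 / 2) \<le> ennreal (V (\<rho> j) powr (- p' / p) * measure M S)" by (rule ennreal_leI)
    then show ?thesis unfolding eS by (simp add: ennreal_mult)
  qed
  also have "\<dots> = (\<integral>\<^sup>+x. ennreal (V (\<rho> j) powr (- p' / p)) * indicator S x \<partial>M)"
    using S by (simp add: nn_integral_cmult_indicator)
  also have "\<dots> \<le> (\<integral>\<^sup>+x. ennreal (\<bar>f j x - f i x\<bar> powr p') \<partial>M)"
  proof (intro nn_integral_mono)
    fix x assume x: "x \<in> X"
    show "ennreal (V (\<rho> j) powr (- p' / p)) * indicator S x \<le> ennreal (\<bar>f j x - f i x\<bar> powr p')"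
    proof (cases "x \<in> S")
      case True
      then have "f j x = V (\<rho> j) powr (- 1 / p)" "f i x = 0"
        using f(5)[OF x, of i] f(6)[of x j] by (auto simp: S_def)
      then show ?thesis using True by (simp add: powr_powr)
    qed simp
  qed
  finally have "ennreal (1 / 2) \<le> ennreal (1 / 4)" using upper by (rule order_trans)
  then have "(1 / 2 :: real) \<le> 1 / 4" by (subst (asm) ennreal_le_iff) simp
  then show False by simp
qed

end

section \<open>Oscillation profiles and pointwise estimates\<close>

lemma suminf_Suc_le_ennreal: "(\<Sum>j. f (Suc j)) \<le> (\<Sum>j. f j :: ennreal)"
proof (rule suminf_le_const)
  fix n
  have "(\<Sum>j<n. f (Suc j)) \<le> (\<Sum>j<Suc n. f j)"
    by (simp add: sum.lessThan_Suc_shift del: sum.lessThan_Suc)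
  also have "\<dots> \<le> (\<Sum>j. f j)" by (rule sum_le_suminf) auto
  finally show "(\<Sum>j<n. f (Suc j)) \<le> (\<Sum>j. f j)" .
qed simp

text \<open>The functions \<open>w n\<close> control \<open>f\<close> off the null set \<open>E\<close>: the \<open>u\<close>-th root of \<open>w n\<close> bounds the oscillation of \<open>f\<close> at all scales
below \<open>2\<^sup>-\<^sup>n\<close>. The bound on \<open>\<bar>f\<bar>\<close> itself is included so that values of \<open>f\<close> at points where \<open>w n\<close> is small are
controlled as well; it costs only the factor \<open>2\<^bsup>\<beta>n\<^esup>\<close>.\<close>

definition oscillation_profile ::
    "'a measure \<Rightarrow> ('a \<Rightarrow> 'a \<Rightarrow> real) \<Rightarrow> real \<Rightarrow> real \<Rightarrow> real \<Rightarrow> ('a \<Rightarrow> real) \<Rightarrow> (nat \<Rightarrow> 'a \<Rightarrow> real) \<Rightarrow> 'a set \<Rightarrow> bool"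
  where
  "oscillation_profile M d \<beta> u A f w E \<longleftrightarrow>
     E \<in> null_sets M \<and> (\<forall>n. w n \<in> borel_measurable M) \<and> (\<forall>n x. 0 \<le> w n x) \<and>
     (\<forall>n. \<forall>x\<in>space M - E. w (Suc n) x \<le> w n x) \<and>
     (\<forall>n. (\<integral>\<^sup>+x. ennreal (w n x) \<partial>M) \<le> ennreal (A * 2 powr (- (\<beta> * u) * real n))) \<and>
     (\<forall>n. \<forall>x\<in>space M - E. \<bar>f x\<bar> \<le> 2 powr (\<beta> * real n) * w n x powr (1 / u)) \<and>
     (\<forall>n. \<forall>x\<in>space M - E. \<forall>y\<in>space M - E. d x y < 2 powr (- real n) \<longrightarrow>
        \<bar>f x - f y\<bar> \<le> w n x powr (1 / u) + w n y powr (1 / u))"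

abbreviation (in quasi_metric_measure) "profile \<equiv> oscillation_profile M d"

text \<open>Take \<open>w n = (\<Sum>k\<ge>n. 2\<^bsup>-k\<beta>u\<^esup> g\<^sub>k\<^sup>u) + 2\<^bsup>-n\<beta>u\<^esup> \<bar>f\<bar>\<^sup>u\<close>. A distance below \<open>2\<^sup>-\<^sup>n\<close> lies in
one of the dyadic ranges with \<open>k \<ge> n\<close>, and the corresponding term alone gives the oscillation bound. The integral is a
geometric series. The null set also absorbs the points where \<open>w 0\<close> is infinite.\<close>

lemma (in quasi_metric_measure) besov_bounded_profile:
  assumes \<beta>: "0 < \<beta>" and u: "0 < u" and A: "0 \<le> A"
  obtains A' where "0 < A'"
    "\<And>f. besov_bounded M d \<beta> u A f \<Longrightarrow> \<exists>w E. profile \<beta> u A' f w E"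
proof -
  define c where "c = 2 powr (- (\<beta> * u))"
  have c: "0 < c" "c < 1" using \<beta> u by (simp_all add: c_def powr_less_one)
  have cn: "c ^ n = 2 powr (- (\<beta> * u) * real n)" for n
    by (simp add: c_def powr_realpow[symmetric] powr_powr)
  define A' where "A' = A * (1 / (1 - c)) + A + 1"
  have A': "0 < A'" using A c by (simp add: A'_def add_nonneg_pos)
  \<comment> \<open>Extracts the bound on a single function from the bound on its weighted \<open>u\<close>-th power.\<close>
  have root: "t \<le> 2 powr (\<beta> * real k) * v powr (1 / u)" if "0 \<le> t" "c ^ k * t powr u \<le> v" for t v k
  proof -
    have "t = (t powr u) powr (1 / u)" using that u by (simp add: powr_powr)
    also have "t powr u = 2 powr (\<beta> * u * real k) * (c ^ k * t powr u)"
      by (simp add: cn powr_add[symmetric] mult.assoc[symmetric])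
    also have "(2 powr (\<beta> * u * real k) * (c ^ k * t powr u)) powr (1 / u)
        \<le> (2 powr (\<beta> * u * real k) * v) powr (1 / u)"
      using u c that by (intro powr_mono2 mult_left_mono) auto
    also have "\<dots> = 2 powr (\<beta> * real k) * v powr (1 / u)"
    proof -
      have "0 \<le> c ^ k * t powr u" using c by simp
      then have "0 \<le> v" using that by linarith
      then show ?thesis using u by (simp add: powr_mult powr_powr)
    qed
    finally show ?thesis .
  qed
  have "\<exists>w E. profile \<beta> u A' f w E" if f: "besov_bounded M d \<beta> u A f" for f
  proof -
    obtain g E0 where g: "\<And>k. g k \<in> borel_measurable M" "\<And>k x. x \<in> X \<Longrightarrow> 0 \<le> g k x"
      "E0 \<in> null_sets M"
      "\<And>k x y. x \<in> X - E0 \<Longrightarrow> y \<in> X - E0 \<Longrightarrow> 2 powi (- k - 1) \<le> d x y \<Longrightarrow> d x y < 2 powi (- k)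
         \<Longrightarrow> \<bar>f x - f y\<bar> \<le> d x y powr \<beta> * (g k x + g k y)"
      "\<And>k. (\<integral>\<^sup>+x. ennreal (g k x powr u) \<partial>M) \<le> ennreal A"
      using f unfolding besov_bounded_def frac_gradients_def by blast
    have fm: "f \<in> borel_measurable M" and fA: "power_integral M u f \<le> ennreal A"
      using f by (auto simp: besov_bounded_def)
    note [measurable] = g(1) fm
    define a where "a k x = ennreal (c ^ k * g (int k) x powr u)" for k x
    define W where "W n x = (\<Sum>j. a (n + j) x) + ennreal (c ^ n * \<bar>f x\<bar> powr u)" for n x
    have Wm [measurable]: "W n \<in> borel_measurable M" for n unfolding W_def a_def by measurable
    have Wmono: "W (Suc n) x \<le> W n x" for n x
      unfolding W_def
    proof (rule add_mono)
      show "(\<Sum>j. a (Suc n + j) x) \<le> (\<Sum>j. a (n + j) x)"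
        using suminf_Suc_le_ennreal[of "\<lambda>j. a (n + j) x"] by simp
      have "c ^ Suc n \<le> c ^ n" using c by (intro power_decreasing) auto
      then show "ennreal (c ^ Suc n * \<bar>f x\<bar> powr u) \<le> ennreal (c ^ n * \<bar>f x\<bar> powr u)"
        by (intro ennreal_leI mult_right_mono) auto
    qed
    have W0: "W n x \<le> W 0 x" for n x
      by (induction n) (use Wmono order_trans in blast)+
    have aW: "a (n + j) x \<le> W n x" for n j x
    proof -
      have "a (n + j) x = (\<Sum>i\<in>{j}. a (n + i) x)" by simp
      also have "\<dots> \<le> (\<Sum>i. a (n + i) x)" by (rule sum_le_suminf) auto
      also have "\<dots> \<le> W n x" by (simp add: W_def)
      finally show ?thesis .
    qed
    have intW: "(\<integral>\<^sup>+x. W n x \<partial>M) \<le> ennreal (A' * c ^ n)" for n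
    proof -
      have "(\<integral>\<^sup>+x. W n x \<partial>M) = (\<Sum>j. \<integral>\<^sup>+x. a (n + j) x \<partial>M) + (\<integral>\<^sup>+x. ennreal (c ^ n * \<bar>f x\<bar> powr u) \<partial>M)"
      proof -
        have [measurable]: "a k \<in> borel_measurable M" for k unfolding a_def by measurable
        have "(\<integral>\<^sup>+x. (\<Sum>j. a (n + j) x) \<partial>M) = (\<Sum>j. \<integral>\<^sup>+x. a (n + j) x \<partial>M)"
          by (rule nn_integral_suminf) measurable
        then show ?thesis unfolding W_def by (subst nn_integral_add) auto
      qed
      also have "(\<integral>\<^sup>+x. ennreal (c ^ n * \<bar>f x\<bar> powr u) \<partial>M) = ennreal (c ^ n) * power_integral M u f"
        using c by (simp add: ennreal_mult nn_integral_cmult)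
      also have "\<dots> \<le> ennreal (c ^ n) * ennreal A" by (intro mult_left_mono fA) simp
      also have "\<dots> = ennreal (c ^ n * A)" using c A by (simp add: ennreal_mult)
      also have "(\<Sum>j. \<integral>\<^sup>+x. a (n + j) x \<partial>M) \<le> (\<Sum>j. ennreal (c ^ n * A * c ^ j))"
      proof (intro suminf_le)
        fix j
        have "(\<integral>\<^sup>+x. a (n + j) x \<partial>M) = ennreal (c ^ (n + j)) * (\<integral>\<^sup>+x. ennreal (g (int (n + j)) x powr u) \<partial>M)"
          using c unfolding a_def by (simp add: ennreal_mult nn_integral_cmult)
        also have "\<dots> \<le> ennreal (c ^ (n + j)) * ennreal A" by (intro mult_left_mono g(5)) simp
        also have "\<dots> = ennreal (c ^ n * A * c ^ j)" using c A by (simp add: ennreal_mult[symmetric] power_add mult_ac)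
        finally show "(\<integral>\<^sup>+x. a (n + j) x \<partial>M) \<le> ennreal (c ^ n * A * c ^ j)" .
      qed auto
      also have "(\<Sum>j. ennreal (c ^ n * A * c ^ j)) = ennreal (c ^ n * A * (1 / (1 - c)))"
        using c A by (subst suminf_ennreal2)
          (auto intro!: summable_mult summable_geometric simp: suminf_mult suminf_geometric)
      finally have "(\<integral>\<^sup>+x. W n x \<partial>M) \<le> ennreal (c ^ n * A * (1 / (1 - c))) + ennreal (c ^ n * A)"
        by (meson add_mono order_refl order_trans)
      also have "\<dots> = ennreal (c ^ n * A * (1 / (1 - c)) + c ^ n * A)"
        using c A by (intro ennreal_plus[symmetric]) auto
      also have "\<dots> \<le> ennreal (A' * c ^ n)"
        using c by (intro ennreal_leI) (simp add: A'_def algebra_simps)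
      finally show ?thesis .
    qed
    define E where "E = E0 \<union> {x \<in> X. W 0 x = \<infinity>}"
    have "AE x in M. W 0 x \<noteq> \<infinity>"
      using intW[of 0] by (intro nn_integral_noteq_infinite) (auto simp: top_unique)
    then have "{x \<in> X. W 0 x = \<infinity>} \<in> null_sets M"
      by (subst (asm) AE_iff_null) auto
    then have E: "E \<in> null_sets M" using g(3) by (auto simp: E_def)
    define w where "w n x = enn2real (W n x)" for n x
    have w0: "0 \<le> w n x" for n x by (simp add: w_def)
    have Ww: "W n x = ennreal (w n x)" if "x \<in> X - E" for n x
    proof -
      have "W 0 x \<noteq> top" using that by (auto simp: E_def)
      then have "W n x < top" using W0[of n x] by (metis less_top order_le_less_trans)
      then show ?thesis by (simp add: w_def)
    qed
    have gw: "g (int (n + j)) x \<le> 2 powr (\<beta> * real (n + j)) * w n x powr (1 / u)"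
      if x: "x \<in> X - E" for n j x
    proof (rule root)
      show "0 \<le> g (int (n + j)) x" using g(2) x by auto
      have "ennreal (c ^ (n + j) * g (int (n + j)) x powr u) \<le> ennreal (w n x)"
        using aW[of n j x] Ww[OF x] by (simp add: a_def)
      then show "c ^ (n + j) * g (int (n + j)) x powr u \<le> w n x"
        using w0[of n x] by (simp add: ennreal_le_iff)
    qed
    have osc: "\<bar>f x - f y\<bar> \<le> w n x powr (1 / u) + w n y powr (1 / u)"
      if xy: "x \<in> X - E" "y \<in> X - E" "d x y < 2 powr (- real n)" for n x y
    proof (cases "x = y")
      case False
      then have dp: "0 < d x y" using d_pos xy by auto
      obtain j where j: "2 powi (- int (n + j) - 1) \<le> d x y" "d x y < 2 powi (- int (n + j))"
        using dyadic_scale_nat[OF dp xy(3)] .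
      let ?k = "n + j"
      have "d x y powr \<beta> \<le> (2 powr (- real ?k)) powr \<beta>"
        using j(2) dp \<beta> by (intro powr_mono2) (auto simp: powi_eq_powr)
      then have dk: "d x y powr \<beta> \<le> 2 powr (- (\<beta> * real ?k))" by (simp add: powr_powr algebra_simps)
      have "\<bar>f x - f y\<bar> \<le> d x y powr \<beta> * (g (int ?k) x + g (int ?k) y)"
        using xy j by (intro g(4)) (auto simp: E_def)
      also have "\<dots> \<le> 2 powr (- (\<beta> * real ?k)) *
          (2 powr (\<beta> * real ?k) * w n x powr (1 / u) + 2 powr (\<beta> * real ?k) * w n y powr (1 / u))"
        using g(2) xy by (intro mult_mono dk add_mono gw) (auto intro!: add_nonneg_nonneg)
      also have "\<dots> = w n x powr (1 / u) + w n y powr (1 / u)"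
        by (simp add: distrib_left mult.assoc[symmetric] powr_add[symmetric])
      finally show ?thesis .
    qed simp
    have bnd: "\<bar>f x\<bar> \<le> 2 powr (\<beta> * real n) * w n x powr (1 / u)" if x: "x \<in> X - E" for n x
    proof (rule root)
      have "ennreal (c ^ n * \<bar>f x\<bar> powr u) \<le> W n x" unfolding W_def by simp
      then show "c ^ n * \<bar>f x\<bar> powr u \<le> w n x"
        unfolding Ww[OF x] using w0[of n x] by (simp add: ennreal_le_iff)
    qed simp
    have "(\<integral>\<^sup>+x. ennreal (w n x) \<partial>M) \<le> ennreal (A' * 2 powr (- (\<beta> * u) * real n))" for n
    proof -
      have "(\<integral>\<^sup>+x. ennreal (w n x) \<partial>M) \<le> (\<integral>\<^sup>+x. W n x \<partial>M)"
        by (intro nn_integral_mono) (auto simp: w_def ennreal_enn2real_if)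
      then show ?thesis using intW[of n] unfolding cn by (rule order_trans)
    qed
    moreover have "w (Suc n) x \<le> w n x" if x: "x \<in> X - E" for n x
      using Wmono[of n x] w0 unfolding Ww[OF x] by (simp add: ennreal_le_iff)
    moreover have "w n \<in> borel_measurable M" for n unfolding w_def by measurable
    ultimately have "profile \<beta> u A' f w E"
      unfolding oscillation_profile_def using E w0 bnd osc by auto
    then show ?thesis by blast
  qed
  then show thesis using that A' by blast
qed

text \<open>The factor 2 produces the contradiction \<open>2 m \<le> m\<close>, so that strict inequalities between integrals are avoided.\<close>

lemma exists_le_average:
  assumes h: "h \<in> borel_measurable M" "\<And>x. 0 \<le> h x" and S: "S \<in> sets M" and N: "N \<in> null_sets M"
    and m: "0 < m" "(\<integral>\<^sup>+x. ennreal (h x) \<partial>M) \<le> ennreal m" and b: "0 < b" "ennreal b \<le> emeasure M S"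
  shows "\<exists>x\<in>S - N. h x \<le> 2 * m / b"
proof (rule ccontr)
  assume "\<not> ?thesis"
  then have gt: "\<And>x. x \<in> S - N \<Longrightarrow> 2 * m / b \<le> h x" by (auto simp: not_le less_imp_le)
  have "ennreal (2 * m) = ennreal (2 * m / b) * ennreal b"
    using m b by (simp add: ennreal_mult[symmetric])
  also have "\<dots> \<le> ennreal (2 * m / b) * emeasure M S" by (intro mult_left_mono b) simp
  also have "\<dots> = (\<integral>\<^sup>+x. ennreal (2 * m / b) * indicator S x \<partial>M)"
    using S by (simp add: nn_integral_cmult_indicator)
  also have "\<dots> \<le> (\<integral>\<^sup>+x. ennreal (h x) \<partial>M)"
  proof (rule nn_integral_mono_AE)
    show "AE x in M. ennreal (2 * m / b) * indicator S x \<le> ennreal (h x)"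
      using AE_not_in[OF N] by eventually_elim (use gt in \<open>auto simp: indicator_def intro!: ennreal_leI\<close>)
  qed
  also have "\<dots> \<le> ennreal m" by (rule m)
  finally show False using m by simp
qed

context bounded_regular_space
begin

text \<open>The average of \<open>w (n - 1)\<close> over a ball of radius comparable to \<open>2\<^sup>-\<^sup>n\<close> is at most a constant times
\<open>2\<^bsup>n(s - \<beta>u)\<^esup>\<close>. Controlling \<open>w (n - 1)\<close> along with \<open>w n\<close> makes it possible to compare good points of
neighbouring scales. At \<open>n = 0\<close> the subtraction truncates and both bounds concern \<open>w 0\<close>.\<close>

lemma good_points:
  assumes A: "0 < A" and u: "0 < u"
  obtains c where "0 < c"
    "\<And>f w E x n. profile \<beta> u A f w E \<Longrightarrow> x \<in> X \<Longrightarrow>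
       \<exists>y\<in>B x (2 powr (- real n) / K\<^sup>2) - E. w n y powr (1 / u) \<le> c * 2 powr ((s / u - \<beta>) * real n) \<and>
         w (n - 1) y powr (1 / u) \<le> c * 2 powr ((s / u - \<beta>) * real n)"
proof -
  have Kp: "0 < K" "1 \<le> K\<^sup>2" using K1 by (simp_all add: one_le_power)
  define G where "G = 2 * (A * 2 powr \<bar>\<beta> * u\<bar>) * (K\<^sup>2) powr s / b"
  have G: "0 < G" using A b_pos Kp by (simp add: G_def)
  have "\<exists>y\<in>B x (2 powr (- real n) / K\<^sup>2) - E. w n y powr (1 / u) \<le> G powr (1 / u) * 2 powr ((s / u - \<beta>) * real n) \<and>
         w (n - 1) y powr (1 / u) \<le> G powr (1 / u) * 2 powr ((s / u - \<beta>) * real n)"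
    if P: "profile \<beta> u A f w E" and x: "x \<in> X" for f w E x n
  proof -
    define r where "r = 2 powr (- real n) / K\<^sup>2"
    have "2 powr (- real n) \<le> 2 powr 0" by (intro powr_mono) auto
    then have r: "0 < r" "r \<le> 1" using Kp by (auto simp: r_def divide_le_eq)
    define m where "m = A * 2 powr (- (\<beta> * u) * real (n - 1))"
    have m0: "0 < m" using A by (simp add: m_def)
    have int: "(\<integral>\<^sup>+x. ennreal (w (n - 1) x) \<partial>M) \<le> ennreal m"
      using P by (simp add: oscillation_profile_def m_def)
    obtain y where y: "y \<in> B x r - E" "w (n - 1) y \<le> 2 * m / (b * r powr s)"
      using exists_le_average[of "w (n - 1)" M "B x r" E m "b * r powr s"] P m0 int b_pos r
        lower_regular[OF x r] ball_sets[OF x r(1)]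
      by (auto simp: oscillation_profile_def)
    have "- (\<beta> * u) * real (n - 1) \<le> \<bar>\<beta> * u\<bar> + - (\<beta> * u) * real n"
      by (cases n) (auto simp: algebra_simps)
    then have "m \<le> A * (2 powr \<bar>\<beta> * u\<bar> * 2 powr (- (\<beta> * u) * real n))"
      unfolding m_def using A by (simp add: powr_add[symmetric])
    then have "2 * m / (b * r powr s) \<le> 2 * (A * (2 powr \<bar>\<beta> * u\<bar> * 2 powr (- (\<beta> * u) * real n))) / (b * r powr s)"
      using b_pos by (intro divide_right_mono) auto
    also have "\<dots> = G * 2 powr ((s - \<beta> * u) * real n)"
    proof -
      have "r powr s = 2 powr (- (s * real n)) / (K\<^sup>2) powr s"
        using Kp unfolding r_def by (simp add: powr_divide powr_powr mult.commute)
      moreover have "2 powr ((s - \<beta> * u) * real n) = 2 powr (- (\<beta> * u) * real n) / 2 powr (- (s * real n))"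
        by (simp add: powr_diff[symmetric] algebra_simps)
      ultimately show ?thesis unfolding G_def by simp
    qed
    finally have y2: "w (n - 1) y \<le> G * 2 powr ((s - \<beta> * u) * real n)" using y(2) by simp
    have yE: "y \<in> X - E" using y by (auto simp: ball_iff)
    have "w n y \<le> w (n - 1) y" using P yE by (cases n) (auto simp: oscillation_profile_def)
    then have y3: "w n y \<le> G * 2 powr ((s - \<beta> * u) * real n)" using y2 by simp
    have eq: "(G * 2 powr ((s - \<beta> * u) * real n)) powr (1 / u) = G powr (1 / u) * 2 powr ((s / u - \<beta>) * real n)"
      using G u by (simp add: powr_mult powr_powr field_simps)
    have "0 \<le> w n y" "0 \<le> w (n - 1) y" using P by (auto simp: oscillation_profile_def)
    then have "w n y powr (1 / u) \<le> G powr (1 / u) * 2 powr ((s / u - \<beta>) * real n)"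
      "w (n - 1) y powr (1 / u) \<le> G powr (1 / u) * 2 powr ((s / u - \<beta>) * real n)"
      unfolding eq[symmetric] using y2 y3 u by (auto intro!: powr_mono2)
    then show ?thesis using y(1) unfolding r_def by blast
  qed
  then show thesis using that[of "G powr (1 / u)"] G by auto
qed

abbreviation good_sequence ::
    "real \<Rightarrow> real \<Rightarrow> real \<Rightarrow> ('a \<Rightarrow> real) \<Rightarrow> (nat \<Rightarrow> 'a \<Rightarrow> real) \<Rightarrow> 'a set \<Rightarrow> 'a \<Rightarrow> (nat \<Rightarrow> 'a) \<Rightarrow> bool"
  where
  "good_sequence u \<sigma> c f w E x Y \<equiv>
     (\<forall>n. Y n \<in> B x (2 powr (- real n) / K\<^sup>2) - E \<and>
        w n (Y n) powr (1 / u) \<le> c * 2 powr (\<sigma> * real n) \<and>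
        \<bar>f (Y n) - f (Y (Suc n))\<bar> \<le> c * 2 powr (\<sigma> * real n)) \<and> \<bar>f (Y 0)\<bar> \<le> c"

text \<open>Good points near \<open>x\<close> at all scales; neighbouring ones are close enough for the oscillation bound at the coarser
of the two scales.\<close>

lemma good_chain:
  assumes A: "0 < A" and u: "0 < u"
  obtains c where "0 < c"
    "\<And>f w E x. profile \<beta> u A f w E \<Longrightarrow> x \<in> X \<Longrightarrow>
       \<exists>Y. good_sequence u (s / u - \<beta>) c f w E x Y"
proof -
  obtain c where c: "0 < c"
    "\<And>f w E x n. profile \<beta> u A f w E \<Longrightarrow> x \<in> X \<Longrightarrow>
       \<exists>y\<in>B x (2 powr (- real n) / K\<^sup>2) - E. w n y powr (1 / u) \<le> c * 2 powr ((s / u - \<beta>) * real n) \<and>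
         w (n - 1) y powr (1 / u) \<le> c * 2 powr ((s / u - \<beta>) * real n)"
    using good_points[OF A u, of \<beta>] by metis
  define \<sigma> where "\<sigma> = s / u - \<beta>"
  define C where "C = c * (1 + 2 powr \<sigma>)"
  have C: "c \<le> C" "0 < C" using c(1) by (auto simp: C_def algebra_simps add_pos_nonneg)
  have Kp: "0 < K" "1 \<le> K\<^sup>2" using K1 by (simp_all add: one_le_power)
  have "\<exists>Y. good_sequence u \<sigma> C f w E x Y"
    if P: "profile \<beta> u A f w E" and x: "x \<in> X" for f w E x
  proof -
    obtain Y where Y: "\<And>n. Y n \<in> B x (2 powr (- real n) / K\<^sup>2) - E"
      "\<And>n. w n (Y n) powr (1 / u) \<le> c * 2 powr (\<sigma> * real n)"
      "\<And>n. w (n - 1) (Y n) powr (1 / u) \<le> c * 2 powr (\<sigma> * real n)"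
      using c(2)[OF P x] unfolding \<sigma>_def by metis
    have YE: "Y n \<in> X - E" for n using Y(1)[of n] by (auto simp: ball_iff)
    have 1: "w n (Y n) powr (1 / u) \<le> C * 2 powr (\<sigma> * real n)" for n
      using Y(2)[of n] C(1) by (meson mult_right_mono order_trans powr_ge_zero)
    have 2: "\<bar>f (Y n) - f (Y (Suc n))\<bar> \<le> C * 2 powr (\<sigma> * real n)" for n
    proof -
      have "2 powr (- real (Suc n)) / K\<^sup>2 \<le> 2 powr (- real n) / K\<^sup>2"
        by (intro divide_right_mono powr_mono) auto
      then have "Y (Suc n) \<in> B x (2 powr (- real n) / K\<^sup>2)" using Y(1)[of "Suc n"] ball_mono by blast
      then have "d (Y n) (Y (Suc n)) < K\<^sup>2 * (2 powr (- real n) / K\<^sup>2)"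
        using Y(1)[of n] Kp by (intro ball_two_points[OF x]) auto
      then have "d (Y n) (Y (Suc n)) < 2 powr (- real n)" using Kp by simp
      then have "\<bar>f (Y n) - f (Y (Suc n))\<bar> \<le> w n (Y n) powr (1 / u) + w n (Y (Suc n)) powr (1 / u)"
        using P YE by (auto simp: oscillation_profile_def)
      also have "\<dots> \<le> c * 2 powr (\<sigma> * real n) + c * 2 powr (\<sigma> * real (Suc n))"
        using Y(2)[of n] Y(3)[of "Suc n"] by simp
      also have "\<dots> = C * 2 powr (\<sigma> * real n)" by (simp add: C_def algebra_simps powr_add)
      finally show ?thesis .
    qed
    have "\<bar>f (Y 0)\<bar> \<le> 2 powr (\<beta> * real 0) * w 0 (Y 0) powr (1 / u)"
      using P YE unfolding oscillation_profile_def by blast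
    then have "\<bar>f (Y 0)\<bar> \<le> C" using Y(2)[of 0] C(1) by simp
    then show ?thesis using Y(1) 1 2 by blast
  qed
  then show thesis using that[of C] C(2) unfolding \<sigma>_def by blast
qed

lemma profile_dist_good_point:
  assumes P: "profile \<beta> u A f w E" and x: "x \<in> X - E"
    and y: "y \<in> B x (2 powr (- real n) / K\<^sup>2) - E"
  shows "\<bar>f x - f y\<bar> \<le> w n x powr (1 / u) + w n y powr (1 / u)"
proof -
  have "1 \<le> K\<^sup>2" using K1 by (simp add: one_le_power)
  then have "2 powr (- real n) / K\<^sup>2 \<le> 2 powr (- real n)" by (simp add: divide_le_eq)
  then show ?thesis using P x y by (auto simp: oscillation_profile_def ball_iff)
qed

text \<open>Here the increments along a chain of good points grow geometrically, so their sum is dominated by the last one.\<close>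

lemma profile_growth_subcritical:
  assumes A: "0 < A" and u: "0 < u" and sub: "\<beta> * u < s"
  obtains C where "0 < C"
    "\<And>f w E x n. profile \<beta> u A f w E \<Longrightarrow> x \<in> X - E \<Longrightarrow>
       \<bar>f x\<bar> \<le> w n x powr (1 / u) + C * 2 powr ((s / u - \<beta>) * real n)"
proof -
  obtain c where c: "0 < c"
    "\<And>f w E x. profile \<beta> u A f w E \<Longrightarrow> x \<in> X \<Longrightarrow>
       \<exists>Y. good_sequence u (s / u - \<beta>) c f w E x Y"
    using good_chain[OF A u, of \<beta>] by metis
  define \<sigma> where "\<sigma> = s / u - \<beta>"
  have \<sigma>: "0 < \<sigma>" using sub u by (simp add: \<sigma>_def field_simps)
  then have t: "1 < 2 powr \<sigma>" by (intro gr_one_powr) auto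
  define C1 where "C1 = c + c / (2 powr \<sigma> - 1)"
  have C1: "0 < C1" "c \<le> C1" using c(1) t by (simp_all add: C1_def add_pos_pos)
  have "c = (c / (2 powr \<sigma> - 1)) * (2 powr \<sigma> - 1)" using t \<sigma> by simp
  also have "\<dots> \<le> C1 * (2 powr \<sigma> - 1)" using t c(1) by (intro mult_right_mono) (auto simp: C1_def)
  \<comment> \<open>This is the induction step for the bound \<open>C1 2\<^bsup>\<sigma>n\<^esup>\<close> along the chain.\<close>
  finally have C1s: "C1 + c \<le> C1 * 2 powr \<sigma>" by (simp add: algebra_simps)
  have "\<bar>f x\<bar> \<le> w n x powr (1 / u) + (C1 + c) * 2 powr (\<sigma> * real n)"
    if P: "profile \<beta> u A f w E" and x: "x \<in> X - E" for f w E x n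
  proof -
    obtain Y where Y: "\<And>n. Y n \<in> B x (2 powr (- real n) / K\<^sup>2) - E"
      "\<And>n. w n (Y n) powr (1 / u) \<le> c * 2 powr (\<sigma> * real n)"
      "\<And>n. \<bar>f (Y n) - f (Y (Suc n))\<bar> \<le> c * 2 powr (\<sigma> * real n)" "\<bar>f (Y 0)\<bar> \<le> c"
      using c(2)[OF P, of x] x unfolding \<sigma>_def by auto
    have fY: "\<bar>f (Y n)\<bar> \<le> C1 * 2 powr (\<sigma> * real n)" for n
    proof (induction n)
      case 0
      then show ?case using Y(4) C1 by simp
    next
      case (Suc n)
      have "\<bar>f (Y (Suc n))\<bar> \<le> (C1 + c) * 2 powr (\<sigma> * real n)"
        using Suc Y(3)[of n] by (simp add: algebra_simps)
      also have "\<dots> \<le> (C1 * 2 powr \<sigma>) * 2 powr (\<sigma> * real n)" by (intro mult_right_mono C1s) simp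
      also have "\<dots> = C1 * 2 powr (\<sigma> * real (Suc n))" by (simp add: algebra_simps powr_add)
      finally show ?case .
    qed
    show ?thesis using profile_dist_good_point[OF P x Y(1)[of n]] Y(2)[of n] fY[of n]
      by (simp add: algebra_simps)
  qed
  then show thesis using that[of "C1 + c"] C1 c(1) unfolding \<sigma>_def by auto
qed

text \<open>The integrals of the \<open>w n\<close> have a finite sum.\<close>

lemma profile_tendsto_zero:
  assumes P: "profile \<beta> u A f w E" and "0 < A" "0 < \<beta>" "0 < u"
  shows "AE x in M. (\<lambda>n. w n x) \<longlonglongrightarrow> 0"
proof -
  define t where "t = 2 powr (- (\<beta> * u))"
  have t: "0 < t" "t < 1" using assms by (simp_all add: t_def powr_less_one)
  have [measurable]: "w n \<in> borel_measurable M" for n using P by (simp add: oscillation_profile_def)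
  have w0: "0 \<le> w n x" for n x using P by (simp add: oscillation_profile_def)
  have "(\<integral>\<^sup>+x. (\<Sum>n. ennreal (w n x)) \<partial>M) = (\<Sum>n. \<integral>\<^sup>+x. ennreal (w n x) \<partial>M)"
    by (intro nn_integral_suminf) auto
  also have "\<dots> \<le> (\<Sum>n. ennreal (A * t ^ n))"
    using P by (intro suminf_le)
      (auto simp: oscillation_profile_def t_def powr_realpow[symmetric] powr_powr)
  also have "\<dots> < \<infinity>" using t assms by (subst suminf_ennreal2) (auto intro!: summable_mult summable_geometric)
  finally have "(\<integral>\<^sup>+x. (\<Sum>n. ennreal (w n x)) \<partial>M) \<noteq> \<infinity>" by simp
  then have "AE x in M. (\<Sum>n. ennreal (w n x)) \<noteq> \<infinity>" by (intro nn_integral_noteq_infinite) auto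
  then show ?thesis
  proof eventually_elim
    case (elim x)
    then have "summable (\<lambda>n. w n x)" using w0 by (intro summable_suminf_not_top) auto
    then show ?case by (rule summable_LIMSEQ_zero)
  qed
qed

abbreviation holder_bounded :: "'a set \<Rightarrow> real \<Rightarrow> real \<Rightarrow> ('a \<Rightarrow> real) \<Rightarrow> bool" where
  "holder_bounded S C \<gamma> f \<equiv>
     (\<forall>x\<in>S. \<bar>f x\<bar> \<le> C) \<and> (\<forall>x\<in>S. \<forall>y\<in>S. \<bar>f x - f y\<bar> \<le> C * d x y powr \<gamma>)"

text \<open>Here the increments along a chain of good points decay geometrically, and at almost every \<open>x\<close> the chain
converges to \<open>f x\<close>; so \<open>f x\<close> differs from the good value at scale \<open>n\<close> by at most a constant times
\<open>2\<^bsup>-n(\<beta> - s/u)\<^esup>\<close>. Two points at distance about \<open>2\<^sup>-\<^sup>n\<close> are compared through their good points at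
that scale.\<close>

lemma profile_holder_supercritical:
  assumes A: "0 < A" and u: "0 < u" and \<beta>: "0 < \<beta>" and super: "s < \<beta> * u"
  obtains C where "0 < C"
    "\<And>f w E. profile \<beta> u A f w E \<Longrightarrow> \<exists>N\<in>null_sets M.
       holder_bounded (X - N) C (\<beta> - s / u) f"
proof -
  obtain c where c: "0 < c"
    "\<And>f w E x. profile \<beta> u A f w E \<Longrightarrow> x \<in> X \<Longrightarrow>
       \<exists>Y. good_sequence u (s / u - \<beta>) c f w E x Y"
    using good_chain[OF A u, of \<beta>] by metis
  have Kp: "0 < K" "1 \<le> K\<^sup>2" using K1 by (simp_all add: one_le_power)
  define \<sigma> where "\<sigma> = s / u - \<beta>"
  have \<sigma>: "\<sigma> < 0" using super u by (simp add: \<sigma>_def field_simps)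
  then have t: "2 powr \<sigma> < 1" by (simp add: powr_less_one)
  define C1 where "C1 = c / (1 - 2 powr \<sigma>)"
  have C1: "0 < C1" "c = C1 * (1 - 2 powr \<sigma>)" using c(1) t \<sigma> by (simp_all add: C1_def)
  define C2 where "C2 = 2 * C1 + 2 * c"
  define C where "C = C2 * (2 * K\<^sup>2) powr (- \<sigma>)"
  have KK: "1 \<le> (2 * K\<^sup>2) powr (- \<sigma>)" using Kp \<sigma> by (intro ge_one_powr_ge_zero) auto
  have C2: "0 < C2" using C1 c by (simp add: C2_def)
  have "C2 * 1 \<le> C" unfolding C_def using C2 KK by (intro mult_left_mono) auto
  then have C: "0 < C" "C2 \<le> C" using C2 by auto
  have "\<exists>N\<in>null_sets M. holder_bounded (X - N) C (\<beta> - s / u) f"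
    if P: "profile \<beta> u A f w E" for f w E
  proof -
    have En: "E \<in> null_sets M" using P by (simp add: oscillation_profile_def)
    obtain N0 where N0: "N0 \<in> null_sets M" "{x \<in> X. \<not> (\<lambda>n. w n x) \<longlonglongrightarrow> 0} \<subseteq> N0"
      using profile_tendsto_zero[OF P A \<beta> u] by (auto elim!: AE_E simp: null_sets_def)
    define N where "N = E \<union> N0"
    have N: "N \<in> null_sets M" using En N0 by (auto simp: N_def)
    have chain: "\<exists>Y. (\<forall>n. Y n \<in> B x (2 powr (- real n) / K\<^sup>2) - E \<and>
              w n (Y n) powr (1 / u) \<le> c * 2 powr (\<sigma> * real n) \<and> \<bar>f x - f (Y n)\<bar> \<le> C1 * 2 powr (\<sigma> * real n)) \<and>
              \<bar>f (Y 0)\<bar> \<le> c" if x: "x \<in> X - N" for x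
    proof -
      obtain Y where Y: "\<And>n. Y n \<in> B x (2 powr (- real n) / K\<^sup>2) - E"
        "\<And>n. w n (Y n) powr (1 / u) \<le> c * 2 powr (\<sigma> * real n)"
        "\<And>n. \<bar>f (Y n) - f (Y (Suc n))\<bar> \<le> c * 2 powr (\<sigma> * real n)" "\<bar>f (Y 0)\<bar> \<le> c"
        using c(2)[OF P, of x] x unfolding \<sigma>_def by auto
      have w_lim: "(\<lambda>n. w n x) \<longlonglongrightarrow> 0" using x N0 by (auto simp: N_def)
      \<comment> \<open>\<open>C1\<close> is chosen such that the differences of \<open>C1 2\<^bsup>\<sigma>n\<^esup>\<close> equal the bounds on the increments.\<close>
      have tel: "\<bar>f (Y n) - f (Y (n + k))\<bar> \<le> C1 * (2 powr (\<sigma> * real n) - 2 powr (\<sigma> * real (n + k)))" for n k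
      proof (induction k)
        case (Suc k)
        have e: "2 powr (\<sigma> * real (n + Suc k)) = 2 powr \<sigma> * 2 powr (\<sigma> * real (n + k))"
          by (simp add: powr_add[symmetric] algebra_simps)
        have "c * 2 powr (\<sigma> * real (n + k)) = C1 * (2 powr (\<sigma> * real (n + k)) - 2 powr (\<sigma> * real (n + Suc k)))"
          unfolding e by (subst C1(2)) (simp add: algebra_simps)
        then show ?case using Suc Y(3)[of "n + k"] by (simp add: algebra_simps)
      qed simp
      have "\<bar>f x - f (Y n)\<bar> \<le> C1 * 2 powr (\<sigma> * real n)" for n
      proof -
        have le: "\<bar>f x - f (Y n)\<bar> \<le> w (n + k) x powr (1 / u) + c * 2 powr (\<sigma> * real (n + k)) + C1 * 2 powr (\<sigma> * real n)" for k
        proof -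
          have "\<bar>f x - f (Y (n + k))\<bar> \<le> w (n + k) x powr (1 / u) + w (n + k) (Y (n + k)) powr (1 / u)"
            using profile_dist_good_point[OF P _ Y(1)] x by (auto simp: N_def)
          moreover have "C1 * (2 powr (\<sigma> * real n) - 2 powr (\<sigma> * real (n + k))) \<le> C1 * 2 powr (\<sigma> * real n)"
            using C1 by (intro mult_left_mono) auto
          ultimately show ?thesis using tel[of n k] Y(2)[of "n + k"] by linarith
        qed
        have l1: "(\<lambda>k. w (n + k) x powr (1 / u)) \<longlonglongrightarrow> 0 powr (1 / u)"
          using LIMSEQ_ignore_initial_segment[OF w_lim, of n] u P
          by (intro tendsto_powr') (auto simp: add.commute oscillation_profile_def)
        have "2 powr (\<sigma> * real (n + k)) = 2 powr (\<sigma> * real n) * (2 powr \<sigma>) ^ k" for k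
          by (simp add: powr_realpow[symmetric] powr_powr powr_add[symmetric] algebra_simps)
        moreover have "(\<lambda>k. (2 powr \<sigma>) ^ k) \<longlonglongrightarrow> 0" using t by (intro LIMSEQ_power_zero) auto
        ultimately have l2: "(\<lambda>k. 2 powr (\<sigma> * real (n + k))) \<longlonglongrightarrow> 0"
          using tendsto_mult_right_zero by simp
        have "(\<lambda>k. w (n + k) x powr (1 / u) + c * 2 powr (\<sigma> * real (n + k)) + C1 * 2 powr (\<sigma> * real n))
            \<longlonglongrightarrow> 0 powr (1 / u) + c * 0 + C1 * 2 powr (\<sigma> * real n)"
          by (intro tendsto_intros l1 l2)
        from LIMSEQ_le_const[OF this] le show ?thesis by auto
      qed
      then show ?thesis using Y by blast
    qed
    have bnd: "\<bar>f x\<bar> \<le> C1 + c" if x: "x \<in> X - N" for x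
    proof -
      obtain Y where "\<bar>f x - f (Y (0::nat))\<bar> \<le> C1 * 2 powr (\<sigma> * real 0)" "\<bar>f (Y 0)\<bar> \<le> c"
        using chain[OF x] by blast
      then show ?thesis by simp
    qed
    have loc: "\<bar>f x - f y\<bar> \<le> C2 * 2 powr (\<sigma> * real n)"
      if xy: "x \<in> X - N" "y \<in> X - N" and dxy: "d x y < 2 powr (- real n) / K\<^sup>2" for x y n
    proof -
      obtain Y where Y: "Y \<in> B x (2 powr (- real n) / K\<^sup>2) - E" "w n Y powr (1 / u) \<le> c * 2 powr (\<sigma> * real n)"
        "\<bar>f x - f Y\<bar> \<le> C1 * 2 powr (\<sigma> * real n)" using chain[OF xy(1)] by blast
      obtain Z where Z: "Z \<in> B y (2 powr (- real n) / K\<^sup>2) - E" "w n Z powr (1 / u) \<le> c * 2 powr (\<sigma> * real n)"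
        "\<bar>f y - f Z\<bar> \<le> C1 * 2 powr (\<sigma> * real n)" using chain[OF xy(2)] by blast
      let ?r = "2 powr (- real n) / K\<^sup>2"
      have X: "x \<in> X" "y \<in> X" "Y \<in> X" "Z \<in> X" using xy Y Z by (auto simp: ball_iff)
      have "d Y x < K * ?r" using Y X by (intro quasi_symmetric_less) (auto simp: ball_iff)
      moreover have "d x Z < K * ?r" using X Z dxy by (intro quasi_triangle_less[of x Z y]) (auto simp: ball_iff)
      ultimately have "d Y Z < K * (K * ?r)" using X by (intro quasi_triangle_less[of Y Z x]) auto
      then have "d Y Z < 2 powr (- real n)" using Kp by (simp add: power2_eq_square)
      then have "\<bar>f Y - f Z\<bar> \<le> w n Y powr (1 / u) + w n Z powr (1 / u)"
        using P X Y Z by (auto simp: oscillation_profile_def)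
      then have "\<bar>f x - f y\<bar> \<le> 2 * (C1 * 2 powr (\<sigma> * real n)) + 2 * (c * 2 powr (\<sigma> * real n))"
        using Y Z by linarith
      then show ?thesis by (simp add: C2_def algebra_simps)
    qed
    have "\<bar>f x - f y\<bar> \<le> C * d x y powr (- \<sigma>)" if xy: "x \<in> X - N" "y \<in> X - N" for x y
    proof -
      consider "x = y" | "x \<noteq> y" "K\<^sup>2 * d x y < 1" | "x \<noteq> y" "1 \<le> K\<^sup>2 * d x y" by linarith
      then show ?thesis
      proof cases
        case 1 then show ?thesis using C by simp
      next
        case 2
        then have dp: "0 < d x y" using d_pos xy by auto
        then have "0 < K\<^sup>2 * d x y" "K\<^sup>2 * d x y < 2 powr (- real 0)" using 2 Kp by auto
        from dyadic_scale_nat[OF this] obtain n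
          where n: "2 powi (- int n - 1) \<le> K\<^sup>2 * d x y" "K\<^sup>2 * d x y < 2 powi (- int n)" by auto
        have "\<bar>f x - f y\<bar> \<le> C2 * 2 powr (\<sigma> * real n)"
          using n(2) Kp by (intro loc xy) (simp add: powi_eq_powr field_simps)
        also have "2 powr (\<sigma> * real n) = (2 powr (- real n)) powr (- \<sigma>)" by (simp add: powr_powr mult.commute)
        also have "C2 * (2 powr (- real n)) powr (- \<sigma>) \<le> C2 * (2 * (K\<^sup>2 * d x y)) powr (- \<sigma>)"
        proof -
          have "2 powr (- real n) = 2 * 2 powr (- real n - 1)" by (simp add: powr_diff)
          also have "\<dots> \<le> 2 * (K\<^sup>2 * d x y)" using n(1) by (simp add: powi_eq_powr)
          finally show ?thesis using \<sigma> C2 by (intro mult_left_mono powr_mono2) auto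
        qed
        also have "\<dots> = C * d x y powr (- \<sigma>)" using dp Kp by (simp add: C_def powr_mult)
        finally show ?thesis .
      next
        case 3
        then have dp: "0 < d x y" using d_pos xy by auto
        have "\<bar>f x - f y\<bar> \<le> C2 * 1" using bnd[OF xy(1)] bnd[OF xy(2)] by (simp add: C2_def)
        also have "\<dots> \<le> C2 * (2 * (K\<^sup>2 * d x y)) powr (- \<sigma>)"
          using 3 \<sigma> C2 by (intro mult_left_mono ge_one_powr_ge_zero) auto
        also have "\<dots> = C * d x y powr (- \<sigma>)" using dp Kp by (simp add: C_def powr_mult)
        finally show ?thesis .
      qed
    qed
    moreover have "\<bar>f x\<bar> \<le> C" if "x \<in> X - N" for x
      using bnd[OF that] C C1 c(1) by (simp add: C2_def)
    ultimately show ?thesis using N unfolding \<sigma>_def by (force intro!: bexI[of _ N])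
  qed
  then show thesis using that C by blast
qed

end

section \<open>Compactness in Lebesgue spaces\<close>

text \<open>Pigeonhole: one representative for each colour that occurs.\<close>

lemma qnorm_totally_bounded_by_coloring:
  fixes N :: "('a \<Rightarrow> real) \<Rightarrow> ennreal" and T :: "('a \<Rightarrow> real) set"
  assumes "\<And>\<epsilon>. 0 < \<epsilon> \<Longrightarrow> \<exists>c :: ('a \<Rightarrow> real) \<Rightarrow> 'c. finite (c ` T) \<and>
    (\<forall>g\<in>T. \<forall>h\<in>T. c g = c h \<longrightarrow> N (\<lambda>x. g x - h x) < \<epsilon>)"
  shows "qnorm_totally_bounded N T"
  unfolding qnorm_totally_bounded_def
proof (intro allI impI)
  fix \<epsilon> :: ennreal assume "0 < \<epsilon>"
  then obtain c :: "('a \<Rightarrow> real) \<Rightarrow> 'c" where c: "finite (c ` T)"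
    "\<And>g h. g \<in> T \<Longrightarrow> h \<in> T \<Longrightarrow> c g = c h \<Longrightarrow> N (\<lambda>x. g x - h x) < \<epsilon>" using assms by blast
  define K where "K = inv_into T c ` c ` T"
  have "\<exists>h\<in>K. N (\<lambda>x. g x - h x) < \<epsilon>" if "g \<in> T" for g
    using that by (intro bexI[of _ "inv_into T c (c g)"] c(2))
      (auto simp: K_def f_inv_into_f inv_into_into)
  then show "\<exists>K. finite K \<and> K \<subseteq> T \<and> (\<forall>g\<in>T. \<exists>h\<in>K. N (\<lambda>x. g x - h x) < \<epsilon>)"
    using c(1) by (intro exI[of _ K]) (auto simp: K_def inv_into_into)
qed

lemma same_floor_diff:
  assumes "0 < (t::real)" "\<lfloor>a / t\<rfloor> = \<lfloor>b / t\<rfloor>" shows "\<bar>a - b\<bar> \<le> t"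
proof -
  have "\<bar>a / t - b / t\<bar> \<le> 1" using assms(2) by linarith
  then show ?thesis using assms(1) by (simp add: diff_divide_distrib[symmetric] divide_le_eq)
qed

lemma floor_in_interval:
  assumes "0 < (t::real)" "\<bar>a\<bar> \<le> L"
  shows "\<lfloor>a / t\<rfloor> \<in> {- \<lceil>L / t\<rceil> - 1..\<lceil>L / t\<rceil> + 1}"
proof -
  have "\<bar>a / t\<bar> \<le> L / t" using assms by (simp add: divide_right_mono)
  then show ?thesis unfolding atLeastAtMost_iff by linarith
qed

context bounded_regular_space
begin

definition total_mass :: real where "total_mass = measure M X"

lemma total_mass: "emeasure M X = ennreal total_mass" "0 \<le> total_mass"
  using finite_space by (auto simp: total_mass_def intro!: emeasure_eq_ennreal_measure)

text \<open>If \<open>T n < \<bar>f x\<bar> \<le> T (Suc n)\<close>, where \<open>T n\<close> is twice the second term in the growth estimate, then the first term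
must account for half of \<open>\<bar>f x\<bar>\<close>, and thus \<open>\<bar>f\<bar>\<^sup>Q \<le> T (Suc n)\<^bsup>Q - u\<^esup> 2\<^sup>u w n\<close>. The integrals of these bounds form a
geometric series whose ratio is below 1 exactly when \<open>Q < su/(s - \<beta>u)\<close>.\<close>

lemma subcritical_moment_bound:
  assumes A: "0 < A" and u: "0 < u" and \<beta>: "0 < \<beta>" and sub: "\<beta> * u < s"
    and Q: "u \<le> Q" "Q < s * u / (s - \<beta> * u)"
  obtains H where "0 \<le> H"
    "\<And>f w E. profile \<beta> u A f w E \<Longrightarrow> power_integral M Q f \<le> ennreal H"
proof -
  define \<sigma> where "\<sigma> = s / u - \<beta>"
  have \<sigma>: "0 < \<sigma>" using sub u by (simp add: \<sigma>_def field_simps)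
  obtain C where C: "0 < C"
    "\<And>f w E x n. profile \<beta> u A f w E \<Longrightarrow> x \<in> X - E \<Longrightarrow>
       \<bar>f x\<bar> \<le> w n x powr (1 / u) + C * 2 powr (\<sigma> * real n)"
    using profile_growth_subcritical[OF A u sub] unfolding \<sigma>_def by metis
  define T where "T n = 2 * C * 2 powr (\<sigma> * real n)" for n
  have T0: "0 < T n" for n using C(1) by (simp add: T_def)
  define a where "a n = T (Suc n) powr (Q - u) * 2 powr u" for n
  have a0: "0 \<le> a n" for n by (simp add: a_def)
  define \<theta> where "\<theta> = 2 powr (\<sigma> * (Q - u) - \<beta> * u)"
  have "Q * \<sigma> < s"
  proof -
    have "Q * (s - \<beta> * u) < s * u" using Q(2) sub by (simp add: pos_less_divide_eq)
    then show ?thesis using u by (simp add: \<sigma>_def field_simps)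
  qed
  moreover have "\<sigma> * (Q - u) - \<beta> * u = Q * \<sigma> - s" using u by (simp add: \<sigma>_def field_simps)
  ultimately have "\<sigma> * (Q - u) - \<beta> * u < 0" by simp
  then have \<theta>: "0 < \<theta>" "\<theta> < 1" by (simp_all add: \<theta>_def powr_less_one)
  define G where "G = (2 * C * 2 powr \<sigma>) powr (Q - u) * 2 powr u * A"
  have G0: "0 \<le> G" using A by (simp add: G_def)
  have aG: "a n * (A * 2 powr (- (\<beta> * u) * real n)) = G * \<theta> ^ n" for n
  proof -
    have "T (Suc n) = (2 * C * 2 powr \<sigma>) * 2 powr (\<sigma> * real n)"
      by (simp add: T_def powr_add algebra_simps)
    then have "T (Suc n) powr (Q - u) = (2 * C * 2 powr \<sigma>) powr (Q - u) * 2 powr (\<sigma> * (Q - u) * real n)"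
      using C(1) by (simp add: powr_mult powr_powr mult_ac)
    moreover have "\<theta> ^ n = 2 powr (\<sigma> * (Q - u) * real n) * 2 powr (- (\<beta> * u) * real n)"
      by (simp add: \<theta>_def powr_realpow[symmetric] powr_powr powr_add[symmetric] algebra_simps)
    ultimately show ?thesis by (simp add: a_def G_def)
  qed
  define H where "H = T 0 powr Q * total_mass + G * (1 / (1 - \<theta>))"
  have H: "0 \<le> H" using G0 \<theta> total_mass by (simp add: H_def)
  have "power_integral M Q f \<le> ennreal H" if P: "profile \<beta> u A f w E" for f w E
  proof -
    have [measurable]: "w n \<in> borel_measurable M" for n using P by (simp add: oscillation_profile_def)
    have w0: "0 \<le> w n x" for n x using P by (simp add: oscillation_profile_def)
    have E: "E \<in> null_sets M" using P by (simp add: oscillation_profile_def)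
    have pw: "ennreal (\<bar>f x\<bar> powr Q) \<le> ennreal (T 0 powr Q) + (\<Sum>n. ennreal (a n * w n x))"
      if x: "x \<in> X - E" for x
    proof (cases "\<bar>f x\<bar> \<le> T 0")
      case True
      then have "ennreal (\<bar>f x\<bar> powr Q) \<le> ennreal (T 0 powr Q)"
        using Q(1) u by (intro ennreal_leI powr_mono2) auto
      then show ?thesis by (simp add: add_increasing2)
    next
      case False
      \<comment> \<open>The level at which the second term of the growth estimate still is at most half of \<open>\<bar>f x\<bar>\<close>.\<close>
      have "\<exists>n. \<bar>f x\<bar> \<le> T n"
      proof -
        have "1 < 2 powr \<sigma>" using \<sigma> by (intro gr_one_powr) auto
        then obtain n where "\<bar>f x\<bar> / (2 * C) < (2 powr \<sigma>) ^ n" using real_arch_pow by blast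
        then have "\<bar>f x\<bar> < T n" using C(1)
          by (simp add: T_def pos_divide_less_eq powr_realpow[symmetric] powr_powr mult.commute)
        then show ?thesis by (intro exI[of _ n]) simp
      qed
      define m where "m = (LEAST n. \<bar>f x\<bar> \<le> T n)"
      have m1: "\<bar>f x\<bar> \<le> T m" unfolding m_def by (rule LeastI_ex) fact
      have "m \<noteq> 0" using m1 False by metis
      then obtain n where n: "m = Suc n" by (cases m) auto
      have m2: "T n < \<bar>f x\<bar>" using not_less_Least[of n "\<lambda>n. \<bar>f x\<bar> \<le> T n"] n unfolding m_def by auto
      have fp: "0 < \<bar>f x\<bar>" using m2 T0[of n] by linarith
      have "\<bar>f x\<bar> \<le> 2 * w n x powr (1 / u)"
        using C(2)[OF P x, of n] m2 by (simp add: T_def)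
      then have "\<bar>f x\<bar> powr u \<le> (2 * w n x powr (1 / u)) powr u" using u by (intro powr_mono2) auto
      also have "\<dots> = 2 powr u * w n x" using u w0 by (simp add: powr_mult powr_powr)
      finally have fu: "\<bar>f x\<bar> powr u \<le> 2 powr u * w n x" .
      have "\<bar>f x\<bar> powr Q = \<bar>f x\<bar> powr (Q - u) * \<bar>f x\<bar> powr u" by (simp add: powr_add[symmetric])
      also have "\<dots> \<le> T (Suc n) powr (Q - u) * (2 powr u * w n x)"
        using m1 n Q(1) by (intro mult_mono fu powr_mono2) auto
      finally have "ennreal (\<bar>f x\<bar> powr Q) \<le> ennreal (a n * w n x)"
        by (intro ennreal_leI) (simp add: a_def mult.assoc)
      also have "\<dots> = (\<Sum>i\<in>{n}. ennreal (a i * w i x))" by simp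
      also have "\<dots> \<le> (\<Sum>n. ennreal (a n * w n x))" by (rule sum_le_suminf) auto
      finally show ?thesis by (simp add: add_increasing)
    qed
    have "power_integral M Q f \<le> (\<integral>\<^sup>+x. ennreal (T 0 powr Q) + (\<Sum>n. ennreal (a n * w n x)) \<partial>M)"
      using AE_not_in[OF E] AE_space by (intro nn_integral_mono_AE) (auto intro: pw)
    also have "\<dots> = ennreal (T 0 powr Q) * ennreal total_mass + (\<Sum>n. \<integral>\<^sup>+x. ennreal (a n * w n x) \<partial>M)"
      by (subst nn_integral_add) (auto simp: nn_integral_suminf total_mass)
    also have "(\<Sum>n. \<integral>\<^sup>+x. ennreal (a n * w n x) \<partial>M) \<le> (\<Sum>n. ennreal (G * \<theta> ^ n))"
    proof (intro suminf_le)
      fix n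
      have "(\<integral>\<^sup>+x. ennreal (a n * w n x) \<partial>M) = ennreal (a n) * (\<integral>\<^sup>+x. ennreal (w n x) \<partial>M)"
        using a0 w0 by (simp add: ennreal_mult nn_integral_cmult)
      also have "\<dots> \<le> ennreal (a n) * ennreal (A * 2 powr (- (\<beta> * u) * real n))"
        using P unfolding oscillation_profile_def by (intro mult_left_mono) auto
      also have "\<dots> = ennreal (G * \<theta> ^ n)" using a0 A aG by (simp add: ennreal_mult[symmetric])
      finally show "(\<integral>\<^sup>+x. ennreal (a n * w n x) \<partial>M) \<le> ennreal (G * \<theta> ^ n)" .
    qed auto
    also have "(\<Sum>n. ennreal (G * \<theta> ^ n)) = ennreal (G * (1 / (1 - \<theta>)))"
      using G0 \<theta> by (subst suminf_ennreal2)
        (auto intro!: summable_mult summable_geometric simp: suminf_mult suminf_geometric)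
    finally have "power_integral M Q f
        \<le> ennreal (T 0 powr Q) * ennreal total_mass + ennreal (G * (1 / (1 - \<theta>)))"
      by (meson add_left_mono order_trans)
    also have "\<dots> = ennreal H" using G0 \<theta> total_mass(2)
      by (simp add: H_def ennreal_mult[symmetric] ennreal_plus[symmetric] del: ennreal_plus)
    finally show ?thesis .
  qed
  then show thesis using that H by blast
qed

text \<open>The colour of \<open>g\<close> records, for each ball of a fine cover, a rounded value of \<open>g\<close> at one good point, that is, one with
\<open>w n \<le> v\<close>. Equal colours give \<open>\<bar>g - h\<bar> \<le> \<tau>\<close> at every point that is good for both functions, since any two good points
in a small ball have nearly equal values. Points that are bad for one of the functions have small total measure;
they are harmless where \<open>\<bar>g - h\<bar> < \<Lambda>\<close>, and large differences are controlled by the moment of order \<open>Q > r\<close>.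
Each of the three contributions is made at most a third of \<open>e\<^sup>r\<close>.\<close>

lemma profile_class_totally_bounded_Lp:
  assumes A: "0 < A" and u: "0 < u" and \<beta>: "0 < \<beta>" and r: "0 < r" "r < Q"
    and T: "\<And>g. g \<in> T \<Longrightarrow> g \<in> borel_measurable M" "\<And>g. g \<in> T \<Longrightarrow> \<exists>w E. profile \<beta> u A g w E"
    and H: "0 \<le> H" "\<And>g. g \<in> T \<Longrightarrow> power_integral M Q g \<le> ennreal H"
  shows "qnorm_totally_bounded (Lp_qnorm M r) T"
proof (rule qnorm_totally_bounded_by_coloring[where 'c = "'a \<Rightarrow> int option"])
  fix \<epsilon> :: ennreal assume "0 < \<epsilon>"
  then obtain e where e: "0 < e" "ennreal e < \<epsilon>" using ennreal_less_obtain_real by blast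
  define \<eta> where "\<eta> = e powr r / 3"
  have \<eta>: "0 < \<eta>" using e by (simp add: \<eta>_def)
  define \<tau> where "\<tau> = (\<eta> / (total_mass + 1)) powr (1 / r)"
  have tm1: "0 < total_mass + 1" using total_mass(2) by simp
  have \<tau>: "0 < \<tau>" using \<eta> tm1 by (simp add: \<tau>_def)
  have \<tau>r: "\<tau> powr r * total_mass \<le> \<eta>"
  proof -
    have "\<tau> powr r = \<eta> / (total_mass + 1)" using \<eta> tm1 r by (simp add: \<tau>_def powr_powr)
    then have "\<tau> powr r * (total_mass + 1) = \<eta>" using tm1 by simp
    then show ?thesis using powr_ge_zero[of \<tau> r] by (simp add: algebra_simps del: powr_ge_zero)
  qed
  define J where "J = 2 powr Q * (2 * H)"
  have J: "0 \<le> J" using H by (simp add: J_def)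
  define \<Lambda> where "\<Lambda> = (\<eta> / (J + 1)) powr (1 / (r - Q))"
  have \<Lambda>: "0 < \<Lambda>" using \<eta> J by (simp add: \<Lambda>_def)
  have \<Lambda>Q: "\<Lambda> powr (r - Q) * J \<le> \<eta>"
  proof -
    have "\<Lambda> powr (r - Q) = \<eta> / (J + 1)" using \<eta> J r by (simp add: \<Lambda>_def powr_powr)
    then have "\<Lambda> powr (r - Q) * (J + 1) = \<eta>" using J by simp
    then show ?thesis using powr_ge_zero[of \<Lambda> "r - Q"] by (simp add: algebra_simps del: powr_ge_zero)
  qed
  define v where "v = (\<tau> / 5) powr u"
  have v: "0 < v" using \<tau> by (simp add: v_def)
  have vr: "x powr (1 / u) \<le> \<tau> / 5" if "0 \<le> x" "x \<le> v" for x
  proof -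
    have "x powr (1 / u) \<le> v powr (1 / u)" using that u by (intro powr_mono2) auto
    then show ?thesis using \<tau> u by (simp add: v_def powr_powr)
  qed
  define Z where "Z = \<Lambda> powr r / v"
  have Z: "0 \<le> Z" using v by (simp add: Z_def)
  obtain n where n: "Z * (2 * (A * 2 powr (- (\<beta> * u) * real n))) \<le> \<eta>"
  proof -
    define t where "t = 2 powr (- (\<beta> * u))"
    have t: "0 < t" "t < 1" using u \<beta> by (simp_all add: t_def powr_less_one)
    have p: "0 < 2 * Z * A + 1" using Z A by (intro add_nonneg_pos) auto
    obtain n where "t ^ n < \<eta> / (2 * Z * A + 1)"
      using real_arch_pow_inv[OF divide_pos_pos[OF \<eta> p] t(2)] by blast
    then have "t ^ n * (2 * Z * A + 1) < \<eta>" using p by (simp add: pos_less_divide_eq)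
    moreover have "0 \<le> t ^ n" using t by simp
    ultimately have "Z * (2 * (A * t ^ n)) \<le> \<eta>" by (simp add: algebra_simps)
    moreover have "t ^ n = 2 powr (- (\<beta> * u) * real n)"
      by (simp add: t_def powr_realpow[symmetric] powr_powr)
    ultimately show thesis using that by simp
  qed
  obtain w E where P: "\<And>g. g \<in> T \<Longrightarrow> profile \<beta> u A g (w g) (E g)"
    using T(2) by metis
  define good where "good g x \<longleftrightarrow> x \<in> X - E g \<and> w g n x \<le> v" for g x
  define \<rho> where "\<rho> = 2 powr (- real n) / K\<^sup>2"
  have Kp: "1 \<le> K\<^sup>2" using K1 by (simp add: one_le_power)
  have \<rho>: "0 < \<rho>" "K\<^sup>2 * \<rho> = 2 powr (- real n)" using Kp K1 by (auto simp: \<rho>_def intro!: divide_pos_pos)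
  obtain F where F: "finite F" "F \<subseteq> X" "\<And>x. x \<in> X \<Longrightarrow> \<exists>y\<in>F. x \<in> B y \<rho>"
    using finite_ball_cover[OF \<rho>(1)] by blast
  define sel where "sel g y = (SOME x. x \<in> B y \<rho> \<and> good g x)" for g y
  have sel: "sel g y \<in> B y \<rho>" "good g (sel g y)" if "x \<in> B y \<rho>" "good g x" for g x y
    using someI[of "\<lambda>x. x \<in> B y \<rho> \<and> good g x" x] that unfolding sel_def by auto
  define c where "c g = (\<lambda>y\<in>F. if \<exists>x\<in>B y \<rho>. good g x then Some \<lfloor>g (sel g y) / (\<tau> / 5)\<rfloor> else None)" for g
  define L where "L = \<lceil>2 powr (\<beta> * real n) * (\<tau> / 5) / (\<tau> / 5)\<rceil>"
  have fin: "finite (c ` T)"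
  proof (rule finite_subset)
    show "c ` T \<subseteq> (\<Pi>\<^sub>E y\<in>F. insert None (Some ` {- L - 1..L + 1}))"
    proof
      fix k assume "k \<in> c ` T"
      then obtain g where g: "g \<in> T" "k = c g" by auto
      have "\<lfloor>g (sel g y) / (\<tau> / 5)\<rfloor> \<in> {- L - 1..L + 1}" if "x \<in> B y \<rho>" "good g x" for x y
      proof -
        have s: "good g (sel g y)" using sel that by blast
        then have "\<bar>g (sel g y)\<bar> \<le> 2 powr (\<beta> * real n) * w g n (sel g y) powr (1 / u)"
          using P[OF g(1)] by (auto simp: oscillation_profile_def good_def)
        also have "\<dots> \<le> 2 powr (\<beta> * real n) * (\<tau> / 5)"
          using s P[OF g(1)] by (intro mult_left_mono vr) (auto simp: oscillation_profile_def good_def)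
        finally show ?thesis unfolding L_def using \<tau> by (intro floor_in_interval) auto
      qed
      then show "k \<in> (\<Pi>\<^sub>E y\<in>F. insert None (Some ` {- L - 1..L + 1}))"
        unfolding g(2) c_def by (auto intro!: restrict_PiE simp: PiE_iff)
    qed
  qed (use F in \<open>auto intro!: finite_PiE\<close>)
  have close: "\<bar>g x - h x\<bar> \<le> \<tau>" if gh: "g \<in> T" "h \<in> T" "c g = c h" and x: "good g x" "good h x" for g h x
  proof -
    have xM: "x \<in> X" using x by (simp add: good_def)
    obtain y where y: "y \<in> F" "x \<in> B y \<rho>" using F(3)[OF xM] by blast
    have yM: "y \<in> X" using F y by auto
    have "c g y = c h y" using gh(3) by simp
    then have "\<lfloor>g (sel g y) / (\<tau> / 5)\<rfloor> = \<lfloor>h (sel h y) / (\<tau> / 5)\<rfloor>"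
      using y x unfolding c_def by (auto split: if_splits)
    then have 1: "\<bar>g (sel g y) - h (sel h y)\<bar> \<le> \<tau> / 5" using \<tau> by (intro same_floor_diff) auto
    have 2: "\<bar>k x - k (sel k y)\<bar> \<le> 2 * (\<tau> / 5)" if k: "k \<in> T" "good k x" for k
    proof -
      have s: "sel k y \<in> B y \<rho>" "good k (sel k y)" using sel[OF y(2) k(2)] by auto
      have "d x (sel k y) < 2 powr (- real n)"
        using ball_two_points[OF yM y(2) s(1) \<rho>(1)] \<rho>(2) by simp
      then have "\<bar>k x - k (sel k y)\<bar> \<le> w k n x powr (1 / u) + w k n (sel k y) powr (1 / u)"
        using P[OF k(1)] k(2) s(2) by (auto simp: oscillation_profile_def good_def)
      also have "\<dots> \<le> \<tau> / 5 + \<tau> / 5"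
        using P[OF k(1)] k(2) s(2) by (intro add_mono vr) (auto simp: oscillation_profile_def good_def)
      finally show ?thesis by simp
    qed
    show ?thesis using 1 2[OF gh(1) x(1)] 2[OF gh(2) x(2)] by linarith
  qed
  have "Lp_qnorm M r (\<lambda>x. g x - h x) < \<epsilon>" if gh: "g \<in> T" "h \<in> T" "c g = c h" for g h
  proof -
    note [measurable] = T(1)[OF gh(1)] T(1)[OF gh(2)]
    have [measurable]: "w k n \<in> borel_measurable M" if "k \<in> T" for k
      using P[OF that] by (simp add: oscillation_profile_def)
    note [measurable] = this[OF gh(1)] this[OF gh(2)]
    have w0: "0 \<le> w k n x" if "k \<in> T" for k x using P[OF that] by (simp add: oscillation_profile_def)
    have EN: "E g \<in> null_sets M" "E h \<in> null_sets M"
      using P[OF gh(1)] P[OF gh(2)] by (auto simp: oscillation_profile_def)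
    \<comment> \<open>The three summands correspond to points good for both functions, to large differences, and to bad points.\<close>
    have pw: "\<bar>g x - h x\<bar> powr r \<le> \<tau> powr r + \<Lambda> powr (r - Q) * (2 powr Q * (\<bar>g x\<bar> powr Q + \<bar>h x\<bar> powr Q))
        + Z * (w g n x + w h n x)" (is "?l \<le> ?a + ?b + ?c")
      if x: "x \<in> X - E g" "x \<in> X - E h" for x
    proof -
      have nn: "0 \<le> ?a" "0 \<le> ?b" "0 \<le> ?c" using Z w0 gh by auto
      consider "good g x \<and> good h x" | "\<not> (good g x \<and> good h x)" "\<Lambda> \<le> \<bar>g x - h x\<bar>"
        | "\<not> (good g x \<and> good h x)" "\<bar>g x - h x\<bar> < \<Lambda>" by linarith
      then show ?thesis
      proof cases
        case 1
        then have "?l \<le> ?a" using close[OF gh, of x] r by (intro powr_mono2) auto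
        then show ?thesis using nn by linarith
      next
        case 2
        then have p: "0 < \<bar>g x - h x\<bar>" using \<Lambda> by linarith
        have "?l = \<bar>g x - h x\<bar> powr (r - Q) * \<bar>g x - h x\<bar> powr Q" by (simp add: powr_add[symmetric])
        also have "\<dots> \<le> \<Lambda> powr (r - Q) * (2 powr Q * (\<bar>g x\<bar> powr Q + \<bar>h x\<bar> powr Q))"
          using 2 \<Lambda> r by (intro mult_mono abs_diff_powr_le powr_mono2') auto
        finally show ?thesis using nn by linarith
      next
        case 3
        then have "v < w g n x \<or> v < w h n x" using x by (auto simp: good_def)
        then have "v \<le> w g n x + w h n x" using w0[OF gh(1), of x] w0[OF gh(2), of x] by linarith
        then have "Z * v \<le> ?c" using Z by (intro mult_left_mono)
        moreover have "?l \<le> \<Lambda> powr r" using 3 r by (intro powr_mono2) auto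
        ultimately have "?l \<le> ?c" using v by (simp add: Z_def)
        then show ?thesis using nn by linarith
      qed
    qed
    define b where "b = \<Lambda> powr (r - Q) * 2 powr Q"
    have b: "0 \<le> b" by (simp add: b_def)
    have "(\<integral>\<^sup>+x. ennreal (\<bar>g x - h x\<bar> powr r) \<partial>M) \<le>
        (\<integral>\<^sup>+x. ennreal (\<tau> powr r) + (ennreal b * (ennreal (\<bar>g x\<bar> powr Q) + ennreal (\<bar>h x\<bar> powr Q)) +
          ennreal Z * (ennreal (w g n x) + ennreal (w h n x))) \<partial>M)"
    proof (rule nn_integral_mono_AE)
      show "AE x in M. ennreal (\<bar>g x - h x\<bar> powr r) \<le>
        ennreal (\<tau> powr r) + (ennreal b * (ennreal (\<bar>g x\<bar> powr Q) + ennreal (\<bar>h x\<bar> powr Q)) +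
          ennreal Z * (ennreal (w g n x) + ennreal (w h n x)))"
        using AE_not_in[OF EN(1)] AE_not_in[OF EN(2)] AE_space
      proof eventually_elim
        case (elim x)
        have "ennreal (\<bar>g x - h x\<bar> powr r) \<le>
          ennreal (\<tau> powr r + (b * (\<bar>g x\<bar> powr Q + \<bar>h x\<bar> powr Q) + Z * (w g n x + w h n x)))"
          using pw[of x] elim by (intro ennreal_leI) (simp add: b_def algebra_simps)
        then show ?case using b Z w0[OF gh(1), of x] w0[OF gh(2), of x]
          by (simp add: ennreal_plus[symmetric] ennreal_mult[symmetric] del: ennreal_plus)
      qed
    qed
    also have "\<dots> = ennreal (\<tau> powr r) * ennreal total_mass +
        (ennreal b * (power_integral M Q g + power_integral M Q h) +
         ennreal Z * ((\<integral>\<^sup>+x. ennreal (w g n x) \<partial>M) + (\<integral>\<^sup>+x. ennreal (w h n x) \<partial>M)))"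
      by (simp add: nn_integral_add nn_integral_cmult total_mass(1))
    also have "\<dots> \<le> ennreal (\<tau> powr r) * ennreal total_mass + (ennreal b * (ennreal H + ennreal H) +
         ennreal Z * (ennreal (A * 2 powr (- (\<beta> * u) * real n)) + ennreal (A * 2 powr (- (\<beta> * u) * real n))))"
      using P[OF gh(1)] P[OF gh(2)] H(2)[OF gh(1)] H(2)[OF gh(2)] unfolding oscillation_profile_def
      by (intro add_mono mult_left_mono) auto
    also have "\<dots> = ennreal (\<tau> powr r * total_mass + (\<Lambda> powr (r - Q) * J + Z * (2 * (A * 2 powr (- (\<beta> * u) * real n)))))"
      using b Z H A total_mass(2)
      by (simp add: ennreal_plus[symmetric] ennreal_mult[symmetric] b_def J_def algebra_simps del: ennreal_plus)
    also have "\<dots> \<le> ennreal (e powr r)"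
      using \<tau>r \<Lambda>Q n by (intro ennreal_leI) (simp add: \<eta>_def)
    finally have "Lp_qnorm M r (\<lambda>x. g x - h x) \<le> ennreal e" using r e by (simp add: Lp_qnorm_le_iff)
    then show ?thesis using e(2) by (rule le_less_trans)
  qed
  then show "\<exists>c :: ('a \<Rightarrow> real) \<Rightarrow> ('a \<Rightarrow> int option). finite (c ` T) \<and>
    (\<forall>g\<in>T. \<forall>h\<in>T. c g = c h \<longrightarrow> Lp_qnorm M r (\<lambda>x. g x - h x) < \<epsilon>)"
    using fin by blast
qed

text \<open>Stated for an arbitrary source space whose bounded sets are \<open>besov_bounded\<close>, so as to serve both scales of spaces.\<close>

lemma compact_embedding_Lp:
  assumes u: "0 < u" and \<beta>: "0 < \<beta>" and r: "0 < r" "r < Q"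
    and Sp: "\<And>f R. f \<in> Sp \<Longrightarrow> 0 \<le> R \<Longrightarrow> N f \<le> ennreal R \<Longrightarrow> besov_bounded M d \<beta> u ((R + 1) powr u) f"
    and fin: "\<And>f. f \<in> Sp \<Longrightarrow> N f < \<infinity>"
    and moment: "\<And>A. 0 < A \<Longrightarrow> \<exists>H\<ge>0. \<forall>f w E. profile \<beta> u A f w E \<longrightarrow>
      power_integral M Q f \<le> ennreal H"
  shows "compact_embedding M Sp N (Lp_space M r) (Lp_qnorm M r)"
  unfolding compact_embedding_def
proof (intro conjI ballI allI impI)
  fix f assume f: "f \<in> Sp"
  obtain R where R: "N f = ennreal R" "0 \<le> R" using fin[OF f] by (cases "N f" rule: ennreal_cases) auto
  have bb: "besov_bounded M d \<beta> u ((R + 1) powr u) f" using Sp[OF f R(2)] R(1) by simp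
  obtain A where A: "0 < A" "\<And>f. besov_bounded M d \<beta> u ((R + 1) powr u) f \<Longrightarrow> \<exists>w E. profile \<beta> u A f w E"
    using besov_bounded_profile[OF \<beta> u, of "(R + 1) powr u"] by auto
  obtain H where H: "0 \<le> H" "power_integral M Q f \<le> ennreal H"
    using moment[OF A(1)] A(2)[OF bb] by blast
  have fm [measurable]: "f \<in> borel_measurable M" using bb by (simp add: besov_bounded_def)
  have "power_integral M r f \<le> (\<integral>\<^sup>+x. 1 + ennreal (\<bar>f x\<bar> powr Q) \<partial>M)"
  proof (intro nn_integral_mono)
    fix x
    have "\<bar>f x\<bar> powr r \<le> 1 + \<bar>f x\<bar> powr Q"
    proof (cases "\<bar>f x\<bar> \<le> 1")
      case True
      then have "\<bar>f x\<bar> powr r \<le> 1" using r by (intro powr_le1) auto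
      then show ?thesis by (simp add: add_increasing2)
    next
      case False
      then have "\<bar>f x\<bar> powr r \<le> \<bar>f x\<bar> powr Q" using r by (intro powr_mono) auto
      then show ?thesis by simp
    qed
    then show "ennreal (\<bar>f x\<bar> powr r) \<le> 1 + ennreal (\<bar>f x\<bar> powr Q)"
      by (simp add: ennreal_plus[symmetric] ennreal_1[symmetric] del: ennreal_plus ennreal_1)
  qed
  also have "\<dots> = ennreal total_mass + power_integral M Q f"
    by (simp add: nn_integral_add total_mass)
  also have "\<dots> \<le> ennreal (total_mass + H)" using H total_mass(2) by (simp add: add_left_mono)
  also have "\<dots> = ennreal (((total_mass + H) powr (1 / r)) powr r)"
    using H total_mass(2) r by (simp add: powr_powr)
  finally have "Lp_qnorm M r f \<le> ennreal ((total_mass + H) powr (1 / r))"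
    using r by (simp add: Lp_qnorm_le_iff)
  then have "f \<in> Lp_space M r" using fm by (auto simp: Lp_space_def intro: le_less_trans)
  then show "\<exists>g\<in>Lp_space M r. AE x in M. f x = g x" by (intro bexI[of _ f]) auto
next
  fix S assume S: "S \<subseteq> Sp" and "\<exists>R<\<infinity>. \<forall>f\<in>S. N f \<le> R"
  then obtain R' where R': "R' < \<infinity>" "\<forall>f\<in>S. N f \<le> R'" by blast
  obtain R where R: "R' = ennreal R" "0 \<le> R" using R'(1) by (cases R' rule: ennreal_cases) auto
  obtain A where A: "0 < A" "\<And>f. besov_bounded M d \<beta> u ((R + 1) powr u) f \<Longrightarrow> \<exists>w E. profile \<beta> u A f w E"
    using besov_bounded_profile[OF \<beta> u, of "(R + 1) powr u"] by auto
  obtain H where H: "0 \<le> H" "\<And>f w E. profile \<beta> u A f w E \<Longrightarrow>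
      power_integral M Q f \<le> ennreal H"
    using moment[OF A(1)] by blast
  let ?T = "{g \<in> Lp_space M r. \<exists>f\<in>S. AE x in M. f x = g x}"
  have prof: "\<exists>w E. profile \<beta> u A g w E" if g: "g \<in> ?T" for g
  proof -
    obtain f where f: "f \<in> S" "AE x in M. f x = g x" using g by blast
    have "besov_bounded M d \<beta> u ((R + 1) powr u) f" using f(1) S R'(2) R by (intro Sp) auto
    then have "besov_bounded M d \<beta> u ((R + 1) powr u) g"
      using f(2) g by (intro besov_bounded_cong_AE[of M d \<beta> u _ f g]) (auto simp: Lp_space_def)
    then show ?thesis by (rule A(2))
  qed
  show "qnorm_totally_bounded (Lp_qnorm M r) ?T"
  proof (rule profile_class_totally_bounded_Lp[OF A(1) u \<beta> r _ prof H(1)])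
    fix g assume g: "g \<in> ?T"
    then show "g \<in> borel_measurable M" by (auto simp: Lp_space_def)
    show "power_integral M Q g \<le> ennreal H" using prof[OF g] H(2) by blast
  qed
qed

end

section \<open>Compactness in Hoelder spaces\<close>

context bounded_regular_space
begin

lemma supercritical_moment_bound:
  assumes A: "0 < A" and u: "0 < u" and \<beta>: "0 < \<beta>" and super: "s < \<beta> * u" and Q: "0 < Q"
  obtains H where "0 \<le> H"
    "\<And>f w E. profile \<beta> u A f w E \<Longrightarrow> power_integral M Q f \<le> ennreal H"
proof -
  obtain C where C: "0 < C"
    "\<And>f w E. profile \<beta> u A f w E \<Longrightarrow> \<exists>N\<in>null_sets M.
       holder_bounded (X - N) C (\<beta> - s / u) f"
    using profile_holder_supercritical[OF A u \<beta> super] by metis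
  have "power_integral M Q f \<le> ennreal (C powr Q * total_mass)"
    if P: "profile \<beta> u A f w E" for f w E
  proof -
    obtain N where N: "N \<in> null_sets M" "\<And>x. x \<in> X - N \<Longrightarrow> \<bar>f x\<bar> \<le> C"
      using C(2)[OF P] by blast
    have "power_integral M Q f \<le> (\<integral>\<^sup>+x. ennreal (C powr Q) \<partial>M)"
    proof (rule nn_integral_mono_AE)
      show "AE x in M. ennreal (\<bar>f x\<bar> powr Q) \<le> ennreal (C powr Q)"
        using AE_not_in[OF N(1)] AE_space
        by eventually_elim (use N(2) Q in \<open>auto intro!: ennreal_leI powr_mono2\<close>)
    qed
    also have "\<dots> = ennreal (C powr Q * total_mass)" by (simp add: total_mass ennreal_mult)
    finally show ?thesis .
  qed
  then show thesis using that[of "C powr Q * total_mass"] total_mass(2) by simp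
qed

text \<open>The complement of a null set is dense, as balls have positive measure. Each \<open>x\<close> gets a sequence converging to it from
this complement, constant if \<open>x\<close> lies in it; \<open>F x\<close> is the limit of \<open>f\<close> along the sequence. The factor \<open>K\<^sup>2\<close> compares
\<open>d\<close> at approximating points with \<open>d x y\<close>, since \<open>d\<close> need not be continuous.\<close>

lemma holder_extension:
  assumes \<gamma>: "0 < \<gamma>" and C: "0 \<le> C" and N: "N \<in> null_sets M"
    and bnd: "\<And>x. x \<in> X - N \<Longrightarrow> \<bar>f x\<bar> \<le> C"
    and hol: "\<And>x y. x \<in> X - N \<Longrightarrow> y \<in> X - N \<Longrightarrow> \<bar>f x - f y\<bar> \<le> C * d x y powr \<gamma>"
  shows "\<exists>F. (\<forall>x\<in>X - N. F x = f x) \<and> (\<forall>x\<in>X. \<bar>F x\<bar> \<le> C) \<and>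
    (\<forall>x\<in>X. \<forall>y\<in>X. \<bar>F x - F y\<bar> \<le> C * (K\<^sup>2 * d x y) powr \<gamma>)"
proof -
  have Kp: "0 < K" "1 \<le> K\<^sup>2" using K1 by (simp_all add: one_le_power)
  have "\<exists>z. z \<in> B x ((1/2) ^ n) - N \<and> (x \<notin> N \<longrightarrow> z = x)" if x: "x \<in> X" for x and n :: nat
  proof (cases "x \<in> N")
    case True
    have "0 < (1/2::real) ^ n" by simp
    from ball_nonempty_off_null[OF x this N] obtain y where "y \<in> B x ((1/2) ^ n)" "y \<notin> N" .
    then show ?thesis using True by blast
  next
    case False
    then show ?thesis using x d_refl[OF x] by (intro exI[of _ x]) (auto simp: ball_iff)
  qed
  then obtain z where z: "\<And>x n. x \<in> X \<Longrightarrow> z x n \<in> B x ((1/2) ^ n) - N"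
    "\<And>x n. x \<in> X \<Longrightarrow> x \<notin> N \<Longrightarrow> z x n = x" by metis
  have zN: "z x n \<in> X - N" if "x \<in> X" for x n using z(1)[OF that, of n] by (auto simp: ball_iff)
  have conv: "convergent (\<lambda>n. f (z x n))" if x: "x \<in> X" for x
  proof (rule real_Cauchy_convergent, rule CauchyI)
    fix e :: real assume e: "0 < e"
    define \<delta> where "\<delta> = (e / (C + 1)) powr (1 / \<gamma>) / K\<^sup>2"
    have \<delta>: "0 < \<delta>" using e C Kp by (auto simp: \<delta>_def intro!: divide_pos_pos)
    have \<delta>e: "C * (K\<^sup>2 * \<delta>) powr \<gamma> < e"
    proof -
      have "(K\<^sup>2 * \<delta>) powr \<gamma> = e / (C + 1)" using Kp e C \<gamma> by (simp add: \<delta>_def powr_powr)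
      moreover have "C * (e / (C + 1)) < e" using e C by (simp add: field_simps)
      ultimately show ?thesis by simp
    qed
    obtain m where m: "(1/2::real) ^ m < \<delta>" using real_arch_pow_inv[OF \<delta>, of "1/2"] by auto
    have "norm (f (z x i) - f (z x j)) < e" if ij: "m \<le> i" "m \<le> j" for i j
    proof -
      have "(1/2::real) ^ i < \<delta>" "(1/2::real) ^ j < \<delta>"
        using ij by (auto intro!: le_less_trans[OF power_decreasing m])
      then have zB: "z x i \<in> B x \<delta>" "z x j \<in> B x \<delta>"
        using z(1)[OF x, of i] z(1)[OF x, of j] by (auto simp: ball_iff)
      have "d (z x i) (z x j) \<le> K\<^sup>2 * \<delta>" using ball_two_points[OF x zB \<delta>] by simp
      then have "C * d (z x i) (z x j) powr \<gamma> \<le> C * (K\<^sup>2 * \<delta>) powr \<gamma>"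
        using C \<gamma> zN[OF x] by (intro mult_left_mono powr_mono2) (auto intro: d_nonneg)
      then show ?thesis using hol[OF zN[OF x] zN[OF x], of i j] \<delta>e by simp
    qed
    then show "\<exists>M. \<forall>m\<ge>M. \<forall>n\<ge>M. norm (f (z x m) - f (z x n)) < e" by blast
  qed
  define F where "F x = lim (\<lambda>n. f (z x n))" for x
  have lim: "(\<lambda>n. f (z x n)) \<longlonglongrightarrow> F x" if "x \<in> X" for x
    using conv[OF that] by (simp add: F_def convergent_LIMSEQ_iff)
  have "F x = f x" if "x \<in> X - N" for x
    using lim[of x] z(2)[of x] that by (simp add: LIMSEQ_const_iff)
  moreover have "\<bar>F x\<bar> \<le> C" if x: "x \<in> X" for x
    by (rule LIMSEQ_le_const2[OF tendsto_rabs[OF lim[OF x]]]) (use bnd[OF zN[OF x]] in auto)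
  moreover have "\<bar>F x - F y\<bar> \<le> C * (K\<^sup>2 * d x y) powr \<gamma>" if xy: "x \<in> X" "y \<in> X" for x y
  proof (cases "x = y")
    case False
    then have dp: "0 < d x y" using d_pos xy by auto
    obtain m where m: "(1/2::real) ^ m < d x y / K" using real_arch_pow_inv[of "d x y / K" "1/2"] dp Kp by auto
    have "\<bar>f (z x n) - f (z y n)\<bar> \<le> C * (K\<^sup>2 * d x y) powr \<gamma>" if n: "m \<le> n" for n
    proof -
      have b: "(1/2::real) ^ n < d x y / K" using n by (intro le_less_trans[OF power_decreasing m]) auto
      have Z: "z x n \<in> X" "z y n \<in> X" using zN xy by auto
      have "d x (z x n) < d x y / K" "d y (z y n) < d x y / K"
        using z(1)[OF xy(1), of n] z(1)[OF xy(2), of n] b by (auto simp: ball_iff)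
      moreover have "d x y / K \<le> d x y" using dp K1 by (simp add: divide_le_eq)
      ultimately have le: "d (z x n) x \<le> d x y" "d y (z y n) \<le> d x y"
        using quasi_symmetric_less[OF xy(1) Z(1), of "d x y / K"] Kp by auto
      have "d x (z y n) \<le> K * max (d x y) (d y (z y n))" using quasi_triangle xy Z by blast
      then have 1: "d x (z y n) \<le> K * d x y" using le by (simp add: max_absorb1)
      have "d x y \<le> K * d x y" using dp by (intro le_K_mult) simp
      have "d (z x n) (z y n) \<le> K * max (d (z x n) x) (d x (z y n))" using quasi_triangle xy Z by blast
      also have "\<dots> \<le> K * (K * d x y)" using 1 le \<open>d x y \<le> K * d x y\<close> Kp by (intro mult_left_mono) auto
      finally have "d (z x n) (z y n) powr \<gamma> \<le> (K\<^sup>2 * d x y) powr \<gamma>"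
        using Z \<gamma> by (intro powr_mono2) (auto simp: power2_eq_square intro: d_nonneg)
      then have "C * d (z x n) (z y n) powr \<gamma> \<le> C * (K\<^sup>2 * d x y) powr \<gamma>" using C by (intro mult_left_mono)
      then show ?thesis using hol[OF zN[OF xy(1)] zN[OF xy(2)], of n n] by simp
    qed
    then show ?thesis
      by (intro LIMSEQ_le_const2[OF tendsto_rabs[OF tendsto_diff[OF lim[OF xy(1)] lim[OF xy(2)]]]] exI[of _ m] allI impI)
  qed (use C in auto)
  ultimately show ?thesis by blast
qed

text \<open>Two continuous functions that agree almost everywhere agree: the Hoelder representative is unique.\<close>

lemma holder_eq_off_null:
  assumes \<gamma>: "0 < \<gamma>" "0 < \<gamma>'" and C: "0 \<le> C" "0 \<le> C'" and N: "N \<in> null_sets M"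
    and F: "\<And>x y. x \<in> X \<Longrightarrow> y \<in> X \<Longrightarrow> \<bar>F x - F y\<bar> \<le> C * d x y powr \<gamma>"
    and G: "\<And>x y. x \<in> X \<Longrightarrow> y \<in> X \<Longrightarrow> \<bar>G x - G y\<bar> \<le> C' * d x y powr \<gamma>'"
    and eq: "\<And>x. x \<in> X - N \<Longrightarrow> F x = G x" and x: "x \<in> X"
  shows "F x = G x"
proof -
  have "\<bar>F x - G x\<bar> \<le> C * ((1/2) ^ n) powr \<gamma> + C' * ((1/2) ^ n) powr \<gamma>'" for n :: nat
  proof -
    obtain z where z: "z \<in> B x ((1/2) ^ n)" "z \<notin> N"
      using ball_nonempty_off_null[OF x, of "(1/2) ^ n" N] N by auto
    have zM: "z \<in> X" and dz: "d x z \<le> (1/2) ^ n" using z by (auto simp: ball_iff)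
    have "C * d x z powr \<gamma> \<le> C * ((1/2) ^ n) powr \<gamma>" "C' * d x z powr \<gamma>' \<le> C' * ((1/2) ^ n) powr \<gamma>'"
      using C \<gamma> dz x zM by (auto intro!: mult_left_mono powr_mono2 d_nonneg)
    then show ?thesis using F[OF x zM] G[OF x zM] eq[of z] z zM by auto
  qed
  moreover have "(\<lambda>n. C * ((1/2) ^ n) powr \<gamma> + C' * ((1/2) ^ n) powr \<gamma>') \<longlonglongrightarrow> C * 0 powr \<gamma> + C' * 0 powr \<gamma>'"
    using \<gamma> by (intro tendsto_intros tendsto_powr' LIMSEQ_power_zero) auto
  ultimately have "\<bar>F x - G x\<bar> \<le> 0" using LIMSEQ_le_const by fastforce
  then show ?thesis by simp
qed

lemma Holder_norm_leI:
  assumes "0 \<le> a" "0 \<le> L" "\<And>x. x \<in> X \<Longrightarrow> \<bar>f x\<bar> \<le> a"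
    and "\<And>x y. x \<in> X \<Longrightarrow> y \<in> X \<Longrightarrow> x \<noteq> y \<Longrightarrow> \<bar>f x - f y\<bar> \<le> L * d x y powr \<gamma>"
  shows "Holder_norm X d \<gamma> f \<le> ennreal (a + L)"
proof -
  have "(SUP x\<in>X. ennreal \<bar>f x\<bar>) \<le> ennreal a" using assms by (intro SUP_least ennreal_leI) auto
  moreover have "(SUP (x, y) \<in> {(x, y). x \<in> X \<and> y \<in> X \<and> x \<noteq> y}. ennreal (\<bar>f x - f y\<bar> / d x y powr \<gamma>)) \<le> ennreal L"
  proof (intro SUP_least, clarify)
    fix x y assume xy: "x \<in> X" "y \<in> X" "x \<noteq> y"
    have "0 < d x y powr \<gamma>" using d_pos[OF xy] by simp
    then show "ennreal (\<bar>f x - f y\<bar> / d x y powr \<gamma>) \<le> ennreal L"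
      using assms(4)[OF xy] by (intro ennreal_leI) (simp add: pos_divide_le_eq)
  qed
  ultimately show ?thesis using assms(1,2) unfolding Holder_norm_def by (simp add: add_mono)
qed

lemma Holder_spaceD:
  assumes "f \<in> Holder_space X d \<gamma>"
  obtains L where "0 \<le> L" "\<And>x y. x \<in> X \<Longrightarrow> y \<in> X \<Longrightarrow> \<bar>f x - f y\<bar> \<le> L * d x y powr \<gamma>"
proof -
  have fin: "Holder_norm X d \<gamma> f < \<infinity>" using assms by (simp add: Holder_space_def)
  then obtain L where L: "Holder_norm X d \<gamma> f = ennreal L" "0 \<le> L"
    by (cases "Holder_norm X d \<gamma> f" rule: ennreal_cases) auto
  have "\<bar>f x - f y\<bar> \<le> L * d x y powr \<gamma>" if xy: "x \<in> X" "y \<in> X" for x y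
  proof (cases "x = y")
    case False
    have "ennreal (\<bar>f x - f y\<bar> / d x y powr \<gamma>) \<le>
      (SUP (x, y) \<in> {(x, y). x \<in> X \<and> y \<in> X \<and> x \<noteq> y}. ennreal (\<bar>f x - f y\<bar> / d x y powr \<gamma>))"
      using xy False by (intro SUP_upper2[of "(x, y)"]) auto
    also have "\<dots> \<le> Holder_norm X d \<gamma> f" unfolding Holder_norm_def by simp
    finally have "\<bar>f x - f y\<bar> / d x y powr \<gamma> \<le> L" unfolding L(1) using L(2) by (simp add: ennreal_le_iff)
    moreover have "0 < d x y powr \<gamma>" using d_pos[OF xy False] by simp
    ultimately show ?thesis by (simp add: pos_divide_le_eq)
  qed (use L in auto)
  then show thesis using that L by blast
qed

text \<open>Rounded values at the centres of a fine cover determine \<open>g\<close> uniformly up to \<open>S\<close>. For the Hoelder quotient of the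
difference, distances below \<open>\<rho>\<close> are handled by the order \<open>\<gamma>' > \<gamma>\<close>, and larger ones by the uniform bound.\<close>

lemma holder_class_totally_bounded:
  assumes \<gamma>: "0 < \<gamma>" "\<gamma> < \<gamma>'" and C: "0 < C"
    and T: "\<And>g x. g \<in> T \<Longrightarrow> x \<in> X \<Longrightarrow> \<bar>g x\<bar> \<le> C"
      "\<And>g x y. g \<in> T \<Longrightarrow> x \<in> X \<Longrightarrow> y \<in> X \<Longrightarrow> \<bar>g x - g y\<bar> \<le> C * d x y powr \<gamma>'"
  shows "qnorm_totally_bounded (Holder_norm X d \<gamma>) T"
proof (rule qnorm_totally_bounded_by_coloring[where 'c = "'a \<Rightarrow> int"])
  fix \<epsilon> :: ennreal assume "0 < \<epsilon>"
  then obtain e where e: "0 < e" "ennreal e < \<epsilon>" using ennreal_less_obtain_real by blast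
  define \<rho> where "\<rho> = (e / (4 * C)) powr (1 / (\<gamma>' - \<gamma>))"
  have \<rho>: "0 < \<rho>" "2 * C * \<rho> powr (\<gamma>' - \<gamma>) = e / 2" using e C \<gamma> by (simp_all add: \<rho>_def powr_powr)
  define S where "S = min (e / 2) (e * \<rho> powr \<gamma> / 4)"
  have S: "0 < S" "S \<le> e / 2" "2 * S \<le> e / 2 * \<rho> powr \<gamma>" using e \<rho> by (auto simp: S_def)
  define r where "r = (S / (4 * C)) powr (1 / \<gamma>')"
  have r: "0 < r" "C * r powr \<gamma>' = S / 4" using S C \<gamma> by (simp_all add: r_def powr_powr)
  obtain F where F: "finite F" "F \<subseteq> X" "\<And>x. x \<in> X \<Longrightarrow> \<exists>y\<in>F. x \<in> B y r"
    using finite_ball_cover[OF r(1)] by blast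
  define c where "c g = (\<lambda>y\<in>F. \<lfloor>g y / (S / 2)\<rfloor>)" for g :: "'a \<Rightarrow> real"
  define L where "L = \<lceil>C / (S / 2)\<rceil>"
  have fin: "finite (c ` T)"
  proof (rule finite_subset)
    show "c ` T \<subseteq> (\<Pi>\<^sub>E y\<in>F. {- L - 1..L + 1})"
    proof
      fix k assume "k \<in> c ` T"
      then obtain g where g: "g \<in> T" "k = c g" by auto
      have "\<lfloor>g y / (S / 2)\<rfloor> \<in> {- L - 1..L + 1}" if "y \<in> F" for y
        unfolding L_def using S T(1)[OF g(1)] F that by (intro floor_in_interval) auto
      then show "k \<in> (\<Pi>\<^sub>E y\<in>F. {- L - 1..L + 1})" unfolding g(2) c_def by (auto simp: PiE_iff)
    qed
  qed (use F in \<open>auto intro!: finite_PiE\<close>)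
  have "Holder_norm X d \<gamma> (\<lambda>x. g x - h x) < \<epsilon>" if gh: "g \<in> T" "h \<in> T" "c g = c h" for g h
  proof -
    have sup: "\<bar>g x - h x\<bar> \<le> S" if x: "x \<in> X" for x
    proof -
      obtain y where y: "y \<in> F" "x \<in> B y r" using F(3)[OF x] by blast
      have yM: "y \<in> X" using F y by auto
      have "c g y = c h y" using gh(3) by simp
      then have 1: "\<bar>g y - h y\<bar> \<le> S / 2" using y S unfolding c_def by (intro same_floor_diff) auto
      have 2: "\<bar>k y - k x\<bar> \<le> S / 4" if k: "k \<in> T" for k
      proof -
        have "C * d y x powr \<gamma>' \<le> C * r powr \<gamma>'"
          using C \<gamma> y x yM by (intro mult_left_mono powr_mono2) (auto simp: ball_iff intro: d_nonneg)
        then show ?thesis using T(2)[OF k yM x] r by linarith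
      qed
      show ?thesis using 1 2[OF gh(1)] 2[OF gh(2)] by linarith
    qed
    have hol: "\<bar>(g x - h x) - (g y - h y)\<bar> \<le> e / 2 * d x y powr \<gamma>"
      if xy: "x \<in> X" "y \<in> X" "x \<noteq> y" for x y
    proof (cases "d x y < \<rho>")
      case True
      have dp: "0 < d x y" using d_pos xy by auto
      have "\<bar>(g x - h x) - (g y - h y)\<bar> \<le> 2 * C * d x y powr \<gamma>'"
        using T(2)[OF gh(1) xy(1,2)] T(2)[OF gh(2) xy(1,2)] by linarith
      also have "\<dots> = 2 * C * d x y powr (\<gamma>' - \<gamma>) * d x y powr \<gamma>" by (simp add: powr_add[symmetric] mult.assoc)
      also have "\<dots> \<le> 2 * C * \<rho> powr (\<gamma>' - \<gamma>) * d x y powr \<gamma>"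
        using True dp C \<gamma> by (intro mult_right_mono mult_left_mono powr_mono2) auto
      finally show ?thesis unfolding \<rho>(2) .
    next
      case False
      have "\<bar>(g x - h x) - (g y - h y)\<bar> \<le> 2 * S" using sup[OF xy(1)] sup[OF xy(2)] by linarith
      also have "\<dots> \<le> e / 2 * \<rho> powr \<gamma>" by (rule S)
      also have "\<dots> \<le> e / 2 * d x y powr \<gamma>" using False e \<rho> \<gamma> by (intro mult_left_mono powr_mono2) auto
      finally show ?thesis .
    qed
    have "Holder_norm X d \<gamma> (\<lambda>x. g x - h x) \<le> ennreal (S + e / 2)"
    proof (rule Holder_norm_leI[where a = S and L = "e / 2" and f = "\<lambda>x. g x - h x"])
      show "0 \<le> S" "0 \<le> e / 2" using S e by auto
    qed (use sup hol in blast)+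
    also have "\<dots> \<le> ennreal e" using S by (intro ennreal_leI) simp
    finally show ?thesis using e(2) by (rule le_less_trans)
  qed
  then show "\<exists>c :: ('a \<Rightarrow> real) \<Rightarrow> ('a \<Rightarrow> int). finite (c ` T) \<and>
    (\<forall>g\<in>T. \<forall>h\<in>T. c g = c h \<longrightarrow> Holder_norm X d \<gamma> (\<lambda>x. g x - h x) < \<epsilon>)"
    using fin by blast
qed

lemma besov_bounded_holder_representative:
  assumes u: "0 < u" and \<beta>: "0 < \<beta>" and super: "s < \<beta> * u" and A: "0 \<le> A"
  obtains C where "0 < C" "\<And>f. besov_bounded M d \<beta> u A f \<Longrightarrow>
    \<exists>F. (AE x in M. f x = F x) \<and> holder_bounded X C (\<beta> - s / u) F"
proof -
  define \<gamma> where "\<gamma> = \<beta> - s / u"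
  have \<gamma>: "0 < \<gamma>" using super u by (simp add: \<gamma>_def field_simps)
  obtain A' where A': "0 < A'" "\<And>f. besov_bounded M d \<beta> u A f \<Longrightarrow> \<exists>w E. profile \<beta> u A' f w E"
    using besov_bounded_profile[OF \<beta> u A] by auto
  obtain C where C: "0 < C"
    "\<And>f w E. profile \<beta> u A' f w E \<Longrightarrow> \<exists>N\<in>null_sets M.
       holder_bounded (X - N) C \<gamma> f"
    using profile_holder_supercritical[OF A'(1) u \<beta> super] unfolding \<gamma>_def by metis
  have Kp: "1 \<le> K\<^sup>2" using K1 by (simp add: one_le_power)
  define C' where "C' = C * (K\<^sup>2) powr \<gamma>"
  have "1 \<le> (K\<^sup>2) powr \<gamma>" using Kp \<gamma> by (intro ge_one_powr_ge_zero) auto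
  then have "C * 1 \<le> C'" unfolding C'_def using C by (intro mult_left_mono) auto
  then have C': "C \<le> C'" "0 < C'" using C by auto
  have "\<exists>F. (AE x in M. f x = F x) \<and> holder_bounded X C' \<gamma> F" if f: "besov_bounded M d \<beta> u A f" for f
  proof -
    obtain w E where P: "profile \<beta> u A' f w E" using A'(2)[OF f] by blast
    obtain N where N: "N \<in> null_sets M" "\<And>x. x \<in> X - N \<Longrightarrow> \<bar>f x\<bar> \<le> C"
       "\<And>x y. x \<in> X - N \<Longrightarrow> y \<in> X - N \<Longrightarrow> \<bar>f x - f y\<bar> \<le> C * d x y powr \<gamma>"
      using C(2)[OF P] by blast
    obtain F where F: "\<forall>x\<in>X - N. F x = f x" "\<forall>x\<in>X. \<bar>F x\<bar> \<le> C"
      "\<forall>x\<in>X. \<forall>y\<in>X. \<bar>F x - F y\<bar> \<le> C * (K\<^sup>2 * d x y) powr \<gamma>"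
      using holder_extension[OF \<gamma> less_imp_le[OF C(1)] N] by blast
    have "AE x in M. f x = F x" using AE_not_in[OF N(1)] AE_space by eventually_elim (use F in auto)
    moreover have "\<bar>F x\<bar> \<le> C'" if "x \<in> X" for x using F(2) C' that by force
    moreover have "\<bar>F x - F y\<bar> \<le> C' * d x y powr \<gamma>" if "x \<in> X" "y \<in> X" for x y
      using F(3) that Kp d_nonneg[OF that] by (simp add: C'_def powr_mult mult.assoc)
    ultimately show ?thesis by blast
  qed
  then show thesis using that C' unfolding \<gamma>_def by blast
qed

text \<open>Bounded sets of the source space have representatives bounded in the Hoelder class of order \<open>\<beta> - s / u\<close>, and uniqueness
of the representative passes this bound on to every member of the image.\<close>

lemma compact_embedding_Holder:
  assumes u: "0 < u" and \<beta>: "0 < \<beta>" and super: "s < \<beta> * u" and \<gamma>: "0 < \<gamma>" "\<gamma> < \<beta> - s / u"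
    and Sp: "\<And>f R. f \<in> Sp \<Longrightarrow> 0 \<le> R \<Longrightarrow> N f \<le> ennreal R \<Longrightarrow> besov_bounded M d \<beta> u ((R + 1) powr u) f"
    and fin: "\<And>f. f \<in> Sp \<Longrightarrow> N f < \<infinity>"
  shows "compact_embedding M Sp N (Holder_space X d \<gamma>) (Holder_norm X d \<gamma>)"
proof -
  define \<gamma>' where "\<gamma>' = \<beta> - s / u"
  have \<gamma>': "0 < \<gamma>'" using \<gamma> by (simp add: \<gamma>'_def)
  have rep: "\<exists>C>0. \<forall>f. besov_bounded M d \<beta> u ((R + 1) powr u) f \<longrightarrow>
    (\<exists>F. (AE x in M. f x = F x) \<and> holder_bounded X C \<gamma>' F)" for R
  proof (rule besov_bounded_holder_representative[OF u \<beta> super powr_ge_zero, of "R + 1" u])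
    fix C assume "0 < C" "\<And>f. besov_bounded M d \<beta> u ((R + 1) powr u) f \<Longrightarrow>
      \<exists>F. (AE x in M. f x = F x) \<and> holder_bounded X C (\<beta> - s / u) F"
    then show ?thesis unfolding \<gamma>'_def by (intro exI[of _ C] conjI allI impI)
  qed
  show ?thesis unfolding compact_embedding_def
  proof (intro conjI ballI allI impI)
    fix f assume f: "f \<in> Sp"
    obtain R where R: "N f = ennreal R" "0 \<le> R" using fin[OF f] by (cases "N f" rule: ennreal_cases) auto
    have bb: "besov_bounded M d \<beta> u ((R + 1) powr u) f" using Sp[OF f R(2)] R(1) by simp
    obtain C F where C: "0 < C" and F: "AE x in M. f x = F x" "\<And>x. x \<in> X \<Longrightarrow> \<bar>F x\<bar> \<le> C"
      "\<And>x y. x \<in> X \<Longrightarrow> y \<in> X \<Longrightarrow> \<bar>F x - F y\<bar> \<le> C * d x y powr \<gamma>'"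
      using rep[of R] bb by meson
    have "\<bar>F x - F y\<bar> \<le> 2 * C * d x y powr \<gamma>" if xy: "x \<in> X" "y \<in> X" "x \<noteq> y" for x y
    proof (cases "d x y \<le> 1")
      case True
      then have "d x y powr \<gamma>' \<le> d x y powr \<gamma>" using d_pos[OF xy] \<gamma> by (intro powr_mono') (auto simp: \<gamma>'_def)
      then have "C * d x y powr \<gamma>' \<le> C * d x y powr \<gamma>" using C by (intro mult_left_mono) auto
      moreover have "0 \<le> C * d x y powr \<gamma>" using C by simp
      ultimately show ?thesis using F(3)[OF xy(1,2)] by linarith
    next
      case False
      then have "1 \<le> d x y powr \<gamma>" using \<gamma> by (intro ge_one_powr_ge_zero) auto
      then have "2 * C * 1 \<le> 2 * C * d x y powr \<gamma>" using C by (intro mult_left_mono) auto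
      then show ?thesis using F(2)[OF xy(1)] F(2)[OF xy(2)] by linarith
    qed
    then have "Holder_norm X d \<gamma> F \<le> ennreal (C + 2 * C)"
      using C F(2) by (intro Holder_norm_leI) auto
    then have "F \<in> Holder_space X d \<gamma>" unfolding Holder_space_def by (auto intro: le_less_trans)
    then show "\<exists>g\<in>Holder_space X d \<gamma>. AE x in M. f x = g x" using F(1) by blast
  next
    fix S assume S: "S \<subseteq> Sp" and "\<exists>R<\<infinity>. \<forall>f\<in>S. N f \<le> R"
    then obtain R' where R': "R' < \<infinity>" "\<forall>f\<in>S. N f \<le> R'" by blast
    obtain R where R: "R' = ennreal R" "0 \<le> R" using R'(1) by (cases R' rule: ennreal_cases) auto
    obtain C where C: "0 < C" and rC: "\<And>f. besov_bounded M d \<beta> u ((R + 1) powr u) f \<Longrightarrow>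
        \<exists>F. (AE x in M. f x = F x) \<and> holder_bounded X C \<gamma>' F"
      using rep[of R] by blast
    let ?T = "{g \<in> Holder_space X d \<gamma>. \<exists>f\<in>S. AE x in M. f x = g x}"
    have key: "holder_bounded X C \<gamma>' g"
      if g: "g \<in> ?T" for g
    proof -
      obtain f where f: "f \<in> S" "AE x in M. f x = g x" using g by blast
      have "besov_bounded M d \<beta> u ((R + 1) powr u) f" using f(1) S R'(2) R by (intro Sp) auto
      from rC[OF this] obtain F where F: "AE x in M. f x = F x" "\<forall>x\<in>X. \<bar>F x\<bar> \<le> C"
        "\<forall>x\<in>X. \<forall>y\<in>X. \<bar>F x - F y\<bar> \<le> C * d x y powr \<gamma>'" by blast
      have "AE x in M. F x = g x" using F(1) f(2) by eventually_elim simp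
      then obtain Z where Z: "Z \<in> null_sets M" "{x \<in> X. F x \<noteq> g x} \<subseteq> Z"
        by (auto elim!: AE_E simp: null_sets_def)
      obtain L where L: "0 \<le> L" "\<And>x y. x \<in> X \<Longrightarrow> y \<in> X \<Longrightarrow> \<bar>g x - g y\<bar> \<le> L * d x y powr \<gamma>"
        using Holder_spaceD g by blast
      have "F x = g x" if x: "x \<in> X" for x
        by (rule holder_eq_off_null[OF \<gamma>' \<gamma>(1) less_imp_le[OF C] L(1) Z(1) _ L(2) _ x]) (use F Z in auto)
      then show ?thesis using F by auto
    qed
    show "qnorm_totally_bounded (Holder_norm X d \<gamma>) ?T"
      by (rule holder_class_totally_bounded[OF \<gamma>(1) _ C, of \<gamma>']) (use key \<gamma> in \<open>auto simp: \<gamma>'_def\<close>)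
  qed
qed

end

section \<open>Compactness of all embeddings\<close>

context bounded_regular_space
begin

lemma compact_Lp_from_moment_bound:
  assumes \<beta>: "0 < \<beta>" and u: "0 < u" and v: "0 < v" and r: "0 < r" "r < Q"
    and moment: "\<And>A. 0 < A \<Longrightarrow> \<exists>H\<ge>0. \<forall>f w E. profile \<beta> u A f w E \<longrightarrow>
      power_integral M Q f \<le> ennreal H"
  shows "HTL_compact_Lp M d \<beta> u v r \<and> HB_compact_Lp M d \<beta> u v r"
  unfolding HTL_compact_Lp_def HB_compact_Lp_def
proof
  show "compact_embedding M (HTL_space M d \<beta> u v) (HTL_norm M d \<beta> u v) (Lp_space M r) (Lp_qnorm M r)"
    by (rule compact_embedding_Lp[OF u \<beta> r _ _ moment])
      (auto intro: HTL_norm_besov_bounded[OF u v] simp: HTL_space_def)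
  show "compact_embedding M (HB_space M d \<beta> u v) (HB_norm M d \<beta> u v) (Lp_space M r) (Lp_qnorm M r)"
    by (rule compact_embedding_Lp[OF u \<beta> r _ _ moment])
      (auto intro: HB_norm_besov_bounded[OF u v] simp: HB_space_def)
qed

text \<open>Since \<open>\<beta> > 0\<close>, also \<open>u < su/(s - \<beta>u)\<close>; this makes room for a moment of order \<open>Q\<close> above both \<open>r\<close> and \<open>u\<close>.\<close>

lemma compact_Lp_subcritical:
  assumes \<beta>: "0 < \<beta>" and u: "0 < u" and v: "0 < v" and sub: "\<beta> * u < s"
    and r: "0 < r" "r < s * u / (s - \<beta> * u)"
  shows "HTL_compact_Lp M d \<beta> u v r \<and> HB_compact_Lp M d \<beta> u v r"
proof -
  have "u < s * u / (s - \<beta> * u)" using sub u \<beta> by (simp add: pos_less_divide_eq algebra_simps)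
  then obtain Q where "max r u < Q" and Q3: "Q < s * u / (s - \<beta> * u)"
    using r dense[of "max r u" "s * u / (s - \<beta> * u)"] by auto
  then have Q: "r < Q" "u \<le> Q" by auto
  have "\<exists>H\<ge>0. \<forall>f w E. profile \<beta> u A f w E \<longrightarrow> power_integral M Q f \<le> ennreal H"
    if "0 < A" for A by (rule subcritical_moment_bound[OF that u \<beta> sub Q(2) Q3]) blast
  then show ?thesis by (rule compact_Lp_from_moment_bound[OF \<beta> u v r(1) Q(1)])
qed

lemma compact_Lp_supercritical:
  assumes \<beta>: "0 < \<beta>" and u: "0 < u" and v: "0 < v" and super: "s < \<beta> * u" and r: "0 < r"
  shows "HTL_compact_Lp M d \<beta> u v r \<and> HB_compact_Lp M d \<beta> u v r"
proof -
  have Q: "r < r + 1" "0 < r + 1" using r by auto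
  have "\<exists>H\<ge>0. \<forall>f w E. profile \<beta> u A f w E \<longrightarrow> power_integral M (r + 1) f \<le> ennreal H"
    if "0 < A" for A by (rule supercritical_moment_bound[OF that u \<beta> super Q(2)]) blast
  then show ?thesis by (rule compact_Lp_from_moment_bound[OF \<beta> u v r Q(1)])
qed

lemma compact_Holder_supercritical:
  assumes \<beta>: "0 < \<beta>" and u: "0 < u" and v: "0 < v" and super: "s < \<beta> * u"
    and \<gamma>: "0 < \<gamma>" "\<gamma> < \<beta> - s / u"
  shows "HTL_compact_Holder M d \<beta> u v \<gamma>" "HB_compact_Holder M d \<beta> u v \<gamma>"
proof -
  show "HTL_compact_Holder M d \<beta> u v \<gamma>" unfolding HTL_compact_Holder_def
    by (rule compact_embedding_Holder[OF u \<beta> super \<gamma>])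
      (auto intro: HTL_norm_besov_bounded[OF u v] simp: HTL_space_def)
  show "HB_compact_Holder M d \<beta> u v \<gamma>" unfolding HB_compact_Holder_def
    by (rule compact_embedding_Holder[OF u \<beta> super \<gamma>])
      (auto intro: HB_norm_besov_bounded[OF u v] simp: HB_space_def)
qed

end

theorem theorem6p20:
  fixes M :: "'a measure" and d :: "'a \<Rightarrow> 'a \<Rightarrow> real"
    and \<alpha> p p' :: real and q :: ennreal
  assumes "quasi_metric_measure_space M d"
    and "doubling_measure M d"
    and "0 < \<alpha>" and "0 < p" and "0 < p'" and "p' \<le> p" and "0 < q"
    and "admissible_smoothness (space M) d q \<alpha>"
    and "HTL_compact_Lp M d \<alpha> p q p' \<or> HB_compact_Lp M d \<alpha> p q p'"
  shows "\<forall>(\<beta>::real) (u::real) (v::ennreal) (s::real).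
    0 < \<beta> \<longrightarrow> 0 < u \<longrightarrow> 0 < v \<longrightarrow> 0 < s \<longrightarrow>
    (\<forall>x\<in>space M. \<forall>r>0. \<forall>l\<ge>1.
       emeasure M (qm_ball (space M) d x (l * r))
         \<le> ennreal (4 powr s * l powr s) * emeasure M (qm_ball (space M) d x r)) \<longrightarrow>
    (\<beta> * u < s \<longrightarrow>
       (\<forall>q'::real. 0 < q' \<and> q' < s * u / (s - \<beta> * u) \<longrightarrow>
          HTL_compact_Lp M d \<beta> u v q' \<and> HB_compact_Lp M d \<beta> u v q')) \<and>
    (s < \<beta> * u \<longrightarrow>
       (\<forall>\<gamma>::real. 0 < \<gamma> \<and> \<gamma> < \<beta> - s / u \<longrightarrow>
          HTL_compact_Holder M d \<beta> u v \<gamma> \<and> HB_compact_Holder M d \<beta> u v \<gamma>) \<and>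
       (\<forall>q'::real. 0 < q' \<longrightarrow>
          HTL_compact_Lp M d \<beta> u v q' \<and> HB_compact_Lp M d \<beta> u v q'))"
proof (intro allI impI)
  fix \<beta> u s :: real and v :: ennreal
  assume \<beta>: "0 < \<beta>" and u: "0 < u" and v: "0 < v" and s: "0 < s"
    and growth: "\<forall>x\<in>space M. \<forall>r>0. \<forall>l\<ge>1.
       emeasure M (qm_ball (space M) d x (l * r))
         \<le> ennreal (4 powr s * l powr s) * emeasure M (qm_ball (space M) d x r)"
  obtain K where K: "quasi_metric_measure M d K"
    using quasi_metric_measure_exists[OF assms(1)] .
  obtain D where D: "\<And>x y. x \<in> space M \<Longrightarrow> y \<in> space M \<Longrightarrow> d x y < D"
    using quasi_metric_measure.compact_embedding_imp_bounded[OF K assms(8,3,7,5,6,2,9)] by blast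
  obtain b where R: "bounded_regular_space M d K s b"
    using quasi_metric_measure.bounded_regular_space_exists[OF K D s] growth by blast
  note Lp_sub = bounded_regular_space.compact_Lp_subcritical[OF R \<beta> u v]
    and Lp_super = bounded_regular_space.compact_Lp_supercritical[OF R \<beta> u v]
    and Holder = bounded_regular_space.compact_Holder_supercritical[OF R \<beta> u v]
  show "(\<beta> * u < s \<longrightarrow>
       (\<forall>q'::real. 0 < q' \<and> q' < s * u / (s - \<beta> * u) \<longrightarrow>
          HTL_compact_Lp M d \<beta> u v q' \<and> HB_compact_Lp M d \<beta> u v q')) \<and>
    (s < \<beta> * u \<longrightarrow>
       (\<forall>\<gamma>::real. 0 < \<gamma> \<and> \<gamma> < \<beta> - s / u \<longrightarrow>
          HTL_compact_Holder M d \<beta> u v \<gamma> \<and> HB_compact_Holder M d \<beta> u v \<gamma>) \<and>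
       (\<forall>q'::real. 0 < q' \<longrightarrow>
          HTL_compact_Lp M d \<beta> u v q' \<and> HB_compact_Lp M d \<beta> u v q'))"
    using Lp_sub Lp_super Holder by auto
qed

end
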